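(* Assume: (i) $\gamma\|A\|^2<1$ and $\gamma\|A+\bar A\|^2<1$; (ii) $Q,\bar Q,R,\bar R$ are symmetric with $Q\succeq0$, $\tilde Q\succeq0$, $R\succ0$, $\tilde R\succ0$; (iii) $\max\{\lambda_{min}(\Sigma_{y_0}),\lambda_{min}(\Sigma^1)\}>0$ and $\max\{\lambda_{min}(\Sigma_{z_0}),\lambda_{min}(\Sigma^0)\}>0$. Let $\theta^{(0)}=(K^{(0)},L^{(0)})\in\Theta$, let $\eta>0$, and let $\theta^{(k)}=(K^{(k)},L^{(k)})$, $k\ge0$, be generated by $$K^{(k+1)}=K^{(k)}-\eta\nabla_KC_y(K^{(k)}),\qquad L^{(k+1)}=L^{(k)}-\eta\nabla_LC_z(L^{(k)}).$$ Let $C_0=C(\theta^{(0)})$ and $\nu_{pl}=\min\{\nu_y,\nu_z\}/2$, and assume that $$\eta\le\tfrac14\min\big\{h_{var,y}(C_0)^{-1},\,h_{hess,y}(C_0)^{-1},\,h_{var,z}(C_0)^{-1},\,h_{hess,z}(C_0)^{-1}\big\}.$$ Then for every $k\ge0$, $C(\theta^{(k+1)})\le C(\theta^{(k)})\le C_0$ and $$C(\theta^{(k+1)})-C(\theta^* )\le(1-\eta\nu_{pl})\big(C(\theta^{(k)})-C(\theta^* )\big).$$ Moreover, for every $\varepsilon>0$, $$C(\theta^{(k)})-C(\theta^* )\le\varepsilon\big(C(\theta^{(0)})-C(\theta^* )\big)\qquad\text{whenever }k\ge\frac{1}{\eta\nu_{pl}}\log\Big(\frac1\varepsilon\Big).$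$
   Context: Let $\gamma\in(0,1)$, $A,\bar A,Q,\bar Q\in\mathbb R^{d\times d}$, $B,\bar B\in\mathbb R^{d\times\ell}$, $R,\bar R\in\mathbb R^{\ell\times\ell}$; $\tilde A=A+\bar A$, $\tilde B=B+\bar B$, $\tilde Q=Q+\bar Q$, $\tilde R=R+\bar R$. $\|\cdot\|$ is the Euclidean norm of vectors and the spectral norm of matrices; $\lambda_{min}$ is the smallest eigenvalue of a symmetric matrix. Noise: $\mathbb R^d$-valued sub-gaussian vectors $\varepsilon_0,\varepsilon^0_0$ and sequences $(\varepsilon_{t+1})_{t\ge0},(\varepsilon^0_{t+1})_{t\ge0}$; each sequence is i.i.d. with mean zero, the two sequences are independent of each other, and $\varepsilon_0,\varepsilon^0_0$ are independent of each other and of both sequences (not assumed centered). $\mathcal F^0_t=\sigma(\varepsilon^0_0,\dots,\varepsilon^0_t)$; for a process, $\bar\xi_t=\mathbb E[\xi_t\mid\mathcal F^0_t]$. $\Theta=\{\theta=(K,L)\in\mathbb R^{\ell\times d}\times\mathbb R^{\ell\times d}:\gamma\|A-BK\|^2<1,\ \gamma\|\tilde A-\tilde BL\|^2<1\}$. For $\theta=(K,L)$, $X^\theta$ is given by $X_0=\varepsilon_0^0+\varepsilon_0$, $X_{t+1}=AX_t+\bar A\bar X_t+Bu_t+\bar B\bar u_t+\varepsilon^0_{t+1}+\varepsilon_{t+1}$ with $u_t=-K(X_t-\bar X_t)-L\bar X_t$, and $C(\theta)=\mathbb E\sum_{t\ge0}\gamma^t[(X_t-\bar X_t)^\top Q(X_t-\bar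 X_t)+\bar X_t^\top\tilde Q\bar X_t+(u_t-\bar u_t)^\top R(u_t-\bar u_t)+\bar u_t^\top\tilde R\bar u_t]$. With $y_t=X^\theta_t-\bar X^\theta_t$ and $z_t=\bar X^\theta_t$: $y_{t+1}=(A-BK)y_t+\varepsilon_{t+1}$, $y_0=\varepsilon_0-\mathbb E\varepsilon_0$; $z_{t+1}=(\tilde A-\tilde BL)z_t+\varepsilon^0_{t+1}$, $z_0=\varepsilon^0_0+\mathbb E\varepsilon_0$. Set $C_y(K)=\mathbb E\sum_t\gamma^ty_t^\top(Q+K^\top RK)y_t$, $C_z(L)=\mathbb E\sum_t\gamma^tz_t^\top(\tilde Q+L^\top\tilde RL)z_t$ (so $C(\theta)=C_y(K)+C_z(L)$), $\Sigma_K=\mathbb E\sum_t\gamma^ty_ty_t^\top$, $\Sigma_L=\mathbb E\sum_t\gamma^tz_tz_t^\top$. $\Sigma_{y_0}=\mathbb E[y_0y_0^\top]$, $\Sigma_{z_0}=\mathbb E[z_0z_0^\top]$, $\Sigma^1=\mathbb E[\varepsilon_1\varepsilon_1^\top]$, $\Sigma^0=\mathbb E[\varepsilon^0_1(\varepsilon^0_1)^\top]$, $\lambda^1_y=\lambda_{min}(\Sigma_{y_0}+\frac{\gamma}{1-\gamma}\Sigma^1)$, $\lambda^0_z=\lambda_{min}(\Sigma_{z_0}+\frac{\gamma}{1-\gamma}\Sigma^0)$. Optimal parameter $\theta^*=(K^*,L^* )$: let $P^{y}$ be the symmetric positive semi-definite solution of $P^y=Q+\gamma A^\top P^yA-\gamma^2A^\top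 P^yB(R+\gamma B^\top P^yB)^{-1}B^\top P^yA$ and $P=2\gamma P^y(I_d+\gamma BR^{-1}B^\top P^y)^{-1}A$; then $K^*=\frac12R^{-1}B^\top P$. $L^*$ is defined in the same way from $(\tilde A,\tilde B,\tilde Q,\tilde R)$. The control with parameter $\theta^*$ is the optimal control of the mean-field control problem. Constants: $\nu_y=4(\lambda^1_y)^2\lambda_{min}(R)/\|\Sigma_{K^*}\|$, $\nu_z=4(\lambda^0_z)^2\lambda_{min}(\tilde R)/\|\Sigma_{L^*}\|$, $$h_{var,y}(C_0)=8\frac{(1+1/\sqrt\gamma)\|B\|C_0^3}{(\lambda^1_y)^2\lambda_{min}(Q)^3}\sqrt{\Big(\|R\|+\gamma\|B\|^2\frac{C_0}{\lambda^1_y}\Big)\frac{C_0}{\lambda^1_y}},\qquad h_{hess,y}(C_0)=\frac{2C_0}{\lambda_{min}(Q)}\Big(\|R\|+\gamma\|B\|^2\frac{C_0}{\lambda^1_y}\Big),$$ and $h_{var,z},h_{hess,z}$ are obtained by replacing $(B,Q,R,\lambda^1_y)$ by $(\tilde B,\tilde Q,\tilde R,\lambda^0_z)$. Conventions $1/0=+\infty$, $1/\infty=0$ (so the step-size condition is meaningful when $\lambda_{min}(Q),\lambda_{min}(\tilde Q)>0$). *)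

theory Defs
  imports "HOL-Probability.Probability"
begin

text \<open>
  Dimensions are index types: a matrix in \<open>\<real>\<^bsup>m \<times> n\<^esup>\<close> has type \<open>real^'n^'m\<close>. Hence \<open>A :: real^'d^'d\<close>,
  \<open>B :: real^'l^'d\<close> and the gains are \<open>K, L :: real^'d^'l\<close>.
\<close>

subsection \<open>Matrices\<close>

text \<open>The library \<open>norm\<close> on matrices is the Frobenius norm, hence a separate constant.\<close>

definition spec_norm :: "real^'n^'m \<Rightarrow> real" where
  "spec_norm S = onorm (\<lambda>x. S *v x)"

definition lambda_min :: "real^'n^'n \<Rightarrow> real" where
  "lambda_min S = Min {c. \<exists>v. v \<noteq> 0 \<and> S *v v = c *\<^sub>R v}"

definition qform :: "real^'n^'n \<Rightarrow> real^'n \<Rightarrow> real" where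
  "qform S x = x \<bullet> (S *v x)"

definition symmetric :: "real^'n^'n \<Rightarrow> bool" where
  "symmetric S \<longleftrightarrow> transpose S = S"

definition pos_semidef :: "real^'n^'n \<Rightarrow> bool" where
  "pos_semidef S \<longleftrightarrow> symmetric S \<and> (\<forall>x. 0 \<le> qform S x)"

definition pos_def :: "real^'n^'n \<Rightarrow> bool" where
  "pos_def S \<longleftrightarrow> symmetric S \<and> (\<forall>x. x \<noteq> 0 \<longrightarrow> 0 < qform S x)"

definition outer :: "real^'n \<Rightarrow> real^'m \<Rightarrow> real^'m^'n" where
  "outer x y = (\<chi> i j. x $ i * y $ j)"

text \<open>
  For functions of a matrix, the inner product used by \<open>GDERIV\<close> is the Frobenius one, so this is the
  matrix of partial derivatives.
\<close>

definition grad :: "('a::real_inner \<Rightarrow> real) \<Rightarrow> 'a \<Rightarrow> 'a" where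
  "grad f x = (THE D. GDERIV f x :> D)"


subsection \<open>Noise\<close>

text \<open>Sub-gaussian vector: the one-dimensional marginals have uniformly bounded \<open>\<psi>\<^sub>2\<close> Orlicz norm.\<close>

definition subgaussian :: "'w measure \<Rightarrow> ('w \<Rightarrow> real^'d) \<Rightarrow> bool" where
  "subgaussian M X \<longleftrightarrow> X \<in> borel_measurable M \<and>
     (\<exists>s>0. \<forall>v. norm v = 1 \<longrightarrow> (\<integral>\<^sup>+ \<omega>. ennreal (exp ((X \<omega> \<bullet> v)\<^sup>2 / s\<^sup>2)) \<partial>M) \<le> 2)"

text \<open>
  Index \<open>0\<close> carries the initial idiosyncratic (\<open>eps\<close>) and common (\<open>eps0\<close>) randomness, which need not
  be centred nor distributed like the rest; the indices \<open>Suc t\<close> carry the two i.i.d. noise sequences.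
\<close>

definition mf_noise ::
  "'w measure \<Rightarrow> (nat \<Rightarrow> 'w \<Rightarrow> real^'d) \<Rightarrow> (nat \<Rightarrow> 'w \<Rightarrow> real^'d) \<Rightarrow> bool" where
  "mf_noise M eps eps0 \<longleftrightarrow>
     prob_space M \<and>
     (\<forall>t. subgaussian M (eps t) \<and> subgaussian M (eps0 t)) \<and>
     prob_space.indep_vars M (\<lambda>_. borel) (case_sum eps eps0) (UNIV :: (nat + nat) set) \<and>
     (\<forall>t. distr M borel (eps (Suc t)) = distr M borel (eps 1) \<and>
          distr M borel (eps0 (Suc t)) = distr M borel (eps0 1)) \<and>
     (\<forall>t. (\<integral>\<omega>. eps (Suc t) \<omega> \<partial>M) = 0 \<and> (\<integral>\<omega>. eps0 (Suc t) \<omega> \<partial>M) = 0)"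

definition common_filt :: "'w measure \<Rightarrow> (nat \<Rightarrow> 'w \<Rightarrow> real^'d) \<Rightarrow> nat \<Rightarrow> 'w measure" where
  "common_filt M eps0 t =
     sigma (space M) (\<Union>s\<in>{..t}. {eps0 s -` S \<inter> space M | S. S \<in> sets borel})"

text \<open>Conditional mean given the common noise up to time \<open>t\<close>, taken componentwise.\<close>

definition cond_mean ::
  "'w measure \<Rightarrow> (nat \<Rightarrow> 'w \<Rightarrow> real^'d) \<Rightarrow> nat \<Rightarrow> ('w \<Rightarrow> real^'n) \<Rightarrow> 'w \<Rightarrow> real^'n" where
  "cond_mean M eps0 t \<xi> = (\<lambda>\<omega>. \<chi> i. real_cond_exp M (common_filt M eps0 t) (\<lambda>\<omega>'. \<xi> \<omega>' $ i) \<omega>)"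


subsection \<open>The mean-field control problem\<close>

definition admissible ::
  "real \<Rightarrow> real^'d^'d \<Rightarrow> real^'d^'d \<Rightarrow> real^'l^'d \<Rightarrow> real^'l^'d \<Rightarrow> ((real^'d^'l) \<times> (real^'d^'l)) set" where
  "admissible \<gamma> A Ab B Bb =
     {(K, L). \<gamma> * (spec_norm (A - B ** K))\<^sup>2 < 1 \<and>
              \<gamma> * (spec_norm ((A + Ab) - (B + Bb) ** L))\<^sup>2 < 1}"

definition mf_control ::
  "'w measure \<Rightarrow> (nat \<Rightarrow> 'w \<Rightarrow> real^'d) \<Rightarrow> (real^'d^'l) \<times> (real^'d^'l) \<Rightarrow> nat \<Rightarrow>
   ('w \<Rightarrow> real^'d) \<Rightarrow> 'w \<Rightarrow> real^'l" where
  "mf_control M eps0 \<theta> t X = (\<lambda>\<omega>.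
     - (fst \<theta> *v (X \<omega> - cond_mean M eps0 t X \<omega>)) - snd \<theta> *v cond_mean M eps0 t X \<omega>)"

primrec mf_state ::
  "'w measure \<Rightarrow> real^'d^'d \<Rightarrow> real^'d^'d \<Rightarrow> real^'l^'d \<Rightarrow> real^'l^'d \<Rightarrow>
   (nat \<Rightarrow> 'w \<Rightarrow> real^'d) \<Rightarrow> (nat \<Rightarrow> 'w \<Rightarrow> real^'d) \<Rightarrow> (real^'d^'l) \<times> (real^'d^'l) \<Rightarrow>
   nat \<Rightarrow> 'w \<Rightarrow> real^'d" where
  "mf_state M A Ab B Bb eps eps0 \<theta> 0 = (\<lambda>\<omega>. eps0 0 \<omega> + eps 0 \<omega>)"
| "mf_state M A Ab B Bb eps eps0 \<theta> (Suc t) =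
     (let X = mf_state M A Ab B Bb eps eps0 \<theta> t;
          u = mf_control M eps0 \<theta> t X
      in (\<lambda>\<omega>. A *v X \<omega> + Ab *v cond_mean M eps0 t X \<omega>
               + B *v u \<omega> + Bb *v cond_mean M eps0 t u \<omega>
               + eps0 (Suc t) \<omega> + eps (Suc t) \<omega>))"

text \<open>
  The costs take values in \<open>[0, \<infinity>]\<close>. The map \<open>ennreal\<close> would cut off negative terms, but all terms are
  nonnegative as soon as the matrices \<open>Q\<close>, \<open>Q + Qb\<close>, \<open>R\<close>, \<open>R + Rb\<close> are positive semi-definite.
\<close>

definition mf_cost ::
  "'w measure \<Rightarrow> real \<Rightarrow> real^'d^'d \<Rightarrow> real^'d^'d \<Rightarrow> real^'l^'d \<Rightarrow> real^'l^'d \<Rightarrow>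
   real^'d^'d \<Rightarrow> real^'d^'d \<Rightarrow> real^'l^'l \<Rightarrow> real^'l^'l \<Rightarrow>
   (nat \<Rightarrow> 'w \<Rightarrow> real^'d) \<Rightarrow> (nat \<Rightarrow> 'w \<Rightarrow> real^'d) \<Rightarrow> (real^'d^'l) \<times> (real^'d^'l) \<Rightarrow> ennreal" where
  "mf_cost M \<gamma> A Ab B Bb Q Qb R Rb eps eps0 \<theta> =
     (\<integral>\<^sup>+ \<omega>. (\<Sum>t. ennreal (\<gamma> ^ t *
        (let X = mf_state M A Ab B Bb eps eps0 \<theta> t;
             Xb = cond_mean M eps0 t X;
             u = mf_control M eps0 \<theta> t X;
             ub = cond_mean M eps0 t u
         in qform Q (X \<omega> - Xb \<omega>) + qform (Q + Qb) (Xb \<omega>)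
            + qform R (u \<omega> - ub \<omega>) + qform (R + Rb) (ub \<omega>)))) \<partial>M)"


subsection \<open>The two auxiliary linear-quadratic problems\<close>

text \<open>
  Both \<open>y\<close> and \<open>z\<close> follow the recursion \<open>lq_state\<close>: \<open>y\<close> is driven by \<open>noise_y\<close> with \<open>A\<close>, \<open>B\<close>, \<open>K\<close>, and
  \<open>z\<close> by \<open>noise_z\<close> with \<open>A + Ab\<close>, \<open>B + Bb\<close>, \<open>L\<close>. The shifts at time \<open>0\<close> come from
  \<open>y\<^sub>0 = \<epsilon>\<^sub>0 - E \<epsilon>\<^sub>0\<close> and \<open>z\<^sub>0 = \<epsilon>\<^sup>0\<^sub>0 + E \<epsilon>\<^sub>0\<close>.
\<close>

definition noise_y :: "'w measure \<Rightarrow> (nat \<Rightarrow> 'w \<Rightarrow> real^'d) \<Rightarrow> nat \<Rightarrow> 'w \<Rightarrow> real^'d" where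
  "noise_y M eps t = (if t = 0 then (\<lambda>\<omega>. eps 0 \<omega> - (\<integral>\<omega>'. eps 0 \<omega>' \<partial>M)) else eps t)"

definition noise_z ::
  "'w measure \<Rightarrow> (nat \<Rightarrow> 'w \<Rightarrow> real^'d) \<Rightarrow> (nat \<Rightarrow> 'w \<Rightarrow> real^'d) \<Rightarrow> nat \<Rightarrow> 'w \<Rightarrow> real^'d" where
  "noise_z M eps eps0 t = (if t = 0 then (\<lambda>\<omega>. eps0 0 \<omega> + (\<integral>\<omega>'. eps 0 \<omega>' \<partial>M)) else eps0 t)"

primrec lq_state ::
  "real^'d^'d \<Rightarrow> real^'l^'d \<Rightarrow> (nat \<Rightarrow> 'w \<Rightarrow> real^'d) \<Rightarrow> real^'d^'l \<Rightarrow> nat \<Rightarrow> 'w \<Rightarrow> real^'d" where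
  "lq_state A B w K 0 = w 0"
| "lq_state A B w K (Suc t) = (\<lambda>\<omega>. (A - B ** K) *v lq_state A B w K t \<omega> + w (Suc t) \<omega>)"

definition lq_cost ::
  "'w measure \<Rightarrow> real \<Rightarrow> real^'d^'d \<Rightarrow> real^'l^'d \<Rightarrow> real^'d^'d \<Rightarrow> real^'l^'l \<Rightarrow>
   (nat \<Rightarrow> 'w \<Rightarrow> real^'d) \<Rightarrow> real^'d^'l \<Rightarrow> ennreal" where
  "lq_cost M \<gamma> A B Q R w K =
     (\<integral>\<^sup>+ \<omega>. (\<Sum>t. ennreal (\<gamma> ^ t *
        qform (Q + transpose K ** R ** K) (lq_state A B w K t \<omega>))) \<partial>M)"

definition lq_Sigma ::
  "'w measure \<Rightarrow> real \<Rightarrow> real^'d^'d \<Rightarrow> real^'l^'d \<Rightarrow>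
   (nat \<Rightarrow> 'w \<Rightarrow> real^'d) \<Rightarrow> real^'d^'l \<Rightarrow> real^'d^'d" where
  "lq_Sigma M \<gamma> A B w K =
     (\<integral>\<omega>. (\<Sum>t. \<gamma> ^ t *\<^sub>R outer (lq_state A B w K t \<omega>) (lq_state A B w K t \<omega>)) \<partial>M)"

definition second_moment :: "'w measure \<Rightarrow> ('w \<Rightarrow> real^'d) \<Rightarrow> real^'d^'d" where
  "second_moment M X = (\<integral>\<omega>. outer (X \<omega>) (X \<omega>) \<partial>M)"

text \<open>With \<open>noise_y\<close> and \<open>noise_z\<close> this gives \<open>\<lambda>\<^sup>1\<^sub>y\<close> and \<open>\<lambda>\<^sup>0\<^sub>z\<close>, respectively.\<close>

definition lq_lambda :: "'w measure \<Rightarrow> real \<Rightarrow> (nat \<Rightarrow> 'w \<Rightarrow> real^'d) \<Rightarrow> real" where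
  "lq_lambda M \<gamma> w =
     lambda_min (second_moment M (w 0) + (\<gamma> / (1 - \<gamma>)) *\<^sub>R second_moment M (w 1))"


subsection \<open>Optimal gains\<close>

definition riccati_solution ::
  "real \<Rightarrow> real^'d^'d \<Rightarrow> real^'l^'d \<Rightarrow> real^'d^'d \<Rightarrow> real^'l^'l \<Rightarrow> real^'d^'d \<Rightarrow> bool" where
  "riccati_solution \<gamma> A B Q R P \<longleftrightarrow> pos_semidef P \<and>
     P = Q + \<gamma> *\<^sub>R (transpose A ** P ** A)
           - \<gamma>\<^sup>2 *\<^sub>R (transpose A ** P ** B
                     ** matrix_inv (R + \<gamma> *\<^sub>R (transpose B ** P ** B))
                     ** transpose B ** P ** A)"

definition optimal_gain ::
  "real \<Rightarrow> real^'d^'d \<Rightarrow> real^'l^'d \<Rightarrow> real^'l^'l \<Rightarrow> real^'d^'d \<Rightarrow> real^'d^'l" where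
  "optimal_gain \<gamma> A B R Py =
     (let P = (2 * \<gamma>) *\<^sub>R
                (Py ** matrix_inv (mat 1 + \<gamma> *\<^sub>R (B ** matrix_inv R ** transpose B ** Py)) ** A)
      in (1 / 2) *\<^sub>R (matrix_inv R ** transpose B ** P))"


subsection \<open>Constants\<close>

definition pl_const ::
  "'w measure \<Rightarrow> real \<Rightarrow> real^'d^'d \<Rightarrow> real^'l^'d \<Rightarrow> real^'l^'l \<Rightarrow>
   (nat \<Rightarrow> 'w \<Rightarrow> real^'d) \<Rightarrow> real^'d^'l \<Rightarrow> real" where
  "pl_const M \<gamma> A B R w Kopt =
     4 * (lq_lambda M \<gamma> w)\<^sup>2 * lambda_min R / spec_norm (lq_Sigma M \<gamma> A B w Kopt)"

text \<open>
  The division by a power of \<open>lambda_min Q\<close> takes place in \<open>ereal\<close>, where \<open>1 / 0 = \<infinity>\<close> and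
  \<open>1 / \<infinity> = 0\<close>. The parameter \<open>lam\<close> stands for \<open>\<lambda>\<^sup>1\<^sub>y\<close> or \<open>\<lambda>\<^sup>0\<^sub>z\<close>.
\<close>

definition h_var ::
  "real \<Rightarrow> real^'l^'d \<Rightarrow> real^'d^'d \<Rightarrow> real^'l^'l \<Rightarrow> real \<Rightarrow> real \<Rightarrow> ereal" where
  "h_var \<gamma> B Q R lam C0 =
     ereal (8 * ((1 + 1 / sqrt \<gamma>) * spec_norm B * C0 ^ 3))
       / ereal (lam\<^sup>2 * lambda_min Q ^ 3)
     * ereal (sqrt ((spec_norm R + \<gamma> * (spec_norm B)\<^sup>2 * (C0 / lam)) * (C0 / lam)))"

definition h_hess ::
  "real \<Rightarrow> real^'l^'d \<Rightarrow> real^'d^'d \<Rightarrow> real^'l^'l \<Rightarrow> real \<Rightarrow> real \<Rightarrow> ereal" where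
  "h_hess \<gamma> B Q R lam C0 =
     ereal (2 * C0) / ereal (lambda_min Q)
     * ereal (spec_norm R + \<gamma> * (spec_norm B)\<^sup>2 * (C0 / lam))"

end

theory Submission
  imports Defs
begin

text \<open>
  Given the common noise, \<open>X\<^sub>t - E[X\<^sub>t | F\<^sup>0\<^sub>t]\<close> and \<open>E[X\<^sub>t | F\<^sup>0\<^sub>t]\<close> are the states \<open>y\<^sub>t\<close>, \<open>z\<^sub>t\<close> of two
  decoupled linear-quadratic problems, so the cost is \<open>C\<^sub>y(K) + C\<^sub>z(L)\<close> and both gains are updated
  independently. For one problem put \<open>N = \<surd>\<gamma> (A - B K)\<close>. Then \<open>\<Sigma>\<close> solves \<open>\<Sigma> = S\<^sub>0 + N \<Sigma> N\<^sup>T\<close>, the value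
  matrix solves \<open>P = Q + K\<^sup>T R K + N\<^sup>T P N\<close>, and with \<open>H = R + \<gamma> B\<^sup>T P B\<close>, \<open>E = H K - \<gamma> B\<^sup>T P A\<close> one has
  \<^emph>\<open>exactly\<close>
  \<open>J(K + D) - J(K) = tr ((D\<^sup>T E + E\<^sup>T D + D\<^sup>T H D) \<Sigma>(K + D))\<close>.
  Completing the square gives the Polyak-Lojasiewicz inequality, and the choice \<open>D = - 2 \<eta> E \<Sigma>\<close> gives
  descent as soon as \<open>\<Sigma>(K + D)\<close> is close to \<open>\<Sigma>(K)\<close>. The iterates need not satisfy the norm
  condition of \<open>\<Theta>\<close>; instead, stability is witnessed by a Lyapunov inequality, and rescaling \<open>\<Sigma>(K)\<close>
  provides a witness for every nearby gain. When \<open>\<lambda>\<^sub>m\<^sub>i\<^sub>n(Q) = 0\<close> the step size condition leaves only the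
  trivial case \<open>C\<^sub>0 = 0\<close>, where \<open>Q = 0\<close> and all gains vanish.
\<close>

subsection \<open>The trace pairing and positive semi-definite matrices\<close>

text \<open>The inner product of matrices is the trace pairing, and \<Sigma> and P solve adjoint
  equations, so costs are pairings and most estimates reduce to comparing quadratic forms. In the
  cost identity the covariance belongs to the new gain, so the real work is to compare \<Sigma>(K +
  D) with \<Sigma>(K). Rescaling bounds the change by f / (1 - f) times \<Sigma>(K). The resulting
  error in the linear term is of order f s |E|, where s bounds \<Sigma>(K), while the decrease is
  measured by G = E \<Sigma>(K), of which only lam |E| \<le> |G| is known. Hence f must stay small
  even after multiplication by s / lam. With s = C0 / q, where q is the smallest eigenvalue of Q,
  the step length contributes one factor s and the smallness of f s / lam contributes (s / lam)^2:
  this is the explicit cube of C0 in \<open>h_var\<close>. The gradient is 2 G, whence the factor 4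
  in the Polyak-Lojasiewicz constant; the errors may use up half of the first-order decrease \<eta>
  |2 G|^2, whence the halved rate.\<close>

lemma matrix_inner_sum: "(X::real^'n^'m) \<bullet> Y = (\<Sum>i\<in>UNIV. \<Sum>j\<in>UNIV. X$i$j * Y$i$j)"
  by (simp add: inner_vec_def)

text \<open>Cyclicity of the trace: left multiplication by \<open>F\<close> has left multiplication
  by \<open>transpose F\<close> as its adjoint.\<close>

lemma inner_matrix_mult_left:
  fixes F :: "real^'k^'m" and G :: "real^'n^'k" and H :: "real^'n^'m"
  shows "(F ** G) \<bullet> H = G \<bullet> (transpose F ** H)"
proof -
  have "(F ** G) \<bullet> H = (\<Sum>i\<in>UNIV. \<Sum>j\<in>UNIV. \<Sum>k\<in>UNIV. F$i$k * G$k$j * H$i$j)"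
    by (simp add: matrix_inner_sum matrix_matrix_mult_def sum_distrib_right)
  also have "\<dots> = (\<Sum>i\<in>UNIV. \<Sum>k\<in>UNIV. \<Sum>j\<in>UNIV. F$i$k * G$k$j * H$i$j)"
    by (rule sum.cong[OF refl], rule sum.swap)
  also have "\<dots> = (\<Sum>k\<in>UNIV. \<Sum>i\<in>UNIV. \<Sum>j\<in>UNIV. F$i$k * G$k$j * H$i$j)"
    by (rule sum.swap)
  also have "\<dots> = (\<Sum>k\<in>UNIV. \<Sum>j\<in>UNIV. \<Sum>i\<in>UNIV. F$i$k * G$k$j * H$i$j)"
    by (rule sum.cong[OF refl], rule sum.swap)
  also have "\<dots> = G \<bullet> (transpose F ** H)"
    by (simp add: matrix_inner_sum matrix_matrix_mult_def transpose_def sum_distrib_left mult_ac)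
  finally show ?thesis .
qed

lemma inner_transpose: "transpose (X::real^'n^'m) \<bullet> transpose Y = X \<bullet> Y"
proof -
  have "transpose X \<bullet> transpose Y = (\<Sum>i\<in>UNIV. \<Sum>j\<in>UNIV. X$j$i * Y$j$i)"
    by (simp add: matrix_inner_sum transpose_def)
  also have "\<dots> = (\<Sum>j\<in>UNIV. \<Sum>i\<in>UNIV. X$j$i * Y$j$i)" by (rule sum.swap)
  finally show ?thesis by (simp add: matrix_inner_sum)
qed

lemma inner_matrix_mult_right:
  fixes F :: "real^'k^'m" and G :: "real^'n^'k" and H :: "real^'n^'m"
  shows "(F ** G) \<bullet> H = F \<bullet> (H ** transpose G)"
proof -
  have "(F ** G) \<bullet> H = (transpose G ** transpose F) \<bullet> transpose H"
    by (subst inner_transpose[symmetric]) (simp only: matrix_transpose_mul)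
  also have "\<dots> = transpose F \<bullet> transpose (H ** transpose G)"
    by (simp only: inner_matrix_mult_left matrix_transpose_mul)
  finally show ?thesis by (simp only: inner_transpose)
qed

lemma matrix_add_rdistrib: "((B + C) ** A) = (B ** A) + (C ** (A::real^'n^'m))"
  by (vector matrix_matrix_mult_def sum.distrib[symmetric] field_simps)

lemma matrix_diff_ldistrib: "(A::real^'n^'m) ** (B - C) = A ** B - A ** C"
  by (vector matrix_matrix_mult_def sum_subtractf[symmetric] field_simps)

lemma matrix_diff_rdistrib: "(B - C) ** (A::real^'n^'m) = B ** A - C ** A"
  by (vector matrix_matrix_mult_def sum_subtractf[symmetric] field_simps)

lemma scaleR_matrix_mult [simp]: "(c *\<^sub>R A) ** (B::real^'n^'m) = c *\<^sub>R (A ** B)"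
  by (vector matrix_matrix_mult_def sum_distrib_left mult_ac)

lemma matrix_mult_scaleR [simp]: "(A::real^'n^'m) ** (c *\<^sub>R B) = c *\<^sub>R (A ** B)"
  by (vector matrix_matrix_mult_def sum_distrib_left mult_ac)

lemma matrix_mult_minus_left [simp]: "(- A) ** (B::real^'n^'m) = - (A ** B)"
  by (vector matrix_matrix_mult_def sum_negf)

lemma matrix_mult_minus_right [simp]: "(A::real^'n^'m) ** (- B) = - (A ** B)"
  by (vector matrix_matrix_mult_def sum_negf)

lemma matrix_mult_zero [simp]: "(A::real^'n^'m) ** 0 = 0" "0 ** (A::real^'n^'m) = 0"
  by (vector matrix_matrix_mult_def)+

lemma transpose_add: "transpose (A + B) = transpose A + transpose (B::real^'n^'m)"
  by (vector transpose_def)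

lemma transpose_diff: "transpose (A - B) = transpose A - transpose (B::real^'n^'m)"
  by (vector transpose_def)

lemma transpose_zero [simp]: "transpose (0::real^'n^'m) = 0"
  by (vector transpose_def)

lemmas matrix_distribs = matrix_add_ldistrib matrix_add_rdistrib matrix_diff_ldistrib
  matrix_diff_rdistrib transpose_add transpose_diff transpose_scalar matrix_transpose_mul
  matrix_mul_assoc

lemma inner_matrix_vector: "x \<bullet> (F *v y) = (transpose F *v x) \<bullet> (y::real^'n)"
  by (metis dot_lmul_matrix transpose_matrix_vector)

lemma qform_add: "qform (S + T) x = qform S x + qform T x"
  and qform_diff: "qform (S - T) x = qform S x - qform T x"
  and qform_scaleR: "qform (c *\<^sub>R S) x = c * qform S x"
  and qform_zero [simp]: "qform 0 x = 0"
  and qform_mat1: "qform (mat 1) x = x \<bullet> x"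
  by (simp_all add: qform_def matrix_vector_mult_add_rdistrib matrix_vector_mult_diff_rdistrib
      inner_add_right inner_diff_right scaleR_matrix_vector_assoc[symmetric])

lemma qform_minus: "qform (- S) x = - qform S x"
  using qform_scaleR[of "-1" S x] by simp

lemma qform_conj: "qform (F ** S ** transpose F) x = qform S (transpose F *v x)"
  by (simp add: qform_def inner_matrix_vector matrix_vector_mul_assoc[symmetric])

lemma qform_conj': "qform (transpose F ** S ** F) x = qform S (F *v x)"
  using qform_conj[of "transpose F"] by simp

lemma outer_mult_vector: "outer x y *v z = (y \<bullet> z) *\<^sub>R x"
  by (vector outer_def matrix_vector_mult_def inner_vec_def sum_distrib_left sum_distrib_right mult_ac)

lemma qform_outer: "qform (outer x x) y = (x \<bullet> y)\<^sup>2"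
  by (simp add: qform_def outer_mult_vector inner_commute power2_eq_square)

lemma inner_outer: "P \<bullet> outer x y = x \<bullet> (P *v (y::real^'n))"
  by (simp add: matrix_inner_sum outer_def inner_vec_def matrix_vector_mult_def sum_distrib_left mult_ac)

lemma inner_outer_self: "P \<bullet> outer x x = qform P x"
  by (simp add: inner_outer qform_def)

lemma symmetric_inner: "symmetric S \<Longrightarrow> x \<bullet> (S *v y) = (S *v x) \<bullet> y"
  by (simp add: inner_matrix_vector symmetric_def)

lemma symmetric_nth: "symmetric S \<Longrightarrow> S $ i $ j = S $ j $ i"
  by (auto simp: symmetric_def transpose_def vec_eq_iff)

lemma pos_semidefD: "pos_semidef S \<Longrightarrow> symmetric S" "pos_semidef S \<Longrightarrow> 0 \<le> qform S x"
  by (auto simp: pos_semidef_def)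

lemma symmetric_add: "symmetric S \<Longrightarrow> symmetric T \<Longrightarrow> symmetric (S + T)"
  and symmetric_diff: "symmetric S \<Longrightarrow> symmetric T \<Longrightarrow> symmetric (S - T)"
  and symmetric_scaleR: "symmetric S \<Longrightarrow> symmetric (c *\<^sub>R S)"
  and symmetric_mat1: "symmetric (mat 1)"
  and symmetric_outer: "symmetric (outer x x)"
  by (auto simp: symmetric_def transpose_add transpose_diff transpose_scalar)
    (vector transpose_def outer_def mult.commute)

lemma symmetric_conj: "symmetric S \<Longrightarrow> symmetric (F ** S ** transpose F)"
  by (simp add: symmetric_def matrix_transpose_mul matrix_mul_assoc)

lemma pos_semidef_add: "pos_semidef S \<Longrightarrow> pos_semidef T \<Longrightarrow> pos_semidef (S + T)"
  and pos_semidef_scaleR: "0 \<le> c \<Longrightarrow> pos_semidef S \<Longrightarrow> pos_semidef (c *\<^sub>R S)"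
  and pos_semidef_conj: "pos_semidef S \<Longrightarrow> pos_semidef (F ** S ** transpose F)"
  and pos_semidef_mat1: "pos_semidef (mat 1)"
  and pos_semidef_outer: "pos_semidef (outer x x)"
  and pos_semidef_zero: "pos_semidef 0"
  by (auto simp: pos_semidef_def symmetric_add qform_add symmetric_scaleR qform_scaleR
      symmetric_conj qform_conj symmetric_mat1 qform_mat1 symmetric_outer qform_outer)
    (simp add: symmetric_def)

lemma pos_semidef_conj': "pos_semidef S \<Longrightarrow> pos_semidef (transpose F ** S ** F)"
  using pos_semidef_conj[of S "transpose F"] by simp

text \<open>Polarization: the form at \<open>x + y\<close> recovers the bilinear form when
  \<open>S\<close> is symmetric.\<close>

lemma symmetric_qform_eq_0:
  fixes S :: "real^'n^'n"
  assumes S: "symmetric S" and 0: "\<And>x. qform S x = 0"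
  shows "S = 0"
proof -
  have "x \<bullet> (S *v y) = 0" for x y
  proof -
    have "qform S (x + y) = qform S x + qform S y + 2 * (x \<bullet> (S *v y))"
      using symmetric_inner[OF S, of y x]
      by (simp add: qform_def algebra_simps inner_add_left inner_add_right inner_commute)
    then show ?thesis by (simp add: 0)
  qed
  then have "S *v y = 0" for y by (metis inner_eq_zero_iff)
  then show ?thesis by (metis matrix_eq matrix_vector_mult_0)
qed

text \<open>The form along the line \<open>x + t y\<close> is a nonnegative polynomial in
  \<open>t\<close> of degree at most two. When \<open>qform S y\<close> vanishes it is affine in
  \<open>t\<close>, so its slope must vanish.\<close>

lemma pos_semidef_cauchy_schwarz:
  assumes S: "pos_semidef S"
  shows "(x \<bullet> (S *v y))\<^sup>2 \<le> qform S x * qform S y"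
proof -
  have q: "0 \<le> qform S x + 2 * t * (x \<bullet> (S *v y)) + t\<^sup>2 * qform S y" for t
  proof -
    have "qform S (x + t *\<^sub>R y) = qform S x + 2 * t * (x \<bullet> (S *v y)) + t\<^sup>2 * qform S y"
      using symmetric_inner[OF pos_semidefD(1)[OF S], of y x]
      by (simp add: qform_def algebra_simps inner_add_left inner_add_right inner_commute power2_eq_square)
    then show ?thesis using pos_semidefD(2)[OF S] by metis
  qed
  show ?thesis
  proof (cases "qform S y = 0")
    case True
    have "x \<bullet> (S *v y) = 0"
    proof (rule ccontr)
      assume n: "x \<bullet> (S *v y) \<noteq> 0"
      \<comment> \<open>This value of \<open>t\<close> would make the affine function equal to
        -1.\<close>
      show False using q[of "- (qform S x + 1) / (2 * (x \<bullet> (S *v y)))"] True n by (simp add: field_simps)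
    qed
    then show ?thesis using True by simp
  next
    case False
    then have "qform S y > 0" using pos_semidefD(2)[OF S, of y] by linarith
    then show ?thesis
      using q[of "- (x \<bullet> (S *v y)) / qform S y"] by (simp add: field_simps power2_eq_square)
  qed
qed

lemma qform_axis: "qform S (axis i 1) = S $ i $ (i::'n::finite)"
  by (simp add: qform_def inner_axis' matrix_vector_mult_basis column_def)

text \<open>Symmetric Gaussian elimination writes \<open>S\<close> as a sum of rank-one matrices \<open>outer v v\<close>.\<close>

lemma inner_pos_semidef_nonneg:
  fixes P S :: "real^'n^'n"
  assumes P: "\<And>x. 0 \<le> qform P x" and S: "pos_semidef S"
  shows "0 \<le> P \<bullet> S"
proof -
  \<comment> \<open>The induction runs over the set \<open>I\<close> of rows that have not yet been
    eliminated.\<close>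
  have "\<lbrakk>finite I; \<And>i j. i \<notin> I \<Longrightarrow> S $ i $ j = 0; pos_semidef S\<rbrakk> \<Longrightarrow> 0 \<le> P \<bullet> S" for I
  proof (induction I arbitrary: S rule: finite_induct)
    case empty
    then have "S = 0" by (simp add: vec_eq_iff)
    then show ?case by simp
  next
    case (insert k I)
    note S = insert.prems(2)
    define v where "v = S *v axis k 1"
    have v: "v $ i = S $ i $ k" for i by (simp add: v_def matrix_vector_mult_basis column_def)
    show ?case
    proof (cases "S $ k $ k = 0")
      case True
      have "S $ k $ j = 0" for j
      proof -
        \<comment> \<open>A vanishing pivot forces its whole row to vanish, so there is nothing to
          eliminate.\<close>
        have "(axis k 1 \<bullet> (S *v axis j 1))\<^sup>2 \<le> 0"
          using pos_semidef_cauchy_schwarz[OF S, of "axis k 1" "axis j 1"] True by (simp add: qform_axis)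
        then show ?thesis by (simp add: inner_axis' matrix_vector_mult_basis column_def)
      qed
      then show ?thesis using insert.prems insert.IH by (metis insertE)
    next
      case False
      then have pos: "0 < S $ k $ k" using pos_semidefD(2)[OF S, of "axis k 1"] by (simp add: qform_axis)
      \<comment> \<open>Schur complement: \<open>v\<close> is the pivot column, and the rank-one
        term clears row and column \<open>k\<close>. That \<open>T\<close> stays positive
        semi-definite is Cauchy-Schwarz against the axis vector.\<close>
      define T where "T = S - (1 / S $ k $ k) *\<^sub>R outer v v"
      have Tn: "T $ i $ j = S $ i $ j - S $ i $ k * S $ j $ k / S $ k $ k" for i j
        by (simp add: T_def outer_def v)
      have "pos_semidef T"
        unfolding pos_semidef_def
      proof (intro conjI allI)
        show "symmetric T"
          unfolding T_def by (intro symmetric_diff symmetric_scaleR symmetric_outer pos_semidefD(1)[OF S])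
        fix x
        have "(v \<bullet> x)\<^sup>2 \<le> S $ k $ k * qform S x"
          using pos_semidef_cauchy_schwarz[OF S, of x "axis k 1"]
          by (simp add: v_def qform_axis inner_commute mult.commute)
        then show "0 \<le> qform T x" using pos
          by (simp add: T_def qform_diff qform_scaleR qform_outer field_simps)
      qed
      moreover have "T $ i $ j = 0" if "i \<notin> I" for i j
      proof (cases "i = k")
        case True
        then show ?thesis using pos symmetric_nth[OF pos_semidefD(1)[OF S], of k j] by (simp add: Tn)
      next
        case False
        then show ?thesis using that insert.prems(1) by (simp add: Tn)
      qed
      ultimately have "0 \<le> P \<bullet> T" using insert.IH by blast
      moreover have "P \<bullet> S = P \<bullet> T + qform P v / S $ k $ k"
        by (simp add: T_def inner_diff_right inner_outer_self)
      ultimately show ?thesis using P pos by simp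
    qed
  qed
  from this[of UNIV] S show ?thesis by simp
qed

section \<open>Norm estimates obtained from the trace pairing\<close>

lemma inner_pos_semidef_mono:
  fixes P P' S :: "real^'n^'n"
  assumes "\<And>x. qform P x \<le> qform P' x" and "pos_semidef S"
  shows "P \<bullet> S \<le> P' \<bullet> S"
  using inner_pos_semidef_nonneg[of "P' - P" S] assms by (simp add: qform_diff inner_diff_left)

text \<open>By Cauchy-Schwarz, \<open>outer x x\<close> lies below the multiple
  \<open>x \<bullet> x\<close> of the identity; pair both with \<open>S\<close>. The trace thus
  serves as an upper bound for the largest eigenvalue.\<close>

lemma qform_le_trace:
  fixes S :: "real^'n^'n"
  assumes S: "pos_semidef S"
  shows "qform S x \<le> (mat 1 \<bullet> S) * (x \<bullet> x)"
proof -
  have "outer x x \<bullet> S \<le> ((x \<bullet> x) *\<^sub>R mat 1) \<bullet> S"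
    by (rule inner_pos_semidef_mono[OF _ S])
      (use Cauchy_Schwarz_ineq in \<open>auto simp: qform_outer qform_scaleR qform_mat1\<close>)
  then show ?thesis by (simp add: inner_commute[of "outer x x"] inner_outer_self mult.commute)
qed

text \<open>The form of \<open>S\<close> is bounded by its trace, and this inequality is paired with
  \<open>S\<close> itself. Summability of traces then gives absolute convergence of series of
  positive semi-definite matrices.\<close>

lemma norm_le_trace:
  fixes S :: "real^'n^'n"
  assumes S: "pos_semidef S"
  shows "norm S \<le> mat 1 \<bullet> S"
proof -
  have "S \<bullet> S \<le> ((mat 1 \<bullet> S) *\<^sub>R mat 1) \<bullet> S"
    by (rule inner_pos_semidef_mono[OF _ S])
      (use qform_le_trace[OF S] in \<open>auto simp: qform_scaleR qform_mat1\<close>)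
  then have "(norm S)\<^sup>2 \<le> (mat 1 \<bullet> S)\<^sup>2"
    unfolding power2_norm_eq_inner by (simp add: power2_eq_square)
  moreover have "0 \<le> mat 1 \<bullet> S"
    by (rule inner_pos_semidef_nonneg[OF _ S]) (simp add: qform_mat1)
  ultimately show ?thesis by (rule power2_le_imp_le)
qed

lemma norm_matrix_sq: "(norm (F::real^'n^'m))\<^sup>2 = mat 1 \<bullet> (F ** transpose F)"
  "(norm (F::real^'n^'m))\<^sup>2 = mat 1 \<bullet> (transpose F ** F)"
  by (simp_all add: power2_norm_eq_inner inner_commute[of "mat 1"] inner_matrix_mult_right inner_transpose)

lemma norm_matrix_vector_le:
  fixes F :: "real^'n^'m"
  shows "norm (F *v x) \<le> norm F * norm x"
proof -
  have "(norm (F *v x))\<^sup>2 = qform (transpose F ** mat 1 ** F) x"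
    by (simp only: qform_conj' qform_mat1 power2_norm_eq_inner)
  also have "\<dots> \<le> (mat 1 \<bullet> (transpose F ** mat 1 ** F)) * (x \<bullet> x)"
    by (rule qform_le_trace[OF pos_semidef_conj'[OF pos_semidef_mat1]])
  also have "\<dots> = (norm F * norm x)\<^sup>2"
    by (simp add: power_mult_distrib norm_matrix_sq(2) flip: power2_norm_eq_inner)
  finally show ?thesis by (rule power2_le_imp_le) simp
qed

lemma norm_transpose: "norm (transpose (F::real^'n^'m)) = norm F"
  by (simp add: norm_eq_sqrt_inner inner_transpose)

text \<open>Brings the norm of a product into a shape where a bound on the form of
  \<open>D ** D\<close> can be paired with the positive semi-definite
  \<open>transpose E ** E\<close>.\<close>

lemma norm_mult_symmetric_sq:
  fixes E :: "real^'n^'m" and D :: "real^'n^'n"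
  assumes D: "symmetric D"
  shows "(norm (E ** D))\<^sup>2 = (D ** D) \<bullet> (transpose E ** E)"
proof -
  have "(norm (E ** D))\<^sup>2 = E \<bullet> (E ** (D ** D))"
    using D by (simp add: power2_norm_eq_inner inner_matrix_mult_right symmetric_def matrix_mul_assoc)
  also have "\<dots> = (D ** D) \<bullet> (transpose E ** E)"
    by (subst inner_commute) (rule inner_matrix_mult_left)
  finally show ?thesis .
qed

text \<open>For symmetric \<open>D\<close> a bound on the quadratic form is a bound on the operator
  norm, by polarization. This is needed for differences of covariances, which have no sign.\<close>

lemma norm_mult_symmetric_le:
  fixes E :: "real^'n^'m" and D :: "real^'n^'n"
  assumes D: "symmetric D" and c: "\<And>x. \<bar>qform D x\<bar> \<le> c * (x \<bullet> x)"
  shows "norm (E ** D) \<le> c * norm E"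
proof -
  have c0: "0 \<le> c"
  proof -
    have "0 \<le> c * (axis undefined 1 \<bullet> (axis undefined 1 :: real^'n))"
      using c[of "axis undefined 1"] by linarith
    then show ?thesis by (simp add: inner_axis_axis)
  qed
  have Dx: "norm (D *v x) \<le> c * norm x" for x
  proof (cases "D *v x = 0")
    case False
    have pol: "4 * (y \<bullet> (D *v x)) \<le> 2 * c * (x \<bullet> x + y \<bullet> y)" for y
    proof -
      have "4 * (y \<bullet> (D *v x)) = qform D (x + y) - qform D (x - y)"
        using symmetric_inner[OF D, of x y]
        by (simp add: qform_def algebra_simps inner_add_left inner_add_right inner_diff_left inner_diff_right inner_commute)
      also have "\<dots> \<le> c * ((x + y) \<bullet> (x + y)) + c * ((x - y) \<bullet> (x - y))"
        using c[of "x + y"] c[of "x - y"] by linarith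
      also have "\<dots> = 2 * c * (x \<bullet> x + y \<bullet> y)"
        by (simp add: algebra_simps inner_add_left inner_add_right inner_diff_left inner_diff_right inner_commute)
      finally show ?thesis .
    qed
    \<comment> \<open>Scaling \<open>D *v x\<close> to the length of \<open>x\<close> balances the
      two squares in the polarized inequality.\<close>
    define r where "r = norm x / norm (D *v x)"
    have r: "r * norm (D *v x) = norm x" using False by (simp add: r_def)
    have x0: "x \<noteq> 0" using False by auto
    have "4 * (r * (norm (D *v x))\<^sup>2) \<le> 2 * c * ((norm x)\<^sup>2 + r\<^sup>2 * (norm (D *v x))\<^sup>2)"
      using pol[of "r *\<^sub>R (D *v x)"] unfolding power2_norm_eq_inner by (simp add: power2_eq_square mult.assoc)
    moreover have "r\<^sup>2 * (norm (D *v x))\<^sup>2 = (norm x)\<^sup>2"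
      by (simp add: r[symmetric] power_mult_distrib)
    moreover have "r * (norm (D *v x))\<^sup>2 = norm x * norm (D *v x)"
      by (simp add: power2_eq_square r[symmetric])
    ultimately have "4 * (norm x * norm (D *v x)) \<le> 2 * c * ((norm x)\<^sup>2 + (norm x)\<^sup>2)"
      by (simp only:)
    then have "norm x * norm (D *v x) \<le> norm x * (c * norm x)"
      by (simp add: power2_eq_square mult_ac)
    then show ?thesis using x0 by simp
  qed (use c0 in simp)
  have "(norm (E ** D))\<^sup>2 = (D ** D) \<bullet> (transpose E ** E)" by (rule norm_mult_symmetric_sq[OF D])
  also have "\<dots> \<le> ((c\<^sup>2) *\<^sub>R mat 1) \<bullet> (transpose E ** E)"
  proof (rule inner_pos_semidef_mono)
    fix x
    have "qform (D ** D) x = (norm (D *v x))\<^sup>2"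
      using symmetric_inner[OF D, of x "D *v x"]
      by (simp add: qform_def power2_norm_eq_inner matrix_vector_mul_assoc[symmetric])
    also have "\<dots> \<le> (c * norm x)\<^sup>2" using Dx by (simp add: power_mono)
    finally show "qform (D ** D) x \<le> qform (c\<^sup>2 *\<^sub>R mat 1) x"
      by (simp add: qform_scaleR qform_mat1 power_mult_distrib power2_norm_eq_inner)
  qed (use pos_semidef_conj'[OF pos_semidef_mat1, of E] in simp)
  also have "\<dots> = (c * norm E)\<^sup>2" by (simp add: norm_matrix_sq(2) power_mult_distrib)
  finally show ?thesis by (rule power2_le_imp_le) (use c0 in simp)
qed

text \<open>The lower bound on the form gives \<open>c * norm x \<le> norm (S *v x)\<close> by
  Cauchy-Schwarz, hence a lower bound on \<open>S ** S\<close>. It is used to pass from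
  \<open>E\<close> to \<open>E ** Sig K\<close>.\<close>

lemma norm_mult_ge:
  fixes E :: "real^'n^'m" and S :: "real^'n^'n"
  assumes S: "symmetric S" and c0: "0 \<le> c" and c: "\<And>x. c * (x \<bullet> x) \<le> qform S x"
  shows "c * norm E \<le> norm (E ** S)"
proof -
  have Sx: "c * norm x \<le> norm (S *v x)" for x
  proof (cases "x = 0")
    case False
    have "c * (norm x)\<^sup>2 \<le> norm x * norm (S *v x)"
      using c[of x] norm_cauchy_schwarz[of x "S *v x"] by (simp add: qform_def power2_norm_eq_inner)
    then show ?thesis using False by (simp add: power2_eq_square mult.left_commute)
  qed simp
  have "(c * norm E)\<^sup>2 = ((c\<^sup>2) *\<^sub>R mat 1) \<bullet> (transpose E ** E)" by (simp add: norm_matrix_sq(2) power_mult_distrib)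
  also have "\<dots> \<le> (S ** S) \<bullet> (transpose E ** E)"
  proof (rule inner_pos_semidef_mono)
    fix x
    have "(c * norm x)\<^sup>2 \<le> (norm (S *v x))\<^sup>2" using Sx c0 by (simp add: power_mono)
    also have "\<dots> = qform (S ** S) x"
      using symmetric_inner[OF S, of x "S *v x"]
      by (simp add: qform_def power2_norm_eq_inner matrix_vector_mul_assoc[symmetric])
    finally show "qform (c\<^sup>2 *\<^sub>R mat 1) x \<le> qform (S ** S) x"
      by (simp add: qform_scaleR qform_mat1 power_mult_distrib power2_norm_eq_inner)
  qed (use pos_semidef_conj'[OF pos_semidef_mat1, of E] in simp)
  also have "\<dots> = (norm (E ** S))\<^sup>2" by (rule norm_mult_symmetric_sq[OF S, symmetric])
  finally show ?thesis by (rule power2_le_imp_le) simp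
qed

subsection \<open>Spectral norm and smallest eigenvalue\<close>

lemma spec_norm_bound: "norm (S *v x) \<le> spec_norm S * norm (x::real^'n)"
  unfolding spec_norm_def by (rule onorm) (rule matrix_vector_mul_bounded_linear)

lemma spec_norm_nonneg: "0 \<le> spec_norm (S::real^'n^'m)"
  unfolding spec_norm_def by (rule onorm_pos_le) (rule matrix_vector_mul_bounded_linear)

lemma spec_norm_pos: "S \<noteq> 0 \<Longrightarrow> 0 < spec_norm (S::real^'n^'m)"
  unfolding spec_norm_def
  by (subst onorm_pos_lt) (auto simp: matrix_vector_mul_bounded_linear, metis matrix_eq matrix_vector_mult_0)

lemma qform_le_spec_norm: "qform S x \<le> spec_norm S * (x \<bullet> x)"
proof -
  have "qform S x \<le> norm x * norm (S *v x)" by (simp add: qform_def norm_cauchy_schwarz)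
  also have "\<dots> \<le> norm x * (spec_norm S * norm x)" by (intro mult_left_mono spec_norm_bound) simp
  also have "\<dots> = spec_norm S * (x \<bullet> x)" by (simp add: power2_norm_eq_inner[symmetric] power2_eq_square)
  finally show ?thesis .
qed

text \<open>Pair \<open>x\<close> with the image under \<open>S\<close> of
  \<open>transpose S *v x\<close> and cancel one factor of the norm of the latter.\<close>

lemma norm_transpose_vector_le: "norm (transpose S *v x) \<le> spec_norm S * norm (x::real^'m)"
proof (cases "transpose S *v x = 0")
  case False
  let ?y = "transpose S *v x"
  have "(norm ?y)\<^sup>2 = x \<bullet> (S *v ?y)" by (simp add: power2_norm_eq_inner inner_matrix_vector)
  also have "\<dots> \<le> norm x * (spec_norm S * norm ?y)"
    using norm_cauchy_schwarz[of x "S *v ?y"] mult_left_mono[OF spec_norm_bound[of S ?y], of "norm x"] by simp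
  finally have "norm ?y * norm ?y \<le> (spec_norm S * norm x) * norm ?y" by (simp add: power2_eq_square mult_ac)
  then show ?thesis using False by (simp only: mult_le_cancel_right norm_le_zero_iff) (auto simp: not_less)
qed (simp add: spec_norm_nonneg)

text \<open>A \<open>Min\<close> carries information only for a finite nonempty set. Nonemptiness
  comes from a minimizer of the form on the unit sphere, finiteness from the orthogonality of
  eigenvectors for distinct eigenvalues.\<close>

lemma lambda_min_attained:
  fixes S :: "real^'n^'n"
  assumes S: "symmetric S"
  shows "\<exists>v. v \<noteq> 0 \<and> S *v v = lambda_min S *\<^sub>R v" and "lambda_min S * (x \<bullet> x) \<le> qform S x"
proof -
  let ?E = "{c. \<exists>v. v \<noteq> 0 \<and> S *v v = c *\<^sub>R v}"
  obtain e where e: "norm e = 1" and emin: "\<And>x. norm x = 1 \<Longrightarrow> qform S e \<le> qform S x"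
  proof -
    have "continuous_on (sphere 0 1) (qform S)"
      unfolding qform_def[abs_def] by (intro continuous_intros linear_continuous_on matrix_vector_mul_bounded_linear)
    moreover have "sphere (0::real^'n) 1 \<noteq> {}" by simp
    ultimately show ?thesis
      using continuous_attains_inf[of "sphere 0 1" "qform S"] that by (auto simp: dist_norm)
  qed
  define m where "m = qform S e"
  have m: "m * (x \<bullet> x) \<le> qform S x" for x
  proof (cases "x = 0")
    case False
    have "m \<le> qform S ((1 / norm x) *\<^sub>R x)" unfolding m_def by (rule emin) (use False in simp)
    also have "\<dots> = qform S x / (norm x)\<^sup>2" by (simp add: qform_def algebra_simps power2_eq_square)
    finally show ?thesis unfolding power2_norm_eq_inner[symmetric] using False by (simp add: pos_le_divide_eq)
  qed (simp add: qform_def)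
  have T: "pos_semidef (S - m *\<^sub>R mat 1)"
    unfolding pos_semidef_def by (auto intro!: symmetric_diff symmetric_scaleR symmetric_mat1 S simp: qform_diff qform_scaleR qform_mat1 m)
  have qe: "qform (S - m *\<^sub>R mat 1) e = 0"
    using e by (simp add: qform_diff qform_scaleR qform_mat1 m_def norm_eq_1)
  \<comment> \<open>The shifted form is nonnegative and vanishes at \<open>e\<close>; Cauchy-Schwarz
    then makes \<open>e\<close> orthogonal to the range, so \<open>e\<close> is in the
    kernel.\<close>
  have "(S - m *\<^sub>R mat 1) *v e = 0"
  proof -
    have "(x \<bullet> ((S - m *\<^sub>R mat 1) *v e))\<^sup>2 \<le> 0" for x
      using pos_semidef_cauchy_schwarz[OF T, of x e] qe by simp
    then have "x \<bullet> ((S - m *\<^sub>R mat 1) *v e) = 0" for x by simp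
    from this[of "(S - m *\<^sub>R mat 1) *v e"] show ?thesis by (simp only: inner_eq_zero_iff)
  qed
  then have Se: "S *v e = m *\<^sub>R e"
    by (simp add: matrix_vector_mult_diff_rdistrib scaleR_matrix_vector_assoc[symmetric])
  have mE: "m \<in> ?E" using Se e by (auto intro!: exI[of _ e])
  have le: "m \<le> c" if "c \<in> ?E" for c
  proof -
    from that obtain v where v: "v \<noteq> 0" "S *v v = c *\<^sub>R v" by auto
    then have "qform S v = c * (v \<bullet> v)" by (simp add: qform_def)
    with m[of v] have "m * (v \<bullet> v) \<le> c * (v \<bullet> v)" by simp
    moreover have "0 < v \<bullet> v" using v(1) by simp
    ultimately show ?thesis by (simp only: mult_le_cancel_right_pos)
  qed
  have "finite ?E"
  proof -
    define f where "f c = (SOME v. v \<noteq> 0 \<and> S *v v = c *\<^sub>R v)" for c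
    have f: "f c \<noteq> 0" "S *v f c = c *\<^sub>R f c" if "c \<in> ?E" for c
      using someI_ex[of "\<lambda>v. v \<noteq> 0 \<and> S *v v = c *\<^sub>R v"] that by (auto simp: f_def)
    have orth: "f c \<bullet> f d = 0" if "c \<in> ?E" "d \<in> ?E" "c \<noteq> d" for c d
      using symmetric_inner[OF S, of "f c" "f d"] f(2)[OF that(1)] f(2)[OF that(2)] that(3) by simp
    have inj: "inj_on f ?E"
    proof (rule inj_onI)
      fix c d assume "c \<in> ?E" "d \<in> ?E" "f c = f d"
      then show "c = d" using orth[of c d] f(1)[of c] by auto
    qed
    have "pairwise orthogonal (f ` ?E)"
      unfolding pairwise_def orthogonal_def using orth by auto
    then have "finite (f ` ?E)" by (rule pairwise_orthogonal_imp_finite)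
    then show ?thesis using inj by (rule finite_imageD)
  qed
  then have "lambda_min S = m" unfolding lambda_min_def using mE le by (intro Min_eqI) auto
  then show "\<exists>v. v \<noteq> 0 \<and> S *v v = lambda_min S *\<^sub>R v" "lambda_min S * (x \<bullet> x) \<le> qform S x"
    using mE m by auto
qed

lemma lambda_min_ge:
  fixes S :: "real^'n^'n"
  assumes "symmetric S" and "\<And>x. c * (x \<bullet> x) \<le> qform S x"
  shows "c \<le> lambda_min S"
proof -
  obtain v where v: "v \<noteq> 0" "S *v v = lambda_min S *\<^sub>R v"
    using lambda_min_attained(1)[OF assms(1)] by auto
  then have "qform S v = lambda_min S * (v \<bullet> v)" by (simp add: qform_def)
  with assms(2)[of v] v(1) show ?thesis by simp
qed

lemma lambda_min_pos_def:
  assumes "pos_def S"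
  shows "0 < lambda_min S"
proof -
  have S: "symmetric S" using assms by (simp add: pos_def_def)
  obtain v where v: "v \<noteq> 0" "S *v v = lambda_min S *\<^sub>R v"
    using lambda_min_attained(1)[OF S] by auto
  then have "0 < lambda_min S * (v \<bullet> v)" using assms v by (auto simp: pos_def_def qform_def)
  then show ?thesis using inner_ge_zero[of v] by (simp only: zero_less_mult_iff) linarith
qed

text \<open>Strict positivity matters twice: as a divisor in the trial step of the gradient bound,
  and to make \<open>h_hess\<close> infinite when the smallest eigenvalue of \<open>Q\<close> is
  zero and the cost is positive.\<close>

lemma hess_factor_pos:
  assumes "pos_def (R::real^'l^'l)" "0 < \<gamma>" "0 \<le> C" "0 < lam"
  shows "0 < spec_norm R + \<gamma> * (spec_norm (B::real^'l^'d))\<^sup>2 * (C / lam)"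
proof -
  have "R \<noteq> 0"
  proof
    assume "R = 0"
    then have "qform R (axis undefined 1) = 0" by simp
    moreover have "0 < qform R (axis undefined 1)"
      using assms(1) by (auto simp: pos_def_def axis_eq_0_iff)
    ultimately show False by simp
  qed
  then show ?thesis using assms by (intro add_pos_nonneg spec_norm_pos mult_nonneg_nonneg) auto
qed

declare transpose_matrix_vector [simp del]

subsection \<open>Discrete Lyapunov equations\<close>

text \<open>Expresses that the spectral radius of \<open>N\<close> is below one without complex
  eigenvalues. The strict inequality already makes \<open>X\<close> positive definite, and any
  convenient witness may be supplied.\<close>

definition lyap_stable :: "real^'n^'n \<Rightarrow> bool" where
  "lyap_stable N \<longleftrightarrow> (\<exists>X c. pos_semidef X \<and> 0 < c \<and>
     (\<forall>x. c * (x \<bullet> x) \<le> qform (X - N ** X ** transpose N) x))"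

text \<open>The adjointness behind the duality of the covariance equation and the value
  equation.\<close>

lemma inner_conj:
  fixes X :: "real^'n^'n"
  shows "(F ** X ** transpose F) \<bullet> P = X \<bullet> (transpose F ** P ** F)"
proof -
  have "(F ** X ** transpose F) \<bullet> P = (X ** transpose F) \<bullet> (transpose F ** P)"
    by (simp only: matrix_mul_assoc[symmetric] inner_matrix_mult_left[of F])
  also have "\<dots> = X \<bullet> (transpose F ** P ** F)"
    by (simp only: inner_matrix_mult_right transpose_transpose)
  finally show ?thesis .
qed

lemma bounded_linear_conj: "bounded_linear (\<lambda>X::real^'n^'n. F ** X ** (G::real^'k^'n))"
  unfolding linear_conv_bounded_linear[symmetric]
  by (rule linearI) (simp_all add: matrix_distribs)

lemma bounded_linear_transpose: "bounded_linear (transpose :: real^'n^'m \<Rightarrow> real^'m^'n)"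
  unfolding linear_conv_bounded_linear[symmetric]
  by (rule linearI) (simp_all add: matrix_distribs)

lemma qform_eq_inner: "qform P x = P \<bullet> outer x x"
  by (rule inner_outer_self[symmetric])

text \<open>The solution is the series of \<open>transpose N ^ t ** S ** N ^ t\<close>. The witness
  lives on the adjoint side, so pairing it with the partial sums bounds their traces
  uniformly.\<close>

lemma lyap_exists:
  fixes N S :: "real^'n^'n"
  assumes N: "lyap_stable N" and S: "pos_semidef S"
  shows "\<exists>P. pos_semidef P \<and> P = S + transpose N ** P ** N"
proof -
  obtain X c where X: "pos_semidef X" and c: "0 < c"
    and Xc: "\<And>x. c * (x \<bullet> x) \<le> qform (X - N ** X ** transpose N) x"
    using N unfolding lyap_stable_def by blast
  define T where "T Z = transpose N ** Z ** N" for Z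
  have bl: "bounded_linear T" unfolding T_def[abs_def] by (rule bounded_linear_conj)
  define p where "p t = (T ^^ t) S" for t
  have p: "pos_semidef (p t)" for t
    by (induction t) (auto simp: p_def S T_def pos_semidef_conj')
  define U where "U n = (\<Sum>t<n. p t)" for n
  have U: "pos_semidef (U n)" for n
    by (induction n) (auto simp: U_def pos_semidef_zero pos_semidef_add p)
  have US: "U (Suc n) = S + T (U n)" for n
  proof -
    have "U (Suc n) = p 0 + (\<Sum>t<n. p (Suc t))" unfolding U_def by (rule sum.lessThan_Suc_shift)
    also have "(\<Sum>t<n. p (Suc t)) = T (U n)"
      by (simp add: U_def p_def linear_sum[OF bounded_linear.linear[OF bl]])
    finally show ?thesis by (simp add: p_def)
  qed
  have bound: "c * (mat 1 \<bullet> U n) \<le> S \<bullet> X" for n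
  proof -
    have "(c *\<^sub>R mat 1) \<bullet> U n \<le> (X - N ** X ** transpose N) \<bullet> U n"
      by (rule inner_pos_semidef_mono[OF _ U]) (simp add: qform_scaleR qform_mat1 Xc)
    also have "\<dots> = X \<bullet> (U n - T (U n))" by (simp add: inner_diff_left inner_conj inner_diff_right T_def)
    also have "U n - T (U n) = S - p n" using US[of n] by (simp add: U_def algebra_simps)
    also have "X \<bullet> (S - p n) \<le> S \<bullet> X"
      using inner_pos_semidef_nonneg[OF pos_semidefD(2)[OF X] p[of n]] by (simp add: inner_diff_right inner_commute)
    finally show ?thesis by simp
  qed
  have "summable (\<lambda>t. mat 1 \<bullet> p t)"
  proof (rule summableI_nonneg_bounded)
    show "0 \<le> mat 1 \<bullet> p t" for t
      by (rule inner_pos_semidef_nonneg[OF _ p]) (simp add: qform_mat1)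
    show "(\<Sum>t<n. mat 1 \<bullet> p t) \<le> S \<bullet> X / c" for n
      using bound[of n] c by (simp add: U_def inner_sum_right field_simps)
  qed
  then have sm: "summable p"
    by (rule summable_comparison_test[rotated]) (use norm_le_trace[OF p] in auto)
  define P where "P = suminf p"
  have "P = p 0 + (\<Sum>t. p (Suc t))" unfolding P_def using suminf_split_head[OF sm] by simp
  also have "(\<Sum>t. p (Suc t)) = T P"
  proof -
    have "(\<Sum>t. p (Suc t)) = (\<Sum>t. T (p t))" by (simp add: p_def)
    then show ?thesis using bounded_linear.suminf[OF bl sm] by (simp add: P_def)
  qed
  finally have eq: "P = S + T P" by (simp add: p_def)
  have "pos_semidef P"
    unfolding pos_semidef_def symmetric_def
  proof (intro conjI allI)
    show "transpose P = P"
      using bounded_linear.suminf[OF bounded_linear_transpose sm] pos_semidefD(1)[OF p]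
      by (simp add: P_def symmetric_def)
    show "0 \<le> qform P x" for x
      using bounded_linear.suminf[OF bounded_linear_inner_left sm, of "outer x x"]
        bounded_linear.summable[OF bounded_linear_inner_left sm, of "outer x x"]
        suminf_nonneg[of "\<lambda>t. p t \<bullet> outer x x"] pos_semidefD(2)[OF p]
      by (simp add: P_def qform_eq_inner)
  qed
  with eq show ?thesis unfolding T_def by blast
qed

text \<open>The solution with source \<open>mat 1\<close> is itself a witness for the transpose,
  with constant 1.\<close>

lemma lyap_stable_transpose: "lyap_stable N \<Longrightarrow> lyap_stable (transpose N)"
  using lyap_exists[OF _ pos_semidef_mat1]
  unfolding lyap_stable_def[of "transpose N"]
proof -
  assume "lyap_stable N"
  from lyap_exists[OF this pos_semidef_mat1]
  obtain P where "pos_semidef P" and P: "P = mat 1 + transpose N ** P ** N" by blast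
  moreover from P have "P - transpose N ** P ** N = mat 1" by (simp add: algebra_simps)
  ultimately show "\<exists>X c. pos_semidef X \<and> 0 < c \<and>
     (\<forall>x. c * (x \<bullet> x) \<le> qform (X - transpose N ** X ** transpose (transpose N)) x)"
    by (intro exI[of _ P] exI[of _ 1]) (simp add: qform_mat1)
qed

text \<open>Comparison principle, by duality: if \<open>P\<close> solves the adjoint equation with
  source \<open>outer x x\<close>, then the form of \<open>X\<close> at \<open>x\<close> is the
  pairing of \<open>X - N ** X ** transpose N\<close> with \<open>P\<close>.\<close>

lemma lyap_nonneg:
  fixes N X :: "real^'n^'n"
  assumes N: "lyap_stable N" and X: "\<And>x. 0 \<le> qform (X - N ** X ** transpose N) x"
  shows "0 \<le> qform X x"
proof -
  obtain P where P: "pos_semidef P" "P = outer x x + transpose N ** P ** N"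
    using lyap_exists[OF N pos_semidef_outer] by blast
  then have "outer x x = P - transpose N ** P ** N" by (simp add: algebra_simps)
  then have "qform X x = (X - N ** X ** transpose N) \<bullet> P"
    by (simp add: qform_eq_inner inner_diff_left inner_diff_right inner_conj)
  also have "0 \<le> \<dots>" by (rule inner_pos_semidef_nonneg[OF X P(1)])
  finally show ?thesis .
qed

lemma lyap_diff: "(Z - W) - N ** (Z - W) ** G = (Z - N ** Z ** G) - (W - N ** W ** (G::real^'n^'n))"
  by (simp add: matrix_diff_ldistrib matrix_diff_rdistrib algebra_simps)

text \<open>The comparison principle applied to the difference in both orders.\<close>

lemma lyap_unique:
  fixes N S :: "real^'n^'n"
  assumes N: "lyap_stable N" and X: "symmetric X" "X = S + N ** X ** transpose N"
    and Y: "symmetric Y" "Y = S + N ** Y ** transpose N"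
  shows "X = Y"
proof -
  have *: "(X - Y) - N ** (X - Y) ** transpose N = 0" "(Y - X) - N ** (Y - X) ** transpose N = 0"
  proof -
    have "X - N ** X ** transpose N = S" "Y - N ** Y ** transpose N = S"
      using X(2) Y(2) by (simp_all add: algebra_simps)
    then show "X - Y - N ** (X - Y) ** transpose N = 0" "Y - X - N ** (Y - X) ** transpose N = 0"
      by (simp_all only: lyap_diff diff_self)
  qed
  have "qform (X - Y) x = 0" for x
    using lyap_nonneg[OF N, of "X - Y" x] lyap_nonneg[OF N, of "Y - X" x]
    unfolding * by (simp add: qform_diff)
  then have "X - Y = 0" by (intro symmetric_qform_eq_0 symmetric_diff X(1) Y(1))
  then show ?thesis by simp
qed

subsection \<open>The linear-quadratic problem\<close>

text \<open>Here \<open>S0\<close> is the discounted covariance \<open>E[w\<^sub>0 w\<^sub>0\<^sup>T] + \<gamma> / (1 - \<gamma>) E[w\<^sub>1 w\<^sub>1\<^sup>T]\<close> of the noise.\<close>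

locale lq_problem =
  fixes \<gamma> :: real and A :: "real^'d^'d" and B :: "real^'l^'d" and Q :: "real^'d^'d"
    and R :: "real^'l^'l" and S0 :: "real^'d^'d" and lam :: real
  assumes \<gamma>: "0 < \<gamma>" and Q: "pos_semidef Q" and R: "pos_def R" and S0: "pos_semidef S0"
    and lam: "0 < lam" and lam_le: "\<And>x. lam * (x \<bullet> x) \<le> qform S0 x"
begin

definition cl :: "real^'d^'l \<Rightarrow> real^'d^'d" where
  "cl K = sqrt \<gamma> *\<^sub>R (A - B ** K)"

abbreviation stable :: "real^'d^'l \<Rightarrow> bool" where
  "stable K \<equiv> lyap_stable (cl K)"

definition Qk :: "real^'d^'l \<Rightarrow> real^'d^'d" where
  "Qk K = Q + transpose K ** R ** K"

text \<open>Meaningful for stable gains only, where a solution exists and is the only symmetric one.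
  Its identification with the expectation \<open>lq_Sigma\<close> has to wait for the noise.\<close>

definition Sig :: "real^'d^'l \<Rightarrow> real^'d^'d" where
  "Sig K = (SOME X. pos_semidef X \<and> X = S0 + cl K ** X ** transpose (cl K))"

definition J :: "real^'d^'l \<Rightarrow> real" where
  "J K = Qk K \<bullet> Sig K"

definition Pk :: "real^'d^'l \<Rightarrow> real^'d^'d" where
  "Pk K = (SOME P. pos_semidef P \<and> P = Qk K + transpose (cl K) ** P ** cl K)"

definition H :: "real^'d^'d \<Rightarrow> real^'l^'l" where
  "H P = R + \<gamma> *\<^sub>R (transpose B ** P ** B)"

text \<open>Half the derivative, in the gain, of the Bellman right-hand side with \<open>P\<close>
  frozen. The matrix \<open>P\<close> is an argument because a Riccati solution is inserted as
  well.\<close>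

definition Eg :: "real^'d^'d \<Rightarrow> real^'d^'l \<Rightarrow> real^'d^'l" where
  "Eg P K = H P ** K - \<gamma> *\<^sub>R (transpose B ** P ** A)"

lemma R_sym: "transpose R = R" and R_psd: "pos_semidef R"
  using R by (auto simp: pos_def_def symmetric_def pos_semidef_def less_imp_le)
    (metis less_imp_le inner_zero_left order_refl qform_def)

lemma Qk_psd: "pos_semidef (Qk K)"
  unfolding Qk_def by (intro pos_semidef_add Q pos_semidef_conj' R_psd)

lemma Sig:
  assumes "stable K"
  shows "pos_semidef (Sig K)" and "Sig K = S0 + cl K ** Sig K ** transpose (cl K)"
proof -
  have "\<exists>X. pos_semidef X \<and> X = S0 + cl K ** X ** transpose (cl K)"
    using lyap_exists[OF lyap_stable_transpose[OF assms] S0] by simp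
  from someI_ex[OF this]
  show "pos_semidef (Sig K)" "Sig K = S0 + cl K ** Sig K ** transpose (cl K)"
    unfolding Sig_def by blast+
qed

lemma Pk:
  assumes "stable K"
  shows "pos_semidef (Pk K)" and "Pk K = Qk K + transpose (cl K) ** Pk K ** cl K"
  using someI_ex[OF lyap_exists[OF assms Qk_psd[of K]]] unfolding Pk_def by blast+

lemma lam_le_Sig: "stable K \<Longrightarrow> lam * (x \<bullet> x) \<le> qform (Sig K) x"
  using lam_le[of x] qform_add[of S0 "cl K ** Sig K ** transpose (cl K)" x] Sig(2)[of K]
    pos_semidefD(2)[OF Sig(1), of K "transpose (cl K) *v x"] by (simp add: qform_conj)

text \<open>Duality turns the pairing of stage cost and covariance into that of value matrix and
  noise. Any solution of the value equation may be used, in particular a Riccati solution.\<close>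

lemma J_eq:
  assumes "stable K" and P: "P = Qk K + transpose (cl K) ** P ** cl K"
  shows "J K = P \<bullet> S0"
proof -
  have "Qk K = P - transpose (cl K) ** P ** cl K" using P by (simp add: algebra_simps)
  then have "J K = P \<bullet> (Sig K - cl K ** Sig K ** transpose (cl K))"
    unfolding J_def by (simp add: inner_diff_left inner_diff_right inner_commute[of P] inner_conj)
      (simp add: inner_commute)
  also have "Sig K - cl K ** Sig K ** transpose (cl K) = S0"
    using Sig(2)[OF assms(1)] by (simp add: algebra_simps)
  finally show ?thesis .
qed

text \<open>Pure algebra: the right-hand side is quadratic in the gain, and the equation for
  \<open>P\<close> removes the constant term. As no stability is involved, trial gains of unknown
  stability are allowed.\<close>

lemma bellman_shift:
  assumes P: "symmetric P" "P = Qk K + transpose (cl K) ** P ** cl K"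
  shows "Qk (K + D) + transpose (cl (K + D)) ** P ** cl (K + D) - P =
    transpose D ** Eg P K + transpose (Eg P K) ** D + transpose D ** H P ** D"
proof -
  have Pt: "transpose P = P" using P(1) by (simp add: symmetric_def)
  have cl: "transpose (cl L) ** P ** cl L = \<gamma> *\<^sub>R (transpose (A - B ** L) ** P ** (A - B ** L))" for L
    using \<gamma> by (simp add: cl_def transpose_scalar)
  have "Qk (K + D) + transpose (cl (K + D)) ** P ** cl (K + D) - (Qk K + transpose (cl K) ** P ** cl K) =
    transpose D ** Eg P K + transpose (Eg P K) ** D + transpose D ** H P ** D"
    unfolding cl Qk_def Eg_def H_def
    by (simp add: matrix_distribs Pt R_sym scaleR_add_right scaleR_diff_right)
  then show ?thesis using P(2) by simp
qed

text \<open>Pair the shifted Bellman identity with the covariance of the new gain, whose Lyapunov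
  equation converts \<open>P\<close> into \<open>S0\<close>. Only the new gain has to be stable; the
  base gain enters through \<open>P\<close>.\<close>

lemma cost_difference:
  assumes K': "stable (K + D)" and P: "symmetric P" "P = Qk K + transpose (cl K) ** P ** cl K"
  shows "J (K + D) - P \<bullet> S0 =
    (transpose D ** Eg P K + transpose (Eg P K) ** D + transpose D ** H P ** D) \<bullet> Sig (K + D)"
proof -
  have "S0 = Sig (K + D) - cl (K + D) ** Sig (K + D) ** transpose (cl (K + D))"
    using Sig(2)[OF K'] by (simp add: algebra_simps)
  then have "P \<bullet> S0 = P \<bullet> Sig (K + D) - (cl (K + D) ** Sig (K + D) ** transpose (cl (K + D))) \<bullet> P"
    by (metis inner_diff_right inner_commute)
  also have "\<dots> = (P - transpose (cl (K + D)) ** P ** cl (K + D)) \<bullet> Sig (K + D)"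
    unfolding inner_conj inner_diff_left by (simp only: inner_commute)
  finally have "J (K + D) - P \<bullet> S0 =
      (Qk (K + D) + transpose (cl (K + D)) ** P ** cl (K + D) - P) \<bullet> Sig (K + D)"
    unfolding J_def by (simp add: inner_diff_left inner_add_left)
  then show ?thesis unfolding bellman_shift[OF P] .
qed

lemma qform_transpose_mult: "qform (transpose D ** E) x = (D *v x) \<bullet> (E *v x)"
  by (simp add: qform_def matrix_vector_mul_assoc[symmetric] inner_matrix_vector)

lemma qform_shift:
  "qform (transpose D ** E + transpose E ** D + transpose D ** G ** D) x =
    2 * ((D *v x) \<bullet> (E *v x)) + qform G (D *v x)"
  by (simp add: qform_add qform_conj' qform_transpose_mult inner_commute)

lemma inner_shift:
  assumes "symmetric X"
  shows "(transpose D ** E + transpose E ** D + G) \<bullet> X = 2 * (E \<bullet> (D ** X)) + G \<bullet> X"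
proof -
  have X: "transpose X = X" using assms by (simp add: symmetric_def)
  have 1: "(transpose D ** E) \<bullet> X = E \<bullet> (D ** X)" by (simp add: inner_matrix_mult_left)
  have "(transpose E ** D) \<bullet> X = transpose (transpose E ** D) \<bullet> transpose X" by (simp only: inner_transpose)
  also have "\<dots> = E \<bullet> (D ** X)" by (simp add: matrix_transpose_mul X 1)
  finally show ?thesis using 1 by (simp add: inner_add_left)
qed

lemma H_psd: "pos_semidef P \<Longrightarrow> pos_semidef (H P)"
  unfolding H_def using \<gamma> by (intro pos_semidef_add pos_semidef_scaleR R_psd pos_semidef_conj') auto

lemma H_ge: "pos_semidef P \<Longrightarrow> qform R x \<le> qform (H P) x"
  unfolding H_def using \<gamma> pos_semidefD(2)[of P "B *v x"] by (simp add: qform_add qform_scaleR qform_conj')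

subsubsection \<open>Perturbation of the covariance\<close>

text \<open>In \<open>f\<close> the term \<open>2 * b\<close> comes from the cross term and
  \<open>b\<^sup>2\<close> from the quadratic term of the shifted loop; \<open>s\<close> bounds the
  covariance, and division by \<open>lam\<close> turns multiples of \<open>x \<bullet> x\<close>
  into multiples of the form of \<open>S0\<close>.\<close>

lemma perturbation:
  assumes K: "stable K" and s: "\<And>x. qform (Sig K) x \<le> s * (x \<bullet> x)" and b0: "0 \<le> b"
    and b: "\<And>x. sqrt \<gamma> * norm (transpose (B ** D) *v x) \<le> b * norm x"
    and f_def: "f = (2 * b + b\<^sup>2) * s / lam" and f1: "f < 1"
  shows "stable (K + D)"
    and "qform (Sig (K + D)) x \<le> qform (Sig K) x / (1 - f)"
    and "\<bar>qform (Sig (K + D) - Sig K) x\<bar> \<le> f / (1 - f) * qform (Sig K) x"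
    and "0 \<le> f"
proof -
  let ?S = "Sig K" and ?N = "cl K" and ?N' = "cl (K + D)"
  note S = Sig[OF K]
  have s0: "0 \<le> s"
  proof -
    have "lam * (axis undefined 1 \<bullet> (axis undefined 1 :: real^'d)) \<le> s * (axis undefined 1 \<bullet> (axis undefined 1 :: real^'d))"
      using lam_le_Sig[OF K, of "axis undefined 1"] s[of "axis undefined 1"] by linarith
    then show ?thesis using lam by (simp add: inner_axis_axis)
  qed
  have f0: "0 \<le> f" unfolding f_def using b0 s0 lam by auto
  then show "0 \<le> f" .
  \<comment> \<open>\<open>F\<close> measures how far the old covariance is from solving the new
    equation: \<open>c *\<^sub>R Sig K\<close> solves it with source
    \<open>c *\<^sub>R (S0 - F)\<close>.\<close>
  define F where "F = ?N' ** ?S ** transpose ?N' - ?N ** ?S ** transpose ?N"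
  have F: "\<bar>qform F x\<bar> \<le> f * qform S0 x" for x
  proof -
    define u where "u = transpose ?N *v x"
    define v where "v = sqrt \<gamma> *\<^sub>R (transpose (B ** D) *v x)"
    have N': "transpose ?N' *v x = u - v"
      unfolding u_def v_def cl_def
      by (simp add: matrix_distribs scaleR_diff_right matrix_vector_mult_diff_rdistrib scaleR_matrix_vector_assoc[symmetric] algebra_simps)
    have Fx: "qform F x = qform ?S v - 2 * (u \<bullet> (?S *v v))"
      using symmetric_inner[OF pos_semidefD(1)[OF S(1)], of v u]
      by (simp add: F_def qform_diff qform_conj N' u_def[symmetric])
        (simp add: qform_def matrix_vector_mult_diff_distrib inner_diff_left inner_diff_right inner_commute)
    have nv: "norm v \<le> b * norm x" using b[of x] \<gamma> by (simp add: v_def)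
    have vv: "qform ?S v \<le> s * (b * norm x)\<^sup>2"
    proof -
      have "qform ?S v \<le> s * (norm v)\<^sup>2" using s[of v] by (simp add: power2_norm_eq_inner)
      also have "\<dots> \<le> s * (b * norm x)\<^sup>2" using nv s0 by (intro mult_left_mono power_mono) auto
      finally show ?thesis .
    qed
    \<comment> \<open>The Lyapunov equation bounds the form at \<open>u\<close> by the form at
      \<open>x\<close>, so no norm of the closed-loop matrix enters.\<close>
    have uu: "qform ?S u \<le> s * (norm x)\<^sup>2"
    proof -
      have "qform ?S x = qform S0 x + qform ?S u"
        using arg_cong[OF S(2), of "\<lambda>X. qform X x"] by (simp add: qform_add qform_conj u_def)
      then show ?thesis using s[of x] pos_semidefD(2)[OF S0, of x] by (simp add: power2_norm_eq_inner)
    qed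
    have "(u \<bullet> (?S *v v))\<^sup>2 \<le> qform ?S u * qform ?S v" by (rule pos_semidef_cauchy_schwarz[OF S(1)])
    also have "\<dots> \<le> (s * (norm x)\<^sup>2) * (s * (b * norm x)\<^sup>2)"
      using s0 by (intro mult_mono uu vv pos_semidefD(2)[OF S(1)]) auto
    also have "\<dots> = (s * b * (norm x)\<^sup>2)\<^sup>2" by (simp add: power2_eq_square mult_ac)
    finally have uv: "\<bar>u \<bullet> (?S *v v)\<bar> \<le> s * b * (norm x)\<^sup>2"
      using s0 b0 by (simp add: abs_le_square_iff[symmetric])
    have "\<bar>qform F x\<bar> \<le> (2 * b + b\<^sup>2) * s * (norm x)\<^sup>2"
      unfolding Fx using uv vv pos_semidefD(2)[OF S(1), of v]
      by (simp add: algebra_simps power_mult_distrib abs_le_iff)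
    also have "\<dots> = f * (lam * (x \<bullet> x))" using lam by (simp add: f_def power2_norm_eq_inner)
    also have "\<dots> \<le> f * qform S0 x" by (intro mult_left_mono lam_le f0)
    finally show ?thesis .
  qed
  have lyap: "c *\<^sub>R ?S - ?N' ** (c *\<^sub>R ?S) ** transpose ?N' = c *\<^sub>R (S0 - F)" for c
  proof -
    have "?S - ?N' ** ?S ** transpose ?N' = S0 - F" using S(2) by (simp add: F_def algebra_simps)
    then show ?thesis by (simp flip: scaleR_diff_right)
  qed
  \<comment> \<open>With this factor the source dominates \<open>S0\<close>: the rescaled covariance
    is a supersolution, which first proves stability and then bounds the new covariance from
    above.\<close>
  let ?c = "1 / (1 - f)"
  have c: "qform S0 x \<le> qform (?c *\<^sub>R (S0 - F)) x" for x
  proof -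
    have "(1 - f) * qform S0 x \<le> qform S0 x - qform F x" using F[of x] by (simp add: algebra_simps abs_le_iff)
    then show ?thesis using f1 by (simp add: qform_scaleR qform_diff pos_le_divide_eq mult.commute)
  qed
  show st: "stable (K + D)"
    unfolding lyap_stable_def
  proof (intro exI[of _ "?c *\<^sub>R ?S"] exI[of _ lam] conjI allI)
    show "pos_semidef (?c *\<^sub>R ?S)" using f1 S(1) by (intro pos_semidef_scaleR) auto
    show "lam * (x \<bullet> x) \<le> qform (?c *\<^sub>R ?S - ?N' ** (?c *\<^sub>R ?S) ** transpose ?N') x" for x
      unfolding lyap using lam_le[of x] c[of x] by (rule order_trans)
  qed (rule lam)
  note S' = Sig[OF st]
  have S'L: "Sig (K + D) - ?N' ** Sig (K + D) ** transpose ?N' = S0"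
    using S'(2) by (simp add: algebra_simps)
  have up: "qform (Sig (K + D)) x \<le> ?c * qform ?S x" for x
  proof -
    have "0 \<le> qform (?c *\<^sub>R ?S - Sig (K + D)) x"
    proof (rule lyap_nonneg[OF st])
      have "(?c *\<^sub>R ?S - Sig (K + D)) - ?N' ** (?c *\<^sub>R ?S - Sig (K + D)) ** transpose ?N' =
          (?c *\<^sub>R ?S - ?N' ** (?c *\<^sub>R ?S) ** transpose ?N') - (Sig (K + D) - ?N' ** Sig (K + D) ** transpose ?N')"
        by (rule lyap_diff)
      also have "\<dots> = ?c *\<^sub>R (S0 - F) - S0" unfolding lyap S'L ..
      finally show "0 \<le> qform ((?c *\<^sub>R ?S - Sig (K + D)) - ?N' ** (?c *\<^sub>R ?S - Sig (K + D)) ** transpose ?N') x" for x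
        using c[of x] by (simp only: qform_diff)
    qed
    then show ?thesis by (simp only: qform_diff qform_scaleR diff_ge_0_iff_ge)
  qed
  then show "qform (Sig (K + D)) x \<le> qform ?S x / (1 - f)" by simp
  \<comment> \<open>Since \<open>S0 - F\<close> is at most \<open>(1 + f) *\<^sub>R S0\<close>, this
    factor gives a subsolution and the bound from below.\<close>
  let ?d = "1 / (1 + f)"
  have lo: "?d * qform ?S x \<le> qform (Sig (K + D)) x"
  proof -
    have "0 \<le> qform (Sig (K + D) - ?d *\<^sub>R ?S) x"
    proof (rule lyap_nonneg[OF st])
      have "(Sig (K + D) - ?d *\<^sub>R ?S) - ?N' ** (Sig (K + D) - ?d *\<^sub>R ?S) ** transpose ?N' =
          (Sig (K + D) - ?N' ** Sig (K + D) ** transpose ?N') - (?d *\<^sub>R ?S - ?N' ** (?d *\<^sub>R ?S) ** transpose ?N')"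
        by (rule lyap_diff)
      also have "\<dots> = S0 - ?d *\<^sub>R (S0 - F)" unfolding lyap S'L ..
      finally have eq: "(Sig (K + D) - ?d *\<^sub>R ?S) - ?N' ** (Sig (K + D) - ?d *\<^sub>R ?S) ** transpose ?N' = S0 - ?d *\<^sub>R (S0 - F)" .
      have "qform (?d *\<^sub>R (S0 - F)) x \<le> qform S0 x" for x
      proof -
        have "qform S0 x - qform F x \<le> (1 + f) * qform S0 x" using F[of x] by (simp add: algebra_simps abs_le_iff)
        then show ?thesis using f0 by (simp add: qform_scaleR qform_diff pos_divide_le_eq mult.commute)
      qed
      then show "0 \<le> qform ((Sig (K + D) - ?d *\<^sub>R ?S) - ?N' ** (Sig (K + D) - ?d *\<^sub>R ?S) ** transpose ?N') x" for x
        unfolding eq by (simp only: qform_diff) (simp add: le_diff_eq)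
    qed
    then show ?thesis by (simp only: qform_diff qform_scaleR diff_ge_0_iff_ge)
  qed
  have Sx: "0 \<le> qform ?S x" by (rule pos_semidefD(2)[OF S(1)])
  have c': "?c = 1 + f / (1 - f)" using f1 by (simp add: field_simps)
  \<comment> \<open>Weakens the lower factor so that both bounds have the same relative
    error.\<close>
  have d': "1 - f / (1 - f) \<le> ?d"
  proof -
    have "f / (1 + f) \<le> f / (1 - f)" using f0 f1 by (intro divide_left_mono) auto
    moreover have "?d = 1 - f / (1 + f)" using f0 by (simp add: field_simps)
    ultimately show ?thesis by simp
  qed
  have "qform (Sig (K + D) - Sig K) x \<le> f / (1 - f) * qform (Sig K) x"
    using up[of x] unfolding c' by (simp add: qform_diff algebra_simps)
  moreover have "- (f / (1 - f) * qform (Sig K) x) \<le> qform (Sig (K + D) - Sig K) x"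
    using lo mult_right_mono[OF d' Sx] by (simp add: qform_diff algebra_simps)
  ultimately show "\<bar>qform (Sig (K + D) - Sig K) x\<bar> \<le> f / (1 - f) * qform (Sig K) x"
    by (simp add: abs_le_iff)
qed

end

context lq_problem
begin

subsubsection \<open>The gradient\<close>

definition \<beta> :: real where
  "\<beta> = sqrt \<gamma> * spec_norm B"

lemma \<beta>_nonneg: "0 \<le> \<beta>"
  unfolding \<beta>_def using \<gamma> by (simp add: spec_norm_nonneg)

lemma BD_bound: "sqrt \<gamma> * norm (transpose (B ** D) *v x) \<le> (\<beta> * norm D) * norm x"
proof -
  have "norm (transpose (B ** D) *v x) \<le> norm (transpose D) * norm (transpose B *v x)"
    using norm_matrix_vector_le[of "transpose D" "transpose B *v x"]
    by (simp add: matrix_transpose_mul matrix_vector_mul_assoc)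
  also have "\<dots> \<le> norm D * (spec_norm B * norm x)"
    unfolding norm_transpose by (intro mult_left_mono norm_transpose_vector_le) simp
  finally show ?thesis using \<gamma> by (simp add: \<beta>_def mult_ac mult_left_mono)
qed

lemma perturbation_norm:
  assumes K: "stable K" and s: "\<And>x. qform (Sig K) x \<le> s * (x \<bullet> x)"
    and f_def: "f = (2 * (\<beta> * norm D) + (\<beta> * norm D)\<^sup>2) * s / lam" and f1: "f < 1"
  shows "stable (K + D)" and "0 \<le> f"
    and "qform (Sig (K + D)) x \<le> s / (1 - f) * (x \<bullet> x)"
    and "\<bar>qform (Sig (K + D) - Sig K) x\<bar> \<le> f / (1 - f) * s * (x \<bullet> x)"
proof -
  note p = perturbation[OF K s _ BD_bound f_def f1]
  have b: "0 \<le> \<beta> * norm D" using \<beta>_nonneg by simp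
  show "stable (K + D)" "0 \<le> f" using p(1,4)[OF b] by auto
  then have "0 \<le> f / (1 - f)" using f1 by simp
  from mult_left_mono[OF s[of x] this]
  show "\<bar>qform (Sig (K + D) - Sig K) x\<bar> \<le> f / (1 - f) * s * (x \<bullet> x)"
    using p(3)[OF b, of x] by (simp add: mult.assoc)
  have "qform (Sig K) x / (1 - f) \<le> s * (x \<bullet> x) / (1 - f)"
    using s[of x] f1 by (intro divide_right_mono) auto
  then show "qform (Sig (K + D)) x \<le> s / (1 - f) * (x \<bullet> x)" using p(2)[OF b, of x] by simp
qed

text \<open>Dominate first \<open>G\<close>, then \<open>X\<close>, by a multiple of the
  identity.\<close>

lemma quadratic_term_le:
  assumes G: "pos_semidef G" "\<And>x. qform G x \<le> r * (x \<bullet> x)" and r: "0 \<le> r"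
    and X: "pos_semidef X" "\<And>x. qform X x \<le> s * (x \<bullet> x)" and s: "0 \<le> s"
  shows "(transpose D ** G ** D) \<bullet> X \<le> s * r * (norm D)\<^sup>2"
proof -
  have "(transpose D ** G ** D) \<bullet> X \<le> (r *\<^sub>R (transpose D ** mat 1 ** D)) \<bullet> X"
    by (rule inner_pos_semidef_mono[OF _ X(1)])
      (use G(2) in \<open>simp add: qform_conj' qform_scaleR qform_mat1 del: matrix_mul_rid\<close>)
  also have "\<dots> = r * (X \<bullet> (transpose D ** D))" by (simp add: inner_commute)
  also have "\<dots> \<le> r * ((s *\<^sub>R mat 1) \<bullet> (transpose D ** D))"
    by (intro mult_left_mono r inner_pos_semidef_mono)
      (use X(2) pos_semidef_conj'[OF pos_semidef_mat1, of D] in \<open>auto simp: qform_scaleR qform_mat1\<close>)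
  also have "\<dots> = s * r * (norm D)\<^sup>2" by (simp add: norm_matrix_sq(2))
  finally show ?thesis .
qed

lemma Sig_trace_pos: "stable K \<Longrightarrow> lam \<le> mat 1 \<bullet> Sig K"
  using lam_le_Sig[of K "axis undefined 1"] qform_le_trace[OF Sig(1), of K "axis undefined 1"]
  by (simp add: inner_axis_axis)

text \<open>The difference \<open>X\<close> of the covariances is split off so that the linear term
  involves only the old one. The same expansion serves infinitesimal \<open>D\<close> for the
  gradient and the finite step for the descent.\<close>

lemma J_expansion:
  assumes K: "stable K" and s: "\<And>x. qform (Sig K) x \<le> s * (x \<bullet> x)" "0 \<le> s"
    and r: "\<And>x. qform (H (Pk K)) x \<le> r * (x \<bullet> x)" "0 \<le> r"
    and f_def: "f = (2 * (\<beta> * norm D) + (\<beta> * norm D)\<^sup>2) * s / lam" and f1: "f < 1"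
  defines "E \<equiv> Eg (Pk K) K"
  shows "\<exists>X. J (K + D) - J K = 2 * ((E ** Sig K) \<bullet> D) + 2 * ((E ** X) \<bullet> D)
            + (transpose D ** H (Pk K) ** D) \<bullet> Sig (K + D)
          \<and> norm (E ** X) \<le> f / (1 - f) * s * norm E
          \<and> 0 \<le> (transpose D ** H (Pk K) ** D) \<bullet> Sig (K + D)
          \<and> (transpose D ** H (Pk K) ** D) \<bullet> Sig (K + D) \<le> s / (1 - f) * r * (norm D)\<^sup>2"
proof -
  note p = perturbation_norm[OF K s(1) f_def f1]
  note P = Pk[OF K] and S = Sig[OF K] and S' = Sig[OF p(1)]
  define X where "X = Sig (K + D) - Sig K"
  have X: "symmetric X" unfolding X_def by (intro symmetric_diff pos_semidefD(1) S(1) S'(1))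
  have tr: "E \<bullet> (D ** Z) = (E ** Z) \<bullet> D" if "symmetric Z" for Z
  proof -
    have "(E ** Z) \<bullet> D = E \<bullet> (D ** transpose Z)" by (rule inner_matrix_mult_right)
    then show ?thesis using that by (simp add: symmetric_def)
  qed
  have "J (K + D) - J K = 2 * (E \<bullet> (D ** Sig (K + D))) + (transpose D ** H (Pk K) ** D) \<bullet> Sig (K + D)"
    using cost_difference[OF p(1) pos_semidefD(1)[OF P(1)] P(2)] J_eq[OF K P(2)]
      inner_shift[OF pos_semidefD(1)[OF S'(1)], of D E] by (simp add: E_def)
  also have "E \<bullet> (D ** Sig (K + D)) = (E ** Sig K) \<bullet> D + (E ** X) \<bullet> D"
    unfolding tr[OF pos_semidefD(1)[OF S'(1)]] X_def
    by (simp add: matrix_diff_ldistrib inner_diff_left)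
  finally have 1: "J (K + D) - J K = 2 * ((E ** Sig K) \<bullet> D) + 2 * ((E ** X) \<bullet> D)
            + (transpose D ** H (Pk K) ** D) \<bullet> Sig (K + D)" by simp
  have 2: "norm (E ** X) \<le> f / (1 - f) * s * norm E"
    by (rule norm_mult_symmetric_le[OF X]) (use p(4) in \<open>simp add: X_def\<close>)
  have 3: "(transpose D ** H (Pk K) ** D) \<bullet> Sig (K + D) \<le> s / (1 - f) * r * (norm D)\<^sup>2"
    by (rule quadratic_term_le[OF H_psd[OF P(1)] r S'(1) p(3)]) (use s f1 in simp)
  have 4: "0 \<le> (transpose D ** H (Pk K) ** D) \<bullet> Sig (K + D)"
    by (rule inner_pos_semidef_nonneg[OF pos_semidefD(2)[OF pos_semidef_conj'[OF H_psd[OF P(1)]]] S'(1)])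
  show ?thesis using 1 2 3 4 by blast
qed

text \<open>Agreement of \<open>g\<close> with \<open>J\<close> on stable gains suffices because a
  whole ball around \<open>K\<close> consists of stable gains.\<close>

lemma gderiv_cost:
  assumes K: "stable K" and g: "\<And>K'. stable K' \<Longrightarrow> g K' = J K'"
  shows "GDERIV g K :> 2 *\<^sub>R (Eg (Pk K) K ** Sig K)"
proof -
  let ?E = "Eg (Pk K) K"
  define s where "s = mat 1 \<bullet> Sig K"
  define r where "r = mat 1 \<bullet> H (Pk K)"
  have s: "qform (Sig K) x \<le> s * (x \<bullet> x)" for x
    unfolding s_def by (rule qform_le_trace[OF Sig(1)[OF K]])
  have s0: "0 \<le> s" using Sig_trace_pos[OF K] lam by (simp add: s_def)
  have r: "qform (H (Pk K)) x \<le> r * (x \<bullet> x)" for x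
    unfolding r_def by (rule qform_le_trace[OF H_psd[OF Pk(1)[OF K]]])
  have r0: "0 \<le> r"
    unfolding r_def by (rule inner_pos_semidef_nonneg[OF _ H_psd[OF Pk(1)[OF K]]]) (simp add: qform_mat1)
  define q where "q = (2 * \<beta> + \<beta>\<^sup>2) * s / lam"
  have q0: "0 \<le> q" using \<beta>_nonneg s0 lam by (simp add: q_def)
  \<comment> \<open>The first summand pays for the change of covariance, the second for the
    quadratic term, both with \<open>1 / (1 - f)\<close> replaced by 2.\<close>
  define c where "c = 4 * q * s * norm ?E + 2 * s * r"
  \<comment> \<open>Below this radius \<open>f\<close> is at most \<open>q * norm D\<close> and at
    most 1/2.\<close>
  define \<delta> where "\<delta> = min 1 (1 / (2 * q + 1))"
  have \<delta>: "0 < \<delta>" using q0 by (simp add: \<delta>_def)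
  have bound: "norm (g (K + D) - g K - D \<bullet> (2 *\<^sub>R (?E ** Sig K))) / norm D \<le> c * norm D"
    if D: "norm D < \<delta>" "D \<noteq> 0" for D
  proof -
    define f where "f = (2 * (\<beta> * norm D) + (\<beta> * norm D)\<^sup>2) * s / lam"
    have d1: "norm D \<le> 1" using D by (simp add: \<delta>_def)
    have "(norm D)\<^sup>2 \<le> norm D" using d1 by (simp add: power2_eq_square mult_left_le)
    then have "\<beta>\<^sup>2 * (norm D)\<^sup>2 \<le> \<beta>\<^sup>2 * norm D" by (intro mult_left_mono) auto
    then have "2 * (\<beta> * norm D) + (\<beta> * norm D)\<^sup>2 \<le> (2 * \<beta> + \<beta>\<^sup>2) * norm D"
      by (simp add: power_mult_distrib algebra_simps)
    then have fq: "f \<le> q * norm D"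
      using s0 lam mult_right_mono[of _ _ "s / lam"] by (force simp: f_def q_def mult_ac)
    also have "\<dots> \<le> q * (1 / (2 * q + 1))" using D q0 by (intro mult_left_mono) (auto simp: \<delta>_def)
    also have "\<dots> \<le> 1 / 2" using q0 by (simp add: field_simps)
    finally have f2: "f \<le> 1 / 2" .
    then have f1: "f < 1" by simp
    obtain X where X: "J (K + D) - J K = 2 * ((?E ** Sig K) \<bullet> D) + 2 * ((?E ** X) \<bullet> D)
            + (transpose D ** H (Pk K) ** D) \<bullet> Sig (K + D)"
        "norm (?E ** X) \<le> f / (1 - f) * s * norm ?E"
        "0 \<le> (transpose D ** H (Pk K) ** D) \<bullet> Sig (K + D)"
        "(transpose D ** H (Pk K) ** D) \<bullet> Sig (K + D) \<le> s / (1 - f) * r * (norm D)\<^sup>2"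
      using J_expansion[OF K s s0 r r0 f_def f1] by blast
    note p = perturbation_norm[OF K s f_def f1]
    have f0: "0 \<le> f" by (rule p(2))
    have i: "1 / (1 - f) \<le> 2" using f2 by (simp add: field_simps)
    have "f / (1 - f) * s * norm ?E \<le> (2 * (q * norm D)) * s * norm ?E"
    proof (intro mult_right_mono s0 norm_ge_zero)
      have "f * (1 / (1 - f)) \<le> (q * norm D) * 2" using fq i f0 f1 q0 by (intro mult_mono) auto
      then show "f / (1 - f) \<le> 2 * (q * norm D)" by simp
    qed
    with X(2) have "norm (?E ** X) \<le> (2 * (q * norm D)) * s * norm ?E" by simp
    then have "norm (?E ** X) * norm D \<le> ((2 * (q * norm D)) * s * norm ?E) * norm D"
      by (rule mult_right_mono) simp
    then have a: "\<bar>(?E ** X) \<bullet> D\<bar> \<le> 2 * q * s * norm ?E * (norm D)\<^sup>2"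
      using Cauchy_Schwarz_ineq2[of "?E ** X" D] by (simp add: power2_eq_square mult_ac)
    have "s / (1 - f) * r * (norm D)\<^sup>2 \<le> (2 * s) * r * (norm D)\<^sup>2"
      using mult_left_mono[OF i s0] by (intro mult_right_mono r0) (auto simp: mult.commute)
    with X(4) have b: "(transpose D ** H (Pk K) ** D) \<bullet> Sig (K + D) \<le> 2 * s * r * (norm D)\<^sup>2" by simp
    have "norm (g (K + D) - g K - D \<bullet> (2 *\<^sub>R (?E ** Sig K))) =
        \<bar>2 * ((?E ** X) \<bullet> D) + (transpose D ** H (Pk K) ** D) \<bullet> Sig (K + D)\<bar>"
      using X(1) by (simp add: g[OF p(1)] g[OF K] inner_commute[of D])
    also have "\<dots> \<le> c * (norm D)\<^sup>2"
      using a b X(3) by (simp add: c_def algebra_simps abs_le_iff)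
    finally show ?thesis using D by (simp add: divide_simps power2_eq_square mult_ac)
  qed
  have "(\<lambda>D. norm (g (K + D) - g K - D \<bullet> (2 *\<^sub>R (?E ** Sig K))) / norm D) \<midarrow>0\<rightarrow> 0"
  proof (rule Lim_null_comparison)
    show "\<forall>\<^sub>F D in at 0. norm (norm (g (K + D) - g K - D \<bullet> (2 *\<^sub>R (?E ** Sig K))) / norm D) \<le> c * norm D"
      unfolding eventually_at using \<delta> bound by (intro exI[of _ \<delta>]) (auto simp: dist_norm)
    show "((\<lambda>D. c * norm D) \<longlongrightarrow> 0) (at 0)"
      by (rule tendsto_eq_intros refl | simp)+
  qed
  then show ?thesis
    unfolding gderiv_def has_derivative_at by (intro conjI bounded_linear_inner_left)
qed

lemma grad_cost:
  assumes "stable K" and "\<And>K'. stable K' \<Longrightarrow> g K' = J K'"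
  shows "grad g K = 2 *\<^sub>R (Eg (Pk K) K ** Sig K)"
  unfolding grad_def
proof (rule the_equality)
  let ?G = "2 *\<^sub>R (Eg (Pk K) K ** Sig K)"
  show G: "GDERIV g K :> ?G" by (rule gderiv_cost[OF assms])
  show "D = ?G" if "GDERIV g K :> D" for D
  proof -
    have "(\<lambda>h. h \<bullet> D) = (\<lambda>h. h \<bullet> ?G)"
      using has_derivative_unique that G unfolding gderiv_def by blast
    \<comment> \<open>Evaluating both derivatives at the difference of the two candidates makes its
      norm vanish.\<close>
    then have "(D - ?G) \<bullet> D = (D - ?G) \<bullet> ?G" by (rule fun_cong)
    then have "(D - ?G) \<bullet> (D - ?G) = 0" by (simp add: inner_diff_right)
    then show ?thesis by simp
  qed
qed

subsubsection \<open>Gradient domination and descent\<close>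

text \<open>Completing the square bounds the integrand below by the form of
  \<open>transpose E ** E\<close> times \<open>- 1 / r\<close>. The covariance is that of the
  comparison gain, so the constant does not depend on \<open>K\<close>.\<close>

lemma gradient_domination:
  assumes K: "stable K" and Ks: "stable Ks" and r: "0 < r" "\<And>x. r * (x \<bullet> x) \<le> qform R x"
    and s: "\<And>x. qform (Sig Ks) x \<le> s * (x \<bullet> x)"
  shows "J K - J Ks \<le> s / r * (norm (Eg (Pk K) K))\<^sup>2"
proof -
  let ?E = "Eg (Pk K) K" and ?D = "Ks - K"
  note P = Pk[OF K] and S = Sig[OF Ks]
  have "(- (1 / r)) *\<^sub>R (transpose ?E ** ?E) \<bullet> Sig Ks \<le>
      (transpose ?D ** ?E + transpose ?E ** ?D + transpose ?D ** H (Pk K) ** ?D) \<bullet> Sig Ks"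
  proof (rule inner_pos_semidef_mono[OF _ S(1)])
    fix x
    let ?u = "?D *v x" and ?v = "?E *v x"
    \<comment> \<open>The square to be completed, scaled by \<open>r\<close> to avoid a
      root.\<close>
    have "0 \<le> (r *\<^sub>R ?u + ?v) \<bullet> (r *\<^sub>R ?u + ?v)" by simp
    then have "- (?v \<bullet> ?v) \<le> r * (2 * (?u \<bullet> ?v) + r * (?u \<bullet> ?u))"
      by (simp add: inner_add_left inner_add_right inner_commute algebra_simps)
    then have "- (1 / r) * (?v \<bullet> ?v) \<le> 2 * (?u \<bullet> ?v) + r * (?u \<bullet> ?u)"
      using r(1) by (simp add: field_simps)
    also have "\<dots> \<le> 2 * (?u \<bullet> ?v) + qform (H (Pk K)) ?u"
      using r(2)[of ?u] H_ge[OF P(1), of ?u] by simp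
    finally show "qform ((- (1 / r)) *\<^sub>R (transpose ?E ** ?E)) x \<le>
        qform (transpose ?D ** ?E + transpose ?E ** ?D + transpose ?D ** H (Pk K) ** ?D) x"
      by (simp add: qform_shift qform_minus qform_scaleR qform_transpose_mult)
  qed
  also have "\<dots> = J Ks - J K"
    using cost_difference[of K ?D "Pk K"] Ks pos_semidefD(1)[OF P(1)] P(2) J_eq[OF K P(2)] by simp
  finally have "J K - J Ks \<le> (1 / r) * (Sig Ks \<bullet> (transpose ?E ** ?E))" by (simp add: inner_commute)
  also have "\<dots> \<le> (1 / r) * ((s *\<^sub>R mat 1) \<bullet> (transpose ?E ** ?E))"
    by (intro mult_left_mono inner_pos_semidef_mono)
      (use s r pos_semidef_conj'[OF pos_semidef_mat1, of ?E] in \<open>auto simp: qform_scaleR qform_mat1\<close>)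
  finally show ?thesis by (simp add: norm_matrix_sq(2) mult_ac)
qed

text \<open>A trial step along the negative gradient cannot make the Bellman right-hand side
  negative, so its gain is at most the value matrix itself. This bounds the step length by the
  cost.\<close>

lemma gradient_upper:
  assumes K: "stable K" and \<rho>: "0 < \<rho>" "\<And>x. qform (H (Pk K)) x \<le> \<rho> * (x \<bullet> x)"
  shows "lam * (norm (Eg (Pk K) K))\<^sup>2 \<le> \<rho> * J K"
proof -
  let ?E = "Eg (Pk K) K" and ?D = "- (1 / \<rho>) *\<^sub>R Eg (Pk K) K"
  note P = Pk[OF K]
  have "(1 / \<rho>) *\<^sub>R (transpose ?E ** ?E) \<bullet> S0 \<le> Pk K \<bullet> S0"
  proof (rule inner_pos_semidef_mono[OF _ S0])
    fix x
    let ?v = "?E *v x"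
    have Dx: "?D *v x = - (1 / \<rho>) *\<^sub>R ?v" by (simp add: scaleR_matrix_vector_assoc)
    \<comment> \<open>Positivity comes from the form of the expression; the trial gain need not be
      stable.\<close>
    have "0 \<le> qform (Qk (K + ?D) + transpose (cl (K + ?D)) ** Pk K ** cl (K + ?D)) x"
      by (intro pos_semidefD(2) pos_semidef_add Qk_psd pos_semidef_conj' P(1))
    also have "\<dots> = qform (Pk K) x + (2 * ((?D *v x) \<bullet> ?v) + qform (H (Pk K)) (?D *v x))"
      using arg_cong[OF bellman_shift[OF pos_semidefD(1)[OF P(1)] P(2), of ?D], of "\<lambda>X. qform X x"]
      unfolding qform_shift qform_diff by linarith
    also have "\<dots> \<le> qform (Pk K) x + (2 * ((?D *v x) \<bullet> ?v) + \<rho> * ((?D *v x) \<bullet> (?D *v x)))"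
      using \<rho>(2)[of "?D *v x"] by simp
    also have "\<dots> = qform (Pk K) x - (1 / \<rho>) * (?v \<bullet> ?v)"
      unfolding Dx using \<rho>(1) by (simp add: field_simps)
    finally show "qform ((1 / \<rho>) *\<^sub>R (transpose ?E ** ?E)) x \<le> qform (Pk K) x"
      by (simp add: qform_scaleR qform_transpose_mult)
  qed
  then have 1: "(S0 \<bullet> (transpose ?E ** ?E)) \<le> \<rho> * J K"
    using \<rho>(1) J_eq[OF K P(2)] by (simp add: field_simps inner_commute)
  have "(lam *\<^sub>R mat 1) \<bullet> (transpose ?E ** ?E) \<le> S0 \<bullet> (transpose ?E ** ?E)"
    by (intro inner_pos_semidef_mono)
      (use lam_le pos_semidef_conj'[OF pos_semidef_mat1, of ?E] in \<open>auto simp: qform_scaleR qform_mat1\<close>)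
  then show ?thesis using 1 by (simp add: norm_matrix_sq(2))
qed

section \<open>Bounds on the value matrix and the covariance in terms of the cost\<close>

lemma J_nonneg: "stable K \<Longrightarrow> 0 \<le> J K"
  unfolding J_def by (rule inner_pos_semidef_nonneg[OF pos_semidefD(2)[OF Qk_psd] Sig(1)])

lemma Pk_trace_le:
  assumes "stable K"
  shows "mat 1 \<bullet> Pk K \<le> J K / lam"
proof -
  note P = Pk[OF assms]
  have "(lam *\<^sub>R mat 1) \<bullet> Pk K \<le> S0 \<bullet> Pk K"
    by (intro inner_pos_semidef_mono P(1)) (auto simp: qform_scaleR qform_mat1 lam_le)
  then show ?thesis using lam J_eq[OF assms P(2)] by (simp add: field_simps inner_commute)
qed

text \<open>The trace of the value matrix is at most the cost divided by \<open>lam\<close>; this is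
  the origin of the second factor of \<open>h_hess\<close>.\<close>

lemma H_le:
  assumes "stable K" and "J K \<le> C"
  shows "qform (H (Pk K)) x \<le> (spec_norm R + \<gamma> * (spec_norm B)\<^sup>2 * (C / lam)) * (x \<bullet> x)"
proof -
  have "qform (Pk K) (B *v x) \<le> (C / lam) * (spec_norm B * norm x)\<^sup>2"
  proof -
    have "qform (Pk K) (B *v x) \<le> (mat 1 \<bullet> Pk K) * (norm (B *v x))\<^sup>2"
      using qform_le_trace[OF Pk(1)[OF assms(1)]] by (simp add: power2_norm_eq_inner)
    also have "\<dots> \<le> (C / lam) * (spec_norm B * norm x)\<^sup>2"
    proof (intro mult_mono power_mono spec_norm_bound)
      have "J K / lam \<le> C / lam" using assms(2) lam by (simp add: divide_right_mono)
      then show "mat 1 \<bullet> Pk K \<le> C / lam" using Pk_trace_le[OF assms(1)] by simp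
      show "0 \<le> C / lam" using J_nonneg[OF assms(1)] assms(2) lam by simp
    qed auto
    finally show ?thesis .
  qed
  then have "\<gamma> * qform (Pk K) (B *v x) \<le> \<gamma> * ((C / lam) * (spec_norm B * norm x)\<^sup>2)"
    using \<gamma> by (intro mult_left_mono) auto
  then show ?thesis using qform_le_spec_norm[of R x]
    by (simp add: H_def qform_add qform_scaleR qform_conj' power2_norm_eq_inner[symmetric] power_mult_distrib algebra_simps)
qed

text \<open>The stage cost dominates \<open>q\<close> times the squared state. Positive definiteness
  of \<open>Q\<close> enters the step size through this bound.\<close>

lemma Sig_trace_le:
  assumes "stable K" and q: "0 < q" "\<And>x. q * (x \<bullet> x) \<le> qform Q x"
  shows "mat 1 \<bullet> Sig K \<le> J K / q"
proof -
  have "(q *\<^sub>R mat 1) \<bullet> Sig K \<le> J K"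
    unfolding J_def
  proof (rule inner_pos_semidef_mono[OF _ Sig(1)[OF assms(1)]])
    fix x show "qform (q *\<^sub>R mat 1) x \<le> qform (Qk K) x"
      using q(2)[of x] pos_semidefD(2)[OF R_psd, of "K *v x"]
      by (simp add: Qk_def qform_add qform_conj' qform_scaleR qform_mat1)
  qed
  then show ?thesis using q(1) by (simp add: field_simps)
qed

text \<open>The linear term is \<open>- 4 * t\<close> with
  \<open>t = \<eta> * (norm G)\<^sup>2\<close>; the claim retains half of it and leaves
  \<open>2 * t\<close> for the change of covariance and the quadratic term.\<close>

lemma descent:
  assumes K: "stable K" and J: "J K \<le> C" and g1: "\<gamma> < 1"
    and q: "0 < q" "\<And>x. q * (x \<bullet> x) \<le> qform Q x" and \<eta>: "0 < \<eta>"
    and \<rho>_def: "\<rho> = spec_norm R + \<gamma> * (spec_norm B)\<^sup>2 * (C / lam)"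
    and step1: "\<eta> * (8 * ((1 + 1 / sqrt \<gamma>) * spec_norm B * C ^ 3) / (lam\<^sup>2 * q ^ 3) * sqrt (\<rho> * (C / lam))) \<le> 1 / 4"
    and step2: "\<eta> * (2 * C / q * \<rho>) \<le> 1 / 4"
  defines "G \<equiv> Eg (Pk K) K ** Sig K"
  shows "stable (K - \<eta> *\<^sub>R (2 *\<^sub>R G))" and "J (K - \<eta> *\<^sub>R (2 *\<^sub>R G)) \<le> J K - 2 * \<eta> * (norm G)\<^sup>2"
proof -
  let ?E = "Eg (Pk K) K"
  define D where "D = - (2 * \<eta>) *\<^sub>R G"
  have KD: "K - \<eta> *\<^sub>R (2 *\<^sub>R G) = K + D" by (simp add: D_def mult.commute)
  define s where "s = C / q"
  have tr_s: "mat 1 \<bullet> Sig K \<le> s"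
    using Sig_trace_le[OF K q] divide_right_mono[OF J, of q] q(1) by (simp add: s_def)
  have s: "qform (Sig K) x \<le> s * (x \<bullet> x)" for x
    using qform_le_trace[OF Sig(1)[OF K], of x] mult_right_mono[OF tr_s, of "x \<bullet> x"] by simp
  have s0: "0 < s" and ls: "lam \<le> s" using Sig_trace_pos[OF K] lam tr_s by auto
  have C0: "0 < C" using s0 q(1) by (simp add: s_def zero_less_divide_iff)
  have \<rho>0: "0 < \<rho>"
    unfolding \<rho>_def using hess_factor_pos[OF R \<gamma> _ lam, of C B] C0 by simp
  have r: "qform (H (Pk K)) x \<le> \<rho> * (x \<bullet> x)" for x
    unfolding \<rho>_def by (rule H_le[OF K J])
  \<comment> \<open>Bounds the condition number of the covariance, whose form lies between
    \<open>lam\<close> and \<open>s\<close>.\<close>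
  define a where "a = s / lam"
  have a1: "1 \<le> a" using ls lam by (simp add: a_def)
  define w where "w = sqrt (\<rho> * (C / lam))"
  have w0: "0 \<le> w" using \<rho>0 C0 lam by (simp add: w_def)
  have E_le: "norm ?E \<le> w"
  proof -
    have "lam * (norm ?E)\<^sup>2 \<le> \<rho> * C"
      by (rule order_trans[OF gradient_upper[OF K \<rho>0 r] mult_left_mono[OF J]]) (use \<rho>0 in simp)
    then have "(norm ?E)\<^sup>2 \<le> \<rho> * (C / lam)" using lam by (simp add: field_simps)
    then show ?thesis unfolding w_def by (rule real_le_rsqrt)
  qed
  have G_le: "norm G \<le> s * norm ?E"
    unfolding G_def by (rule norm_mult_symmetric_le[OF pos_semidefD(1)[OF Sig(1)[OF K]]])
      (use s pos_semidefD(2)[OF Sig(1)[OF K]] in simp)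
  have G_ge: "lam * norm ?E \<le> norm G"
    unfolding G_def using lam
    by (intro norm_mult_ge pos_semidefD(1)[OF Sig(1)[OF K]] lam_le_Sig[OF K]) auto
  define b where "b = \<beta> * norm D"
  have b0: "0 \<le> b" unfolding b_def using \<beta>_nonneg by simp
  \<comment> \<open>Since \<open>s * a\<^sup>2 = C ^ 3 / (lam\<^sup>2 * q ^ 3)\<close> and
    \<open>2 * sqrt \<gamma> \<le> 1 + 1 / sqrt \<gamma>\<close>, the left side is at most one
    eighth of the quantity in \<open>step1\<close>.\<close>
  have ba: "b * a\<^sup>2 \<le> 1 / 32"
  proof -
    have nD: "norm D = 2 * \<eta> * norm G" using \<eta> by (simp add: D_def)
    also have "\<dots> \<le> 2 * \<eta> * (s * w)"
    proof (rule mult_left_mono)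
      show "norm G \<le> s * w" by (rule order_trans[OF G_le mult_left_mono[OF E_le]]) (use s0 in simp)
    qed (use \<eta> in simp)
    finally have nD: "norm D \<le> 2 * \<eta> * (s * w)" .
    have sg: "2 * sqrt \<gamma> \<le> 1 + 1 / sqrt \<gamma>"
    proof -
      have "sqrt \<gamma> \<le> 1" "0 < sqrt \<gamma>" using \<gamma> g1 by auto
      then show ?thesis by (smt (verit) le_divide_eq_1)
    qed
    have "b * a\<^sup>2 \<le> (\<beta> * (2 * \<eta> * (s * w))) * a\<^sup>2"
      unfolding b_def using nD \<beta>_nonneg by (intro mult_right_mono mult_left_mono) auto
    also have "\<dots> = (2 * sqrt \<gamma>) * (spec_norm B * \<eta> * s * w * a\<^sup>2)" by (simp add: \<beta>_def mult_ac)
    also have "\<dots> \<le> (1 + 1 / sqrt \<gamma>) * (spec_norm B * \<eta> * s * w * a\<^sup>2)"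
      using sg \<eta> s0 w0 spec_norm_nonneg[of B] by (intro mult_right_mono) auto
    also have "\<dots> = (\<eta> * (8 * ((1 + 1 / sqrt \<gamma>) * spec_norm B * C ^ 3) / (lam\<^sup>2 * q ^ 3) * w)) / 8"
      using lam q(1) by (simp add: a_def s_def power2_eq_square power3_eq_cube field_simps)
    also have "\<dots> \<le> 1 / 32"
    proof -
      have "x / 8 \<le> 1 / 32" if "x \<le> 1 / 4" for x :: real using that by simp
      from this[OF step1] show ?thesis unfolding w_def .
    qed
    finally show ?thesis .
  qed
  define f where "f = (2 * (\<beta> * norm D) + (\<beta> * norm D)\<^sup>2) * s / lam"
  \<comment> \<open>Here \<open>f = (2 + b) * b * a\<close>. The extra factor \<open>a\<close> is
    the price of replacing \<open>s * norm E\<close> by \<open>a * norm G\<close>; numerically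
    65/1024 is (2 + 1/32)/32.\<close>
  have fa: "f * a \<le> 65 / 1024"
  proof -
    have a2: "1 \<le> a\<^sup>2" using a1 by simp
    have "b \<le> b * a\<^sup>2" using mult_left_mono[OF a2 b0] by simp
    then have b1: "b \<le> 1 / 32" using ba by simp
    have "f * a = (2 + b) * (b * a\<^sup>2)" 
      unfolding f_def a_def b_def[symmetric] using lam by (simp add: power2_eq_square field_simps)
    also have "\<dots> \<le> (2 + 1 / 32) * (1 / 32)" using b0 b1 ba by (intro mult_mono) auto
    finally show ?thesis by simp
  qed
  have f0: "0 \<le> f" unfolding f_def using \<beta>_nonneg s0 lam by auto
  have "f \<le> f * a" using mult_left_mono[OF a1 f0] by simp
  with fa have fs: "f \<le> 65 / 1024" by simp
  then have f1: "f < 1" by simp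
  have i: "1 / (1 - f) \<le> 8 / 7" using fs by (simp add: field_simps)
  show "stable (K - \<eta> *\<^sub>R (2 *\<^sub>R G))"
    unfolding KD by (rule perturbation_norm(1)[OF K s f_def f1])
  obtain X where X: "J (K + D) - J K = 2 * (G \<bullet> D) + 2 * ((?E ** X) \<bullet> D)
          + (transpose D ** H (Pk K) ** D) \<bullet> Sig (K + D)"
      "norm (?E ** X) \<le> f / (1 - f) * s * norm ?E"
      "(transpose D ** H (Pk K) ** D) \<bullet> Sig (K + D) \<le> s / (1 - f) * \<rho> * (norm D)\<^sup>2"
    using J_expansion[OF K s _ r _ f_def f1] s0 \<rho>0 unfolding G_def by fastforce
  define t where "t = \<eta> * (norm G)\<^sup>2"
  have t0: "0 \<le> t" using \<eta> by (simp add: t_def)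
  have A1: "2 * (G \<bullet> D) = - 4 * t" by (simp add: D_def t_def power2_norm_eq_inner)
  have A2: "2 * ((?E ** X) \<bullet> D) \<le> 4 * (1 / 8) * t"
  proof -
    have "norm (?E ** X) \<le> f * (1 / (1 - f)) * a * (lam * norm ?E)" using X(2) lam by (simp add: a_def)
    also have "\<dots> \<le> f * (1 / (1 - f)) * a * norm G"
      using G_ge f0 f1 a1 by (intro mult_left_mono) auto
    also have "\<dots> = (f * a) * (1 / (1 - f)) * norm G" by simp
    also have "\<dots> \<le> (65 / 1024) * (8 / 7) * norm G"
      using fa i f1 by (intro mult_right_mono mult_mono) auto
    also have "\<dots> \<le> (1 / 8) * norm G" by (intro mult_right_mono) auto
    finally have "norm (?E ** X) * norm G \<le> (1 / 8) * norm G * norm G" by (rule mult_right_mono) simp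
    then have "- ((?E ** X) \<bullet> G) \<le> (1 / 8) * (norm G)\<^sup>2"
      using Cauchy_Schwarz_ineq2[of "?E ** X" G] by (simp add: power2_eq_square)
    then have "4 * \<eta> * (- ((?E ** X) \<bullet> G)) \<le> 4 * \<eta> * ((1 / 8) * (norm G)\<^sup>2)"
      using \<eta> by (intro mult_left_mono) auto
    then show ?thesis by (simp add: D_def t_def mult_ac)
  qed
  \<comment> \<open>Of the two factors \<eta> in the squared step, one is absorbed by
    \<open>step2\<close> and the other remains in \<open>t\<close>.\<close>
  have A3: "(transpose D ** H (Pk K) ** D) \<bullet> Sig (K + D) \<le> 4 * (1 / 7) * t"
  proof -
    have "s / (1 - f) * \<rho> * (norm D)\<^sup>2 = (\<eta> * (2 * C / q * \<rho>)) * (1 / (1 - f)) * (2 * t)"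
      using \<eta> q(1) by (simp add: D_def t_def s_def power2_eq_square)
    also have "\<dots> \<le> (1 / 4) * (8 / 7) * (2 * t)"
      using step2 i f1 t0 by (intro mult_right_mono mult_mono) auto
    finally show ?thesis using order_trans[OF X(3)] by fastforce
  qed
  \<comment> \<open>The balance is -4 + 1/2 + 4/7, which is below -2.\<close>
  have "J (K + D) - J K \<le> - 2 * t" using X(1) A1 A2 A3 t0 by simp
  then show "J (K - \<eta> *\<^sub>R (2 *\<^sub>R G)) \<le> J K - 2 * \<eta> * (norm G)\<^sup>2"
    unfolding KD t_def by simp
qed

text \<open>Gradient domination bounds the gap by \<open>s / r\<close> times the squared norm of
  \<open>E\<close>, and \<open>lam * norm E\<close> is at most the norm of \<open>G\<close>; the
  factor 4 / 2 is the 2 of the guaranteed decrease.\<close>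

lemma contraction:
  assumes K: "stable K" and Ks: "stable Ks" and r: "0 < r" "\<And>x. r * (x \<bullet> x) \<le> qform R x"
    and s: "0 < s" "\<And>x. qform (Sig Ks) x \<le> s * (x \<bullet> x)" and \<eta>: "0 < \<eta>"
    and K': "J K' \<le> J K - 2 * \<eta> * (norm (Eg (Pk K) K ** Sig K))\<^sup>2"
  shows "J K' - J Ks \<le> (1 - \<eta> * (4 * lam\<^sup>2 * r / s / 2)) * (J K - J Ks)"
proof -
  let ?E = "Eg (Pk K) K"
  have "lam * norm ?E \<le> norm (?E ** Sig K)"
    using lam by (intro norm_mult_ge pos_semidefD(1)[OF Sig(1)[OF K]] lam_le_Sig[OF K]) auto
  then have "(lam * norm ?E)\<^sup>2 \<le> (norm (?E ** Sig K))\<^sup>2" using lam by (intro power_mono) auto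
  then have 1: "2 * \<eta> * (lam\<^sup>2 * (norm ?E)\<^sup>2) \<le> 2 * \<eta> * (norm (?E ** Sig K))\<^sup>2"
    using \<eta> by (simp add: power_mult_distrib)
  have "r / s * (J K - J Ks) \<le> r / s * (s / r * (norm ?E)\<^sup>2)"
    using r(1) s(1) by (intro mult_left_mono gradient_domination K Ks r s) auto
  also have "\<dots> = (norm ?E)\<^sup>2" using r(1) s(1) by simp
  finally have "2 * \<eta> * lam\<^sup>2 * (r / s * (J K - J Ks)) \<le> 2 * \<eta> * lam\<^sup>2 * (norm ?E)\<^sup>2"
    using \<eta> by (intro mult_left_mono) auto
  with 1 K' show ?thesis by (simp add: algebra_simps)
qed

subsubsection \<open>The Riccati equation\<close>

text \<open>The gain is given through the inverse of \<open>T\<close>, the Riccati equation through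
  the inverse of \<open>H P\<close>. The push-through identity
  \<open>H P ** Ri ** transpose B ** P = transpose B ** P ** T\<close> reconciles them and says that
  \<open>Ks\<close> is stationary.\<close>

lemma riccati_bellman:
  assumes P: "riccati_solution \<gamma> A B Q R P"
  defines "Ks \<equiv> optimal_gain \<gamma> A B R P"
  shows "P = Qk Ks + transpose (cl Ks) ** P ** cl Ks" and "Eg P Ks = 0"
proof -
  have Pp: "pos_semidef P"
    and Pe: "P = Q + \<gamma> *\<^sub>R (transpose A ** P ** A)
           - \<gamma>\<^sup>2 *\<^sub>R (transpose A ** P ** B ** matrix_inv (H P) ** transpose B ** P ** A)"
    using P by (simp_all add: riccati_solution_def H_def)
  have inv_I: "M ** matrix_inv M = mat 1 \<and> matrix_inv M ** M = mat 1"
    if "\<And>x. M *v x = 0 \<Longrightarrow> x = 0" for M :: "real^'n^'n"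
  proof -
    have "\<exists>M'. M' ** M = mat 1" unfolding matrix_left_invertible_ker using that by blast
    then have "\<exists>M'. M ** M' = mat 1 \<and> M' ** M = mat 1" using matrix_left_right_inverse by blast
    from someI_ex[OF this] show ?thesis unfolding matrix_inv_def .
  qed
  have R0: "x = 0" if "R *v x = 0" for x
    using R that unfolding pos_def_def qform_def by (metis inner_zero_right less_irrefl)
  define Ri where "Ri = matrix_inv R"
  have Ri: "R ** Ri = mat 1" "Ri ** R = mat 1" using inv_I[OF R0] by (auto simp: Ri_def)
  have H0: "x = 0" if "H P *v x = 0" for x
    using R H_ge[OF Pp, of x] that unfolding pos_def_def qform_def[of "H P"]
    by (metis inner_zero_right not_less)
  define Hi where "Hi = matrix_inv (H P)"
  have Hi: "H P ** Hi = mat 1" "Hi ** H P = mat 1" using inv_I[OF H0] by (auto simp: Hi_def)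
  define T where "T = mat 1 + \<gamma> *\<^sub>R (B ** Ri ** transpose B ** P)"
  \<comment> \<open>\<open>T\<close> need not be symmetric. Pairing \<open>T *v x\<close> with
    \<open>P *v x\<close> gives a sum of two nonnegative forms, so the control \<open>v\<close>
    vanishes and with it \<open>x\<close>.\<close>
  have T0: "x = 0" if x: "T *v x = 0" for x
  proof -
    define v where "v = Ri *v (transpose B *v (P *v x))"
    have Tx: "T *v x = x + \<gamma> *\<^sub>R (B *v v)"
      by (simp add: T_def v_def matrix_vector_mult_add_rdistrib scaleR_matrix_vector_assoc[symmetric] matrix_vector_mul_assoc matrix_mul_assoc)
    have Rv: "R *v v = transpose B *v (P *v x)"
      unfolding v_def by (simp add: matrix_vector_mul_assoc matrix_mul_assoc Ri)
    have "(P *v x) \<bullet> (B *v v) = qform R v"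
      using inner_matrix_vector[of "P *v x" B v] by (simp add: qform_def Rv inner_commute)
    then have "0 = qform P x + \<gamma> * qform R v"
      using arg_cong[OF x, of "\<lambda>y. (P *v x) \<bullet> y"] unfolding Tx
      by (simp add: inner_add_right qform_def inner_commute)
    moreover have "0 \<le> qform P x" "0 \<le> qform R v" by (auto intro: pos_semidefD(2) Pp R_psd)
    ultimately have "qform R v = 0" using \<gamma> by (smt (verit) mult_pos_pos)
    then have "v = 0" using R unfolding pos_def_def by (metis less_irrefl)
    then show ?thesis using x Tx by simp
  qed
  define Ti where "Ti = matrix_inv T"
  have Ti: "T ** Ti = mat 1" using inv_I[OF T0] by (auto simp: Ti_def)
  have Ks: "Ks = \<gamma> *\<^sub>R (Ri ** transpose B ** P ** Ti ** A)"
    unfolding Ks_def optimal_gain_def Let_def Ri_def[symmetric] T_def[symmetric] Ti_def[symmetric]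
    by (simp add: matrix_mul_assoc)
  have "H P ** Ri ** transpose B ** P = transpose B ** P ** T"
    by (simp add: H_def T_def matrix_distribs Ri)
  then have HK: "H P ** Ks = \<gamma> *\<^sub>R (transpose B ** P ** A)"
  proof -
    assume a: "H P ** Ri ** transpose B ** P = transpose B ** P ** T"
    have "H P ** Ks = \<gamma> *\<^sub>R ((H P ** Ri ** transpose B ** P) ** Ti ** A)"
      by (simp add: Ks matrix_mul_assoc)
    also have "\<dots> = \<gamma> *\<^sub>R (transpose B ** P ** (T ** Ti) ** A)" unfolding a by (simp add: matrix_mul_assoc)
    finally show ?thesis by (simp add: Ti)
  qed
  then show "Eg P Ks = 0" by (simp add: Eg_def)
  \<comment> \<open>Rewrites the gain with the inverse of \<open>H P\<close>, as it occurs in the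
    Riccati equation.\<close>
  have "Hi ** (H P ** Ks) = Ks" by (simp add: matrix_mul_assoc Hi)
  then have Ks': "\<gamma> *\<^sub>R (Hi ** transpose B ** P ** A) = Ks" unfolding HK by (simp add: matrix_mul_assoc)
  have "\<gamma>\<^sup>2 *\<^sub>R (transpose A ** P ** B ** matrix_inv (H P) ** transpose B ** P ** A) =
      \<gamma> *\<^sub>R (transpose A ** P ** B ** (\<gamma> *\<^sub>R (Hi ** transpose B ** P ** A)))"
    by (simp add: Hi_def matrix_mul_assoc power2_eq_square)
  then have Pe': "P = Q + \<gamma> *\<^sub>R (transpose A ** P ** A) - \<gamma> *\<^sub>R (transpose A ** P ** B ** Ks)"
    using Pe unfolding Ks' by simp
  have "transpose Ks ** (H P ** Ks) = \<gamma> *\<^sub>R (transpose Ks ** transpose B ** P ** A)"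
    unfolding HK by (simp add: matrix_mul_assoc)
  then have KHK: "transpose Ks ** R ** Ks + \<gamma> *\<^sub>R (transpose Ks ** transpose B ** P ** B ** Ks) =
      \<gamma> *\<^sub>R (transpose Ks ** transpose B ** P ** A)"
    by (simp add: H_def matrix_distribs)
  have "transpose (cl Ks) ** P ** cl Ks = \<gamma> *\<^sub>R (transpose (A - B ** Ks) ** P ** (A - B ** Ks))"
    using \<gamma> by (simp add: cl_def transpose_scalar)
  then have "Qk Ks + transpose (cl Ks) ** P ** cl Ks =
      Q + (transpose Ks ** R ** Ks + \<gamma> *\<^sub>R (transpose Ks ** transpose B ** P ** B ** Ks))
      + \<gamma> *\<^sub>R (transpose A ** P ** A) - \<gamma> *\<^sub>R (transpose A ** P ** B ** Ks)
      - \<gamma> *\<^sub>R (transpose Ks ** transpose B ** P ** A)"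
    by (simp add: Qk_def matrix_distribs scaleR_add_right scaleR_diff_right)
  also have "\<dots> = Q + \<gamma> *\<^sub>R (transpose A ** P ** A) - \<gamma> *\<^sub>R (transpose A ** P ** B ** Ks)"
    unfolding KHK by simp
  finally show "P = Qk Ks + transpose (cl Ks) ** P ** cl Ks" using Pe' by simp
qed

text \<open>Stationarity removes the linear term of the exact cost difference; the quadratic term is
  nonnegative.\<close>

lemma riccati_optimal:
  assumes P: "riccati_solution \<gamma> A B Q R P"
    and Ks: "stable (optimal_gain \<gamma> A B R P)" and K: "stable K"
  shows "J (optimal_gain \<gamma> A B R P) \<le> J K"
proof -
  let ?K = "optimal_gain \<gamma> A B R P"
  have Pp: "pos_semidef P" using P by (simp add: riccati_solution_def)
  note b = riccati_bellman[OF P]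
  have "J K - P \<bullet> S0 = (transpose (K - ?K) ** H P ** (K - ?K)) \<bullet> Sig K"
    using cost_difference[of ?K "K - ?K", OF _ pos_semidefD(1)[OF Pp] b(1)] K b(2) by simp
  also have "\<dots> \<ge> 0"
    by (rule inner_pos_semidef_nonneg[OF pos_semidefD(2)[OF pos_semidef_conj'[OF H_psd[OF Pp]]] Sig(1)[OF K]])
  finally show ?thesis using J_eq[OF Ks b(1)] by simp
qed

text \<open>The Riccati solution is a Lyapunov witness for the transposed closed loop, strict
  because \<open>Q\<close> is bounded below.\<close>

lemma riccati_stable:
  assumes P: "riccati_solution \<gamma> A B Q R P" and q: "0 < q" "\<And>x. q * (x \<bullet> x) \<le> qform Q x"
  shows "stable (optimal_gain \<gamma> A B R P)"
proof -
  let ?K = "optimal_gain \<gamma> A B R P"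
  have Pp: "pos_semidef P" using P by (simp add: riccati_solution_def)
  have "P - transpose (cl ?K) ** P ** cl ?K = Qk ?K"
    using riccati_bellman(1)[OF P] by (simp add: algebra_simps)
  moreover have "q * (x \<bullet> x) \<le> qform (Qk ?K) x" for x
    using q(2)[of x] pos_semidefD(2)[OF R_psd, of "?K *v x"] by (simp add: Qk_def qform_add qform_conj')
  ultimately have "lyap_stable (transpose (cl ?K))"
    unfolding lyap_stable_def using Pp q(1) by (intro exI[of _ P] exI[of _ q]) simp
  then show ?thesis using lyap_stable_transpose by force
qed

text \<open>A zero cost forces the trace of the value matrix, hence that matrix and the stage cost,
  to vanish. This settles the case in which the step size is unrestricted.\<close>

lemma zero_cost:
  assumes K: "stable K" and J: "J K = 0"
  shows "Q = 0" and "K = 0" and "Eg (Pk K) K = 0"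
proof -
  note P = Pk[OF K]
  have "norm (Pk K) \<le> J K / lam" by (rule order_trans[OF norm_le_trace[OF P(1)] Pk_trace_le[OF K]])
  then have P0: "Pk K = 0" using J by simp
  then have "Qk K = 0" using P(2) by simp
  then have "qform (Qk K) x = 0" for x by simp
  then have 0: "qform Q x + qform R (K *v x) = 0" for x by (simp add: Qk_def qform_add qform_conj')
  have nn: "0 \<le> qform Q x" "0 \<le> qform R (K *v x)" for x
    by (auto intro: pos_semidefD(2) Q R_psd)
  have "qform Q x = 0" for x using 0[of x] nn[of x] by linarith
  then show "Q = 0" by (rule symmetric_qform_eq_0[OF pos_semidefD(1)[OF Q]])
  have "qform R (K *v x) = 0" for x using 0[of x] nn[of x] by linarith
  then have "K *v x = 0" for x using R unfolding pos_def_def by (metis less_irrefl)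
  then show "K = 0" by (metis matrix_eq matrix_vector_mult_0)
  then show "Eg (Pk K) K = 0" using P0 by (simp add: Eg_def)
qed

text \<open>Shifting the Bellman equation from the optimal gain to the zero gain shows that
  \<open>- P\<close> satisfies the comparison principle of the stable uncontrolled system, so
  \<open>P\<close> is also negative semi-definite.\<close>

lemma riccati_zero:
  assumes P: "riccati_solution \<gamma> A B Q R P" and Q0: "Q = 0" and K: "stable 0"
  shows "optimal_gain \<gamma> A B R P = 0"
proof -
  let ?K = "optimal_gain \<gamma> A B R P"
  have Pp: "pos_semidef P" using P by (simp add: riccati_solution_def)
  note b = riccati_bellman[OF P]
  have "transpose (cl 0) ** P ** cl 0 - P = transpose (- ?K) ** H P ** (- ?K)"
  proof -
    have "Qk 0 = 0" unfolding Qk_def using Q0 by simp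
    then show ?thesis using bellman_shift[OF pos_semidefD(1)[OF Pp] b(1), of "- ?K"] b(2) by simp
  qed
  then have "0 \<le> qform (- P - transpose (cl 0) ** (- P) ** cl 0) x" for x
    using pos_semidefD(2)[OF pos_semidef_conj'[OF H_psd[OF Pp]], of "- ?K" x] by simp
  then have "0 \<le> qform (- P) x" for x
    using lyap_nonneg[OF lyap_stable_transpose[OF K], of "- P" x] by simp
  then have "qform P x = 0" for x using pos_semidefD(2)[OF Pp, of x] by (simp add: qform_minus order_antisym)
  then have "P = 0" by (rule symmetric_qform_eq_0[OF pos_semidefD(1)[OF Pp]])
  then show ?thesis by (simp add: optimal_gain_def)
qed

end

subsection \<open>Square integrable random vectors\<close>

lemma borel_measurable_mult_vec [measurable]:
  "X \<in> borel_measurable M \<Longrightarrow> (\<lambda>\<omega>. (F::real^'n^'m) *v X \<omega>) \<in> borel_measurable M"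
  by (rule measurable_compose[OF _ borel_measurable_continuous_onI])
    (auto intro: linear_continuous_on matrix_vector_mul_bounded_linear)

lemma borel_measurable_qform [measurable]:
  assumes [measurable]: "X \<in> borel_measurable M"
  shows "(\<lambda>\<omega>. qform (S::real^'n^'n) (X \<omega>)) \<in> borel_measurable M"
  unfolding qform_def by measurable

lemma borel_measurable_vec:
  fixes X :: "'w \<Rightarrow> real^'n"
  assumes "\<And>i. (\<lambda>\<omega>. X \<omega> $ i) \<in> borel_measurable M"
  shows "X \<in> borel_measurable M"
  unfolding borel_measurable_euclidean_space[of X]
  using assms by (auto simp: Basis_vec_def inner_axis)

lemma borel_measurable_nth [measurable]:
  "X \<in> borel_measurable M \<Longrightarrow> (\<lambda>\<omega>. X \<omega> $ (i::'n::finite) :: real) \<in> borel_measurable M"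
  by (rule measurable_compose[OF _ borel_measurable_continuous_onI]) (auto intro: continuous_intros)

lemma outer_add_left: "outer (x + y) z = outer x z + outer y z"
  and outer_mult_left: "outer (F *v x) z = F ** outer x z"
  and transpose_outer: "transpose (outer x z) = outer z x"
  by (vector outer_def matrix_vector_mult_def matrix_matrix_mult_def transpose_def
      algebra_simps sum_distrib_left sum_distrib_right)+

lemma outer_add_right: "outer x (y + z) = outer x y + outer x z"
  by (vector outer_def algebra_simps)

lemma outer_mult_right: "outer x (F *v z) = outer x z ** transpose F"
  by (metis outer_mult_left transpose_outer matrix_transpose_mul)

lemma outer_affine:
  fixes F :: "real^'n^'m"
  shows "outer (F *v y + v) (F *v y + v) =
    F ** outer y y ** transpose F + F ** outer y v + transpose (F ** outer y v) + outer v v"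
proof -
  have "outer (F *v y) (F *v y) = F ** outer y y ** transpose F"
    by (simp only: outer_mult_right outer_mult_left)
  moreover have "outer (F *v y) v = F ** outer y v" by (rule outer_mult_left)
  moreover have "outer v (F *v y) = transpose (F ** outer y v)"
    by (simp only: outer_mult_left[symmetric] transpose_outer)
  ultimately show ?thesis by (simp only: outer_add_left outer_add_right add.assoc add.left_commute)
qed

lemma norm_outer: "norm (outer x y) = norm x * norm y"
proof -
  have "(norm (outer x y))\<^sup>2 = (norm x * norm y)\<^sup>2"
    by (simp add: power2_norm_eq_inner[of "outer x y"] inner_outer outer_mult_vector
        power_mult_distrib power2_norm_eq_inner)
  then show ?thesis by (simp add: power2_eq_iff_nonneg)
qed

lemma borel_measurable_outer [measurable]:
  fixes X :: "'w \<Rightarrow> real^'n" and Y :: "'w \<Rightarrow> real^'m"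
  assumes [measurable]: "X \<in> borel_measurable M" "Y \<in> borel_measurable M"
  shows "(\<lambda>\<omega>. outer (X \<omega>) (Y \<omega>)) \<in> borel_measurable M"
proof -
  have "(\<lambda>\<omega>. outer (X \<omega>) (Y \<omega>)) = (\<lambda>\<omega>. \<Sum>j\<in>UNIV. (Y \<omega> $ j) *\<^sub>R outer (X \<omega>) (axis j 1))"
    by (rule ext, vector outer_def axis_def) (simp add: if_distrib cong: if_cong)
  moreover have "(\<lambda>\<omega>. outer (X \<omega>) (axis j 1 :: real^'m)) \<in> borel_measurable M" for j
    by (rule measurable_compose[OF _ borel_measurable_continuous_onI], rule assms)
      (auto simp: outer_def intro!: continuous_intros)
  ultimately show ?thesis by simp
qed

definition sq_integrable :: "'w measure \<Rightarrow> ('w \<Rightarrow> real^'n) \<Rightarrow> bool" where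
  "sq_integrable M X \<longleftrightarrow> X \<in> borel_measurable M \<and> integrable M (\<lambda>\<omega>. (norm (X \<omega>))\<^sup>2)"

lemma sq_integrable_measurable [measurable_dest]: "sq_integrable M X \<Longrightarrow> X \<in> borel_measurable M"
  by (simp add: sq_integrable_def)

lemma sq_integrable_outer:
  assumes X: "sq_integrable M X" and Y: "sq_integrable M Y"
  shows "integrable M (\<lambda>\<omega>. outer (X \<omega>) (Y \<omega>))"
proof (rule Bochner_Integration.integrable_bound)
  show "integrable M (\<lambda>\<omega>. (norm (X \<omega>))\<^sup>2 + (norm (Y \<omega>))\<^sup>2)"
    using X Y by (simp add: sq_integrable_def)
  show "(\<lambda>\<omega>. outer (X \<omega>) (Y \<omega>)) \<in> borel_measurable M" using X Y by measurable
  have "norm (outer (X \<omega>) (Y \<omega>)) \<le> (norm (X \<omega>))\<^sup>2 + (norm (Y \<omega>))\<^sup>2" for \<omega>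
    using sum_squares_bound[of "norm (X \<omega>)" "norm (Y \<omega>)"] mult_nonneg_nonneg[of "norm (X \<omega>)" "norm (Y \<omega>)"]
    by (simp add: norm_outer del: mult_nonneg_nonneg)
  then show "AE \<omega> in M. norm (outer (X \<omega>) (Y \<omega>)) \<le> norm ((norm (X \<omega>))\<^sup>2 + (norm (Y \<omega>))\<^sup>2)"
    by simp
qed

lemma sq_integrable_add:
  assumes X: "sq_integrable M X" and Y: "sq_integrable M Y"
  shows "sq_integrable M (\<lambda>\<omega>. X \<omega> + Y \<omega>)"
  unfolding sq_integrable_def
proof
  show m: "(\<lambda>\<omega>. X \<omega> + Y \<omega>) \<in> borel_measurable M" using X Y by measurable
  show "integrable M (\<lambda>\<omega>. (norm (X \<omega> + Y \<omega>))\<^sup>2)"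
  proof (rule Bochner_Integration.integrable_bound)
    show "integrable M (\<lambda>\<omega>. 2 * (norm (X \<omega>))\<^sup>2 + 2 * (norm (Y \<omega>))\<^sup>2)"
      using X Y by (simp add: sq_integrable_def)
    have "(norm (X \<omega> + Y \<omega>))\<^sup>2 \<le> 2 * (norm (X \<omega>))\<^sup>2 + 2 * (norm (Y \<omega>))\<^sup>2" for \<omega>
    proof -
      have "(norm (X \<omega> + Y \<omega>))\<^sup>2 \<le> (norm (X \<omega>) + norm (Y \<omega>))\<^sup>2"
        by (intro power_mono norm_triangle_ineq) simp
      also have "\<dots> \<le> 2 * (norm (X \<omega>))\<^sup>2 + 2 * (norm (Y \<omega>))\<^sup>2"
        using sum_squares_bound[of "norm (X \<omega>)" "norm (Y \<omega>)"] by (simp add: power2_sum)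
      finally show ?thesis .
    qed
    then show "AE \<omega> in M. norm ((norm (X \<omega> + Y \<omega>))\<^sup>2) \<le> norm (2 * (norm (X \<omega>))\<^sup>2 + 2 * (norm (Y \<omega>))\<^sup>2)"
      by simp
  qed (use m in measurable)
qed

lemma sq_integrable_mult_vec:
  fixes F :: "real^'n^'m"
  assumes X: "sq_integrable M X"
  shows "sq_integrable M (\<lambda>\<omega>. F *v X \<omega>)"
  unfolding sq_integrable_def
proof
  show m: "(\<lambda>\<omega>. F *v X \<omega>) \<in> borel_measurable M" using X by measurable
  show "integrable M (\<lambda>\<omega>. (norm (F *v X \<omega>))\<^sup>2)"
  proof (rule Bochner_Integration.integrable_bound)
    show "integrable M (\<lambda>\<omega>. (norm F)\<^sup>2 * (norm (X \<omega>))\<^sup>2)"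
      using X by (simp add: sq_integrable_def)
    show "AE \<omega> in M. norm ((norm (F *v X \<omega>))\<^sup>2) \<le> norm ((norm F)\<^sup>2 * (norm (X \<omega>))\<^sup>2)"
      using power_mono[OF norm_matrix_vector_le[of F], of _ 2] by (intro AE_I2) (simp add: power_mult_distrib)
  qed (use m in measurable)
qed

lemma (in finite_measure) sq_integrable_const: "sq_integrable M (\<lambda>\<omega>. c)"
  by (simp add: sq_integrable_def)

lemma (in finite_measure) sq_integrable_integrable:
  assumes X: "sq_integrable M X"
  shows "integrable M X"
proof (rule Bochner_Integration.integrable_bound)
  show "integrable M (\<lambda>\<omega>. 1 + (norm (X \<omega>))\<^sup>2)" using X by (simp add: sq_integrable_def)
  show "AE \<omega> in M. norm (X \<omega>) \<le> norm (1 + (norm (X \<omega>))\<^sup>2)"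
  proof (intro AE_I2)
    fix \<omega>
    have "norm (X \<omega>) \<le> 1 + (norm (X \<omega>))\<^sup>2"
      using sum_squares_bound[of 1 "norm (X \<omega>)"] norm_ge_zero[of "X \<omega>"]
      unfolding one_power2 mult_1_right by linarith
    then show "norm (X \<omega>) \<le> norm (1 + (norm (X \<omega>))\<^sup>2)" by simp
  qed
qed (use X in measurable)

lemma integral_add4:
  fixes f g h k :: "'w \<Rightarrow> 'a::{banach, second_countable_topology}"
  assumes "integrable M f" "integrable M g" "integrable M h" "integrable M k"
  shows "(\<integral>\<omega>. f \<omega> + g \<omega> + h \<omega> + k \<omega> \<partial>M) =
    integral\<^sup>L M f + integral\<^sup>L M g + integral\<^sup>L M h + integral\<^sup>L M k"
  using assms by simp

lemma integrable_nth:
  fixes X :: "'w \<Rightarrow> 'b::euclidean_space^'n"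
  assumes "integrable M X"
  shows "integrable M (\<lambda>\<omega>. X \<omega> $ i)" and "(\<integral>\<omega>. X \<omega> $ i \<partial>M) = (\<integral>\<omega>. X \<omega> \<partial>M) $ i"
  using integrable_bounded_linear[OF bounded_linear_vec_nth assms, of i]
    integral_bounded_linear[OF bounded_linear_vec_nth assms, of i] by auto

lemma inner_second_moment:
  assumes X: "sq_integrable M X"
  shows "integrable M (\<lambda>\<omega>. qform P (X \<omega>))" and "(\<integral>\<omega>. qform P (X \<omega>) \<partial>M) = P \<bullet> second_moment M X"
proof -
  note i = sq_integrable_outer[OF X X]
  show "integrable M (\<lambda>\<omega>. qform P (X \<omega>))"
    using integrable_bounded_linear[OF bounded_linear_inner_right i, of P] by (simp add: inner_outer_self)
  show "(\<integral>\<omega>. qform P (X \<omega>) \<partial>M) = P \<bullet> second_moment M X"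
    using integral_bounded_linear[OF bounded_linear_inner_right i, of P]
    by (simp add: inner_outer_self second_moment_def)
qed

lemma second_moment_psd:
  assumes X: "sq_integrable M X"
  shows "pos_semidef (second_moment M X)"
  unfolding pos_semidef_def
proof (intro conjI allI)
  show "symmetric (second_moment M X)"
    unfolding symmetric_def second_moment_def
    using integral_bounded_linear[OF bounded_linear_transpose sq_integrable_outer[OF X X]]
    by (simp add: transpose_outer)
  fix x
  have "qform (second_moment M X) x = (\<integral>\<omega>. qform (outer x x) (X \<omega>) \<partial>M)"
    unfolding inner_second_moment(2)[OF X] by (simp add: qform_eq_inner inner_commute)
  also have "\<dots> \<ge> 0" by (simp add: qform_outer)
  finally show "0 \<le> qform (second_moment M X) x" .
qed

subsection \<open>The cost of a linear feedback under white noise\<close>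

text \<open>Common interface of both noises. Later noise is uncorrelated with the past, while
  \<open>w 0\<close> may have a mean and a law of its own.\<close>

locale lq_noise = prob_space M for M :: "'w measure" +
  fixes w :: "nat \<Rightarrow> 'w \<Rightarrow> real^'d"
  assumes w_sq: "sq_integrable M (w t)"
    and w_uncorrelated: "s \<le> t \<Longrightarrow> (\<integral>\<omega>. outer (w s \<omega>) (w (Suc t) \<omega>) \<partial>M) = 0"
    and w_cov: "second_moment M (w (Suc t)) = second_moment M (w 1)"

lemma (in lq_noise) state_sq: "sq_integrable M (lq_state A B w K t)"
  by (induction t) (simp_all add: w_sq sq_integrable_add sq_integrable_mult_vec)

text \<open>Adding a positive semi-definite matrix cannot lower the smallest eigenvalue, so
  nondegeneracy of either summand suffices; the weight of the second is positive.\<close>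

lemma (in lq_noise) lq_lambda_pos:
  assumes "0 < \<gamma>" "\<gamma> < 1"
    and "max (lambda_min (second_moment M (w 0))) (lambda_min (second_moment M (w 1))) > 0"
  defines "S \<equiv> second_moment M (w 0) + (\<gamma> / (1 - \<gamma>)) *\<^sub>R second_moment M (w 1)"
  shows "pos_semidef S" and "0 < lq_lambda M \<gamma> w" and "lq_lambda M \<gamma> w * (x \<bullet> x) \<le> qform S x"
proof -
  let ?W0 = "second_moment M (w 0)" and ?W1 = "second_moment M (w 1)" and ?g = "\<gamma> / (1 - \<gamma>)"
  have g: "0 < ?g" using assms(1,2) by simp
  have W: "pos_semidef ?W0" "pos_semidef ?W1" by (intro second_moment_psd w_sq)+
  show S: "pos_semidef S" unfolding S_def using g W by (intro pos_semidef_add pos_semidef_scaleR) auto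
  note Ssym = pos_semidefD(1)[OF S]
  have qS: "qform S x = qform ?W0 x + ?g * qform ?W1 x" for x
    by (simp only: S_def qform_add qform_scaleR)
  have l0: "lambda_min ?W0 \<le> lambda_min S"
  proof (rule lambda_min_ge[OF Ssym])
    fix x
    have "0 \<le> ?g * qform ?W1 x" by (rule mult_nonneg_nonneg[OF less_imp_le[OF g] pos_semidefD(2)[OF W(2)]])
    then show "lambda_min ?W0 * (x \<bullet> x) \<le> qform S x"
      using lambda_min_attained(2)[OF pos_semidefD(1)[OF W(1)], of x] qS[of x] by linarith
  qed
  have l1: "?g * lambda_min ?W1 \<le> lambda_min S"
  proof (rule lambda_min_ge[OF Ssym])
    fix x
    show "?g * lambda_min ?W1 * (x \<bullet> x) \<le> qform S x"
      using mult_left_mono[OF lambda_min_attained(2)[OF pos_semidefD(1)[OF W(2)], of x], of ?g] g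
        qS[of x] pos_semidefD(2)[OF W(1), of x] by (simp only: mult.assoc) linarith
  qed
  have "0 < lambda_min S"
    using assms(3) l0 l1 g mult_pos_pos[OF g, of "lambda_min ?W1"] by linarith
  then show "0 < lq_lambda M \<gamma> w" by (simp only: lq_lambda_def S_def)
  show "lq_lambda M \<gamma> w * (x \<bullet> x) \<le> qform S x"
    using lambda_min_attained(2)[OF Ssym, of x] by (simp only: lq_lambda_def S_def)
qed

locale lq_control =
  lq_noise M w +
  lq_problem \<gamma> A B Q R "second_moment M (w 0) + (\<gamma> / (1 - \<gamma>)) *\<^sub>R second_moment M (w 1)" lam
  for M :: "'w measure" and w :: "nat \<Rightarrow> 'w \<Rightarrow> real^'d" and \<gamma> A B Q and R :: "real^'l^'l" and lam +
  assumes \<gamma>1: "\<gamma> < 1"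
begin

lemma state_uncorrelated:
  "t \<le> r \<Longrightarrow> (\<integral>\<omega>. outer (lq_state A B w K t \<omega>) (w (Suc r) \<omega>) \<partial>M) = 0"
proof (induction t)
  case 0
  then show ?case by (simp add: w_uncorrelated)
next
  case (Suc t)
  let ?o = "\<lambda>\<omega>. outer (lq_state A B w K t \<omega>) (w (Suc r) \<omega>)"
  have i: "integrable M ?o" by (intro sq_integrable_outer state_sq w_sq)
  have bl: "bounded_linear (\<lambda>X::real^'d^'d. (A - B ** K) ** X)"
    using bounded_linear_conj[of "A - B ** K" "mat 1"] by simp
  have "integrable M (\<lambda>\<omega>. (A - B ** K) ** ?o \<omega>)" "(\<integral>\<omega>. (A - B ** K) ** ?o \<omega> \<partial>M) = 0"
    using integrable_bounded_linear[OF bl i] integral_bounded_linear[OF bl i] Suc by simp_all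
  then show ?case
    using w_uncorrelated[of "Suc t" r] Suc.prems sq_integrable_outer[OF w_sq[of "Suc t"] w_sq[of "Suc r"]]
    by (simp add: outer_add_left outer_mult_left)
qed

lemma second_moment_Suc:
  "second_moment M (lq_state A B w K (Suc t)) =
    (A - B ** K) ** second_moment M (lq_state A B w K t) ** transpose (A - B ** K) + second_moment M (w 1)"
proof -
  let ?F = "A - B ** K" and ?y = "lq_state A B w K t" and ?v = "w (Suc t)"
  have i: "integrable M (\<lambda>\<omega>. outer (?y \<omega>) (?y \<omega>))" "integrable M (\<lambda>\<omega>. outer (?v \<omega>) (?v \<omega>))"
    "integrable M (\<lambda>\<omega>. outer (?y \<omega>) (?v \<omega>))"
    by (intro sq_integrable_outer state_sq w_sq)+
  have bl: "bounded_linear (\<lambda>X::real^'d^'d. ?F ** X)"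
    using bounded_linear_conj[of ?F "mat 1"] by simp
  note bt = bounded_linear_compose[OF bounded_linear_transpose bl, unfolded o_def]
  note b2 = bounded_linear_conj[of ?F "transpose ?F"]
  have "second_moment M (lq_state A B w K (Suc t)) =
      (\<integral>\<omega>. ?F ** outer (?y \<omega>) (?y \<omega>) ** transpose ?F + ?F ** outer (?y \<omega>) (?v \<omega>)
     + transpose (?F ** outer (?y \<omega>) (?v \<omega>)) + outer (?v \<omega>) (?v \<omega>) \<partial>M)"
    unfolding second_moment_def lq_state.simps outer_affine ..
  also have "\<dots> = (\<integral>\<omega>. ?F ** outer (?y \<omega>) (?y \<omega>) ** transpose ?F \<partial>M)
      + (\<integral>\<omega>. ?F ** outer (?y \<omega>) (?v \<omega>) \<partial>M) + (\<integral>\<omega>. transpose (?F ** outer (?y \<omega>) (?v \<omega>)) \<partial>M)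
      + (\<integral>\<omega>. outer (?v \<omega>) (?v \<omega>) \<partial>M)"
    by (intro integral_add4 integrable_bounded_linear[OF b2 i(1)] integrable_bounded_linear[OF bl i(3)]
        integrable_bounded_linear[OF bt i(3)] i(2))
  also have "\<dots> = ?F ** second_moment M ?y ** transpose ?F + second_moment M ?v"
    unfolding integral_bounded_linear[OF b2 i(1)] integral_bounded_linear[OF bl i(3)]
      integral_bounded_linear[OF bt i(3)] state_uncorrelated[OF order_refl]
    by (simp add: second_moment_def)
  finally show ?thesis by (simp only: w_cov[of t])
qed

definition "Y K t = \<gamma> ^ t *\<^sub>R second_moment M (lq_state A B w K t)"

lemma Y_psd: "pos_semidef (Y K t)"
  unfolding Y_def using \<gamma> by (intro pos_semidef_scaleR second_moment_psd state_sq) auto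

lemma Y_Suc: "Y K (Suc t) = cl K ** Y K t ** transpose (cl K) + \<gamma> ^ Suc t *\<^sub>R second_moment M (w 1)"
  unfolding Y_def second_moment_Suc using \<gamma>
  by (simp add: cl_def transpose_scalar scaleR_add_right mult_ac)

text \<open>The noise entering at time \<open>Suc t\<close> has weight
  \<open>\<gamma> ^ Suc t\<close>, with total \<gamma> / (1 - \<gamma>): hence the weight in
  \<open>S0\<close>. The limit is identified by uniqueness of the Lyapunov solution.\<close>

lemma Y_sums:
  assumes K: "stable K"
  shows "Y K sums Sig K" and "summable (\<lambda>t. mat 1 \<bullet> Y K t)"
proof -
  let ?W0 = "second_moment M (w 0)" and ?W1 = "second_moment M (w 1)"
  have W: "pos_semidef ?W1" by (intro second_moment_psd w_sq)
  define N where "N = cl K"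
  have bl: "bounded_linear (\<lambda>X. N ** X ** transpose N)" by (rule bounded_linear_conj)
  note S = Sig[OF K, folded N_def]
  have geo: "(\<lambda>t. \<gamma> ^ Suc t) sums (\<gamma> / (1 - \<gamma>))"
    using sums_mult[OF geometric_sums[of \<gamma>], of \<gamma>] \<gamma> \<gamma>1 by simp
  have split: "(\<Sum>t<Suc n. Y K t) = ?W0 + (\<Sum>t<n. \<gamma> ^ Suc t) *\<^sub>R ?W1 + N ** (\<Sum>t<n. Y K t) ** transpose N" for n
  proof -
    have "(\<Sum>t<Suc n. Y K t) = ?W0 + (\<Sum>t<n. Y K (Suc t))"
      unfolding sum.lessThan_Suc_shift by (simp add: Y_def)
    also have "(\<Sum>t<n. Y K (Suc t)) = N ** (\<Sum>t<n. Y K t) ** transpose N + (\<Sum>t<n. \<gamma> ^ Suc t) *\<^sub>R ?W1"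
      unfolding Y_Suc N_def[symmetric] sum.distrib linear_sum[OF bounded_linear.linear[OF bl]] scaleR_sum_left ..
    finally show ?thesis by (simp only: add_ac)
  qed
  \<comment> \<open>The recursion evaluates the previous sum at \<open>transpose N *v x\<close>, so
    the induction must keep \<open>x\<close> arbitrary.\<close>
  have bound: "qform (\<Sum>t<n. Y K t) x \<le> qform (Sig K) x" for n x
  proof (induction n arbitrary: x)
    case 0
    then show ?case using pos_semidefD(2)[OF S(1)] by simp
  next
    case (Suc n)
    have g: "(\<Sum>t<n. \<gamma> ^ Suc t) \<le> \<gamma> / (1 - \<gamma>)"
      unfolding sums_unique[OF geo] by (rule sum_le_suminf) (use geo \<gamma> in \<open>auto simp: sums_iff\<close>)
    have "qform (Sig K) x = qform ?W0 x + \<gamma> / (1 - \<gamma>) * qform ?W1 x + qform (Sig K) (transpose N *v x)"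
      using arg_cong[OF S(2), of "\<lambda>X. qform X x"] by (simp only: qform_add qform_scaleR qform_conj)
    moreover have "qform (\<Sum>t<Suc n. Y K t) x =
        qform ?W0 x + (\<Sum>t<n. \<gamma> ^ Suc t) * qform ?W1 x + qform (\<Sum>t<n. Y K t) (transpose N *v x)"
      unfolding split by (simp only: qform_add qform_scaleR qform_conj)
    ultimately show ?case
      using Suc[of "transpose N *v x"] mult_right_mono[OF g pos_semidefD(2)[OF W, of x]] by linarith
  qed
  show "summable (\<lambda>t. mat 1 \<bullet> Y K t)"
  proof (rule summableI_nonneg_bounded)
    show "0 \<le> mat 1 \<bullet> Y K t" for t by (rule inner_pos_semidef_nonneg[OF _ Y_psd]) (simp add: qform_mat1)
    have "0 \<le> mat 1 \<bullet> (Sig K - (\<Sum>t<n. Y K t))" for n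
      by (subst inner_commute, rule inner_pos_semidef_nonneg[OF _ pos_semidef_mat1]) (simp only: qform_diff diff_ge_0_iff_ge bound)
    then show "(\<Sum>t<n. mat 1 \<bullet> Y K t) \<le> mat 1 \<bullet> Sig K" for n
      by (simp only: inner_sum_right inner_diff_right diff_ge_0_iff_ge)
  qed
  then have sm: "summable (Y K)"
    by (rule summable_comparison_test[rotated]) (use norm_le_trace[OF Y_psd] in auto)
  have "suminf (Y K) = Sig K"
  proof (rule lyap_unique)
    show "lyap_stable N" using K by (simp add: N_def)
    show "symmetric (suminf (Y K))"
      unfolding symmetric_def bounded_linear.suminf[OF bounded_linear_transpose sm]
      using pos_semidefD(1)[OF Y_psd] by (simp add: symmetric_def)
    have "suminf (Y K) = Y K 0 + (\<Sum>t. Y K (Suc t))" using suminf_split_head[OF sm] by simp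
    also have "(\<Sum>t. Y K (Suc t)) = N ** suminf (Y K) ** transpose N + (\<gamma> / (1 - \<gamma>)) *\<^sub>R ?W1"
      unfolding Y_Suc N_def[symmetric]
      by (rule sums_unique[symmetric])
        (intro sums_add bounded_linear.sums[OF bl] summable_sums sm
          bounded_linear.sums[OF bounded_linear_scaleR_left] geo)
    finally have "suminf (Y K) = Y K 0 + (N ** suminf (Y K) ** transpose N + (\<gamma> / (1 - \<gamma>)) *\<^sub>R ?W1)" .
    moreover have "Y K 0 = ?W0" by (simp add: Y_def)
    ultimately show "suminf (Y K) = (?W0 + (\<gamma> / (1 - \<gamma>)) *\<^sub>R ?W1) + N ** suminf (Y K) ** transpose N"
      by (simp only: add_ac)
    show "symmetric (Sig K)" by (rule pos_semidefD(1)[OF S(1)])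
    show "Sig K = (?W0 + (\<gamma> / (1 - \<gamma>)) *\<^sub>R ?W1) + N ** Sig K ** transpose N" by (rule S(2))
  qed
  then show "Y K sums Sig K" using summable_sums[OF sm] by simp
qed

lemma nn_integral_qform_sum:
  assumes K: "stable K" and P: "pos_semidef P"
  shows "(\<integral>\<^sup>+ \<omega>. (\<Sum>t. ennreal (\<gamma> ^ t * qform P (lq_state A B w K t \<omega>))) \<partial>M) = ennreal (P \<bullet> Sig K)"
proof -
  have [measurable]: "lq_state A B w K t \<in> borel_measurable M" for t
    using state_sq by (rule sq_integrable_measurable)
  have "(\<integral>\<^sup>+ \<omega>. (\<Sum>t. ennreal (\<gamma> ^ t * qform P (lq_state A B w K t \<omega>))) \<partial>M) =
      (\<Sum>t. \<integral>\<^sup>+ \<omega>. ennreal (\<gamma> ^ t * qform P (lq_state A B w K t \<omega>)) \<partial>M)"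
    by (rule nn_integral_suminf) measurable
  also have "\<dots> = (\<Sum>t. ennreal (P \<bullet> Y K t))"
  proof (rule suminf_cong)
    fix t
    have "(\<integral>\<^sup>+ \<omega>. ennreal (\<gamma> ^ t * qform P (lq_state A B w K t \<omega>)) \<partial>M) =
        ennreal (\<integral>\<omega>. \<gamma> ^ t * qform P (lq_state A B w K t \<omega>) \<partial>M)"
      by (rule nn_integral_eq_integral)
        (use \<gamma> pos_semidefD(2)[OF P] inner_second_moment(1)[OF state_sq] in auto)
    also have "(\<integral>\<omega>. \<gamma> ^ t * qform P (lq_state A B w K t \<omega>) \<partial>M) = P \<bullet> Y K t"
      by (simp add: inner_second_moment(2)[OF state_sq] Y_def)
    finally show "(\<integral>\<^sup>+ \<omega>. ennreal (\<gamma> ^ t * qform P (lq_state A B w K t \<omega>)) \<partial>M) = ennreal (P \<bullet> Y K t)" .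
  qed
  also have "\<dots> = ennreal (\<Sum>t. P \<bullet> Y K t)"
    using bounded_linear.summable[OF bounded_linear_inner_right sums_summable[OF Y_sums(1)[OF K]], of P]
    by (intro suminf_ennreal2 inner_pos_semidef_nonneg pos_semidefD(2)[OF P] Y_psd)
  also have "(\<Sum>t. P \<bullet> Y K t) = P \<bullet> Sig K"
    using bounded_linear.sums[OF bounded_linear_inner_right Y_sums(1)[OF K], of P] by (simp add: sums_iff)
  finally show ?thesis .
qed

lemma lq_cost_eq: "stable K \<Longrightarrow> lq_cost M \<gamma> A B Q R w K = ennreal (J K)"
  unfolding lq_cost_def J_def Qk_def[symmetric] by (rule nn_integral_qform_sum[OF _ Qk_psd])

text \<open>The norm of \<open>outer y y\<close> is the squared norm of \<open>y\<close>, so the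
  absolute convergence needed to exchange sum and expectation is finiteness of the cost with weight
  \<open>mat 1\<close>.\<close>

lemma lq_Sigma_eq:
  assumes K: "stable K"
  shows "lq_Sigma M \<gamma> A B w K = Sig K"
proof -
  let ?y = "lq_state A B w K"
  have [measurable]: "?y t \<in> borel_measurable M" for t
    using state_sq by (rule sq_integrable_measurable)
  have n: "norm (\<gamma> ^ t *\<^sub>R outer (?y t \<omega>) (?y t \<omega>)) = \<gamma> ^ t * qform (mat 1) (?y t \<omega>)" for t \<omega>
    using \<gamma> by (simp add: norm_outer qform_mat1 power2_norm_eq_inner[symmetric] power2_eq_square)
  have "(\<integral>\<^sup>+ \<omega>. (\<Sum>t. ennreal (\<gamma> ^ t * qform (mat 1) (?y t \<omega>))) \<partial>M) \<noteq> \<infinity>"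
    unfolding nn_integral_qform_sum[OF K pos_semidef_mat1] by simp
  then have "AE \<omega> in M. (\<Sum>t. ennreal (\<gamma> ^ t * qform (mat 1) (?y t \<omega>))) \<noteq> \<infinity>"
    by (intro nn_integral_PInf_AE) measurable
  then have ae: "AE \<omega> in M. summable (\<lambda>t. norm (\<gamma> ^ t *\<^sub>R outer (?y t \<omega>) (?y t \<omega>)))"
  proof eventually_elim
    case (elim \<omega>)
    show ?case unfolding n
      by (rule summable_suminf_not_top) (use elim \<gamma> in \<open>auto simp: qform_mat1\<close>)
  qed
  have "lq_Sigma M \<gamma> A B w K = (\<Sum>t. \<integral>\<omega>. \<gamma> ^ t *\<^sub>R outer (?y t \<omega>) (?y t \<omega>) \<partial>M)"
    unfolding lq_Sigma_def
  proof (rule integral_suminf[OF _ ae])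
    show "integrable M (\<lambda>\<omega>. \<gamma> ^ t *\<^sub>R outer (?y t \<omega>) (?y t \<omega>))" for t
      using sq_integrable_outer[OF state_sq[of A B K t] state_sq[of A B K t]] by simp
    show "summable (\<lambda>t. \<integral>\<omega>. norm (\<gamma> ^ t *\<^sub>R outer (?y t \<omega>) (?y t \<omega>)) \<partial>M)"
      using Y_sums(2)[OF K] unfolding n by (simp add: inner_second_moment(2)[OF state_sq] Y_def)
  qed
  also have "\<dots> = (\<Sum>t. Y K t)" by (simp add: Y_def second_moment_def)
  also have "\<dots> = Sig K" using Y_sums(1)[OF K] by (simp add: sums_iff)
  finally show ?thesis .
qed

end

subsection \<open>Reduction of the mean-field cost\<close>

lemma integrable_square_of_exp:
  assumes [measurable]: "f \<in> borel_measurable M" and s: "0 < s"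
    and i: "(\<integral>\<^sup>+ \<omega>. ennreal (exp ((f \<omega>)\<^sup>2 / s\<^sup>2)) \<partial>M) \<le> 2"
  shows "integrable M (\<lambda>\<omega>. (f \<omega>)\<^sup>2 :: real)"
proof (rule integrableI_bounded)
  have "(\<integral>\<^sup>+ \<omega>. ennreal (norm ((f \<omega>)\<^sup>2)) \<partial>M) \<le> (\<integral>\<^sup>+ \<omega>. ennreal (s\<^sup>2) * ennreal (exp ((f \<omega>)\<^sup>2 / s\<^sup>2)) \<partial>M)"
  proof (rule nn_integral_mono)
    fix \<omega>
    have "(f \<omega>)\<^sup>2 / s\<^sup>2 \<le> exp ((f \<omega>)\<^sup>2 / s\<^sup>2)"
      using exp_ge_add_one_self[of "(f \<omega>)\<^sup>2 / s\<^sup>2"] by linarith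
    then have "(f \<omega>)\<^sup>2 \<le> s\<^sup>2 * exp ((f \<omega>)\<^sup>2 / s\<^sup>2)" using s by (simp add: field_simps)
    then show "ennreal (norm ((f \<omega>)\<^sup>2)) \<le> ennreal (s\<^sup>2) * ennreal (exp ((f \<omega>)\<^sup>2 / s\<^sup>2))"
      by (simp add: ennreal_mult[symmetric] ennreal_leI)
  qed
  also have "\<dots> = ennreal (s\<^sup>2) * (\<integral>\<^sup>+ \<omega>. ennreal (exp ((f \<omega>)\<^sup>2 / s\<^sup>2)) \<partial>M)"
    by (rule nn_integral_cmult) measurable
  also have "\<dots> < \<infinity>"
    using i by (auto simp: ennreal_mult_less_top intro: le_less_trans)
  finally show "(\<integral>\<^sup>+ \<omega>. ennreal (norm ((f \<omega>)\<^sup>2)) \<partial>M) < \<infinity>" .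
qed simp

lemma subgaussian_sq_integrable:
  fixes X :: "'w \<Rightarrow> real^'d"
  assumes X: "subgaussian M X"
  shows "sq_integrable M X"
proof -
  have m: "X \<in> borel_measurable M" using X by (simp add: subgaussian_def)
  obtain s where s: "0 < s"
    and i: "\<And>v. norm v = 1 \<Longrightarrow> (\<integral>\<^sup>+ \<omega>. ennreal (exp ((X \<omega> \<bullet> v)\<^sup>2 / s\<^sup>2)) \<partial>M) \<le> 2"
    using X by (auto simp: subgaussian_def)
  have "integrable M (\<lambda>\<omega>. (X \<omega> \<bullet> axis k 1)\<^sup>2)" for k
    by (rule integrable_square_of_exp[OF _ s i]) (use m in auto)
  then have "integrable M (\<lambda>\<omega>. \<Sum>k\<in>UNIV. (X \<omega> \<bullet> axis k 1)\<^sup>2)" by (intro Bochner_Integration.integrable_sum)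
  moreover have "(\<Sum>k\<in>UNIV. (X \<omega> \<bullet> axis k 1)\<^sup>2) = (norm (X \<omega>))\<^sup>2" for \<omega>
  proof -
    have "X \<omega> \<bullet> axis k 1 = X \<omega> $ k" for k by (simp add: inner_axis)
    then show ?thesis unfolding power2_norm_eq_inner inner_vec_def[of "X \<omega>" "X \<omega>"] by (simp add: power2_eq_square)
  qed
  ultimately show ?thesis using m by (simp add: sq_integrable_def)
qed

lemma (in prob_space) indep_var_outer_integral:
  fixes X Y :: "'a \<Rightarrow> real^'n"
  assumes XY: "indep_var borel X borel Y" and X: "sq_integrable M X" and Y: "sq_integrable M Y"
    and Y0: "(\<integral>\<omega>. Y \<omega> \<partial>M) = 0"
  shows "(\<integral>\<omega>. outer (X \<omega>) (Y \<omega>) \<partial>M) = 0"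
proof -
  note iX = integrable_nth[OF sq_integrable_integrable[OF X]]
  note iY = integrable_nth[OF sq_integrable_integrable[OF Y]]
  have "(\<integral>\<omega>. X \<omega> $ i * Y \<omega> $ j \<partial>M) = 0" for i j
  proof -
    have "indep_var borel ((\<lambda>x. x $ i) \<circ> X) borel ((\<lambda>y. y $ j) \<circ> Y)"
      by (rule indep_var_compose[OF XY]) measurable
    then have "(\<integral>\<omega>. X \<omega> $ i * Y \<omega> $ j \<partial>M) = (\<integral>\<omega>. X \<omega> $ i \<partial>M) * (\<integral>\<omega>. Y \<omega> $ j \<partial>M)"
      by (intro indep_var_lebesgue_integral) (auto simp: o_def iX iY)
    then show ?thesis by (simp add: iY Y0)
  qed
  then have "(\<integral>\<omega>. outer (X \<omega>) (Y \<omega>) \<partial>M) $ i $ j = 0" for i j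
    using integrable_nth[OF sq_integrable_outer[OF X Y], of i]
      integrable_nth(2)[OF integrable_nth(1)[OF sq_integrable_outer[OF X Y], of i], of j]
    by (simp add: outer_def)
  then show ?thesis by (simp add: vec_eq_iff)
qed

locale mf_problem =
  fixes M :: "'w measure" and eps eps0 :: "nat \<Rightarrow> 'w \<Rightarrow> real^'d"
  assumes noise: "mf_noise M eps eps0"
begin

sublocale prob_space M using noise by (simp add: mf_noise_def)

lemma eps_sq: "sq_integrable M (eps t)" "sq_integrable M (eps0 t)"
  using noise unfolding mf_noise_def by (blast intro: subgaussian_sq_integrable)+

lemma eps_mean: "(\<integral>\<omega>. eps (Suc t) \<omega> \<partial>M) = 0" "(\<integral>\<omega>. eps0 (Suc t) \<omega> \<partial>M) = 0"
  using noise unfolding mf_noise_def by blast+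

lemma eps_distr: "distr M borel (eps (Suc t)) = distr M borel (eps 1)"
  "distr M borel (eps0 (Suc t)) = distr M borel (eps0 1)"
  using noise unfolding mf_noise_def by blast+

lemma eps_indep: "indep_vars (\<lambda>_. borel) (case_sum eps eps0) UNIV"
  using noise unfolding mf_noise_def by blast

lemma pair_indep:
  assumes "a \<noteq> b" and [measurable]: "f \<in> borel_measurable borel" "g \<in> borel_measurable borel"
  shows "indep_var borel (\<lambda>\<omega>. f (case_sum eps eps0 a \<omega>)) borel (\<lambda>\<omega>. g (case_sum eps eps0 b \<omega>))"
proof -
  have "indep_var borel ((\<lambda>x. f (x a)) \<circ> (\<lambda>\<omega>. restrict (\<lambda>i. case_sum eps eps0 i \<omega>) {a}))
     borel ((\<lambda>x. g (x b)) \<circ> (\<lambda>\<omega>. restrict (\<lambda>i. case_sum eps eps0 i \<omega>) {b}))"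
    by (rule indep_var_compose[OF indep_var_restrict[OF eps_indep]]) (use assms(1) in \<open>auto intro!: measurable_compose[OF _ assms(2)] measurable_compose[OF _ assms(3)]\<close>)
  then show ?thesis by (simp add: o_def)
qed

lemma second_moment_distr:
  assumes "X \<in> borel_measurable M" "Y \<in> borel_measurable M" "distr M borel X = distr M borel Y"
  shows "second_moment M X = second_moment M (Y :: 'w \<Rightarrow> real^'d)"
proof -
  have "second_moment M Z = (\<integral>x. outer x x \<partial>distr M borel Z)" if "Z \<in> borel_measurable M" for Z :: "'w \<Rightarrow> real^'d"
    unfolding second_moment_def by (intro integral_distr[symmetric] borel_measurable_outer that) auto
  then show ?thesis using assms by simp
qed

lemma noise_y_lq: "lq_noise M (noise_y M eps)"
proof
  let ?c = "\<integral>\<omega>. eps 0 \<omega> \<partial>M"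
  show sq: "sq_integrable M (noise_y M eps t)" for t
    using sq_integrable_add[OF eps_sq(1)[of 0] sq_integrable_const[of "- ?c"]]
    by (simp add: noise_y_def eps_sq)
  show "(\<integral>\<omega>. outer (noise_y M eps s \<omega>) (noise_y M eps (Suc t) \<omega>) \<partial>M) = 0" if "s \<le> t" for s t
  proof (rule indep_var_outer_integral[OF _ sq sq])
    show "indep_var borel (noise_y M eps s) borel (noise_y M eps (Suc t))"
    proof -
      define c where "c = (if s = 0 then ?c else 0)"
      have "indep_var borel (\<lambda>\<omega>. case_sum eps eps0 (Inl s) \<omega> - c) borel (\<lambda>\<omega>. case_sum eps eps0 (Inl (Suc t)) \<omega>)"
        by (rule pair_indep) (use that in auto)
      moreover have "noise_y M eps s = (\<lambda>\<omega>. case_sum eps eps0 (Inl s) \<omega> - c)"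
        by (auto simp: noise_y_def c_def)
      moreover have "noise_y M eps (Suc t) = (\<lambda>\<omega>. case_sum eps eps0 (Inl (Suc t)) \<omega>)"
        by (simp add: noise_y_def)
      ultimately show ?thesis by (simp only:)
    qed
    show "(\<integral>\<omega>. noise_y M eps (Suc t) \<omega> \<partial>M) = 0" by (simp add: noise_y_def eps_mean)
  qed
  show "second_moment M (noise_y M eps (Suc t)) = second_moment M (noise_y M eps 1)" for t
    using second_moment_distr[OF sq_integrable_measurable sq_integrable_measurable, OF eps_sq(1) eps_sq(1) eps_distr(1), of t]
    by (simp add: noise_y_def)
qed

lemma noise_z_lq: "lq_noise M (noise_z M eps eps0)"
proof
  let ?c = "\<integral>\<omega>. eps 0 \<omega> \<partial>M"
  show sq: "sq_integrable M (noise_z M eps eps0 t)" for t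
    using sq_integrable_add[OF eps_sq(2)[of 0] sq_integrable_const[of ?c]]
    by (simp add: noise_z_def eps_sq)
  show "(\<integral>\<omega>. outer (noise_z M eps eps0 s \<omega>) (noise_z M eps eps0 (Suc t) \<omega>) \<partial>M) = 0" if "s \<le> t" for s t
  proof (rule indep_var_outer_integral[OF _ sq sq])
    show "indep_var borel (noise_z M eps eps0 s) borel (noise_z M eps eps0 (Suc t))"
    proof -
      define c where "c = (if s = 0 then ?c else 0)"
      have "indep_var borel (\<lambda>\<omega>. case_sum eps eps0 (Inr s) \<omega> + c) borel (\<lambda>\<omega>. case_sum eps eps0 (Inr (Suc t)) \<omega>)"
        by (rule pair_indep) (use that in auto)
      moreover have "noise_z M eps eps0 s = (\<lambda>\<omega>. case_sum eps eps0 (Inr s) \<omega> + c)"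
        by (auto simp: noise_z_def c_def)
      moreover have "noise_z M eps eps0 (Suc t) = (\<lambda>\<omega>. case_sum eps eps0 (Inr (Suc t)) \<omega>)"
        by (simp add: noise_z_def)
      ultimately show ?thesis by (simp only:)
    qed
    show "(\<integral>\<omega>. noise_z M eps eps0 (Suc t) \<omega> \<partial>M) = 0" by (simp add: noise_z_def eps_mean)
  qed
  show "second_moment M (noise_z M eps eps0 (Suc t)) = second_moment M (noise_z M eps eps0 1)" for t
    using second_moment_distr[OF sq_integrable_measurable sq_integrable_measurable, OF eps_sq(2) eps_sq(2) eps_distr(2), of t]
    by (simp add: noise_z_def)
qed

section \<open>The common filtration and conditional means\<close>

abbreviation F :: "nat \<Rightarrow> 'w measure" where "F \<equiv> common_filt M eps0"

lemma space_F [simp]: "space (F t) = space M"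
  by (simp add: common_filt_def space_measure_of_conv)

lemma sets_F: "sets (F t) = sigma_sets (space M) (\<Union>s\<in>{..t}. {eps0 s -` S \<inter> space M | S. S \<in> sets borel})"
  unfolding common_filt_def by (rule sets_measure_of) auto

lemma F_subset: "sets (F t) \<subseteq> sets M"
  unfolding sets_F
  by (rule sets.sigma_sets_subset) (use eps_sq(2) in \<open>auto dest!: sq_integrable_measurable intro: measurable_sets\<close>)

lemma F_mono: "s \<le> t \<Longrightarrow> sets (F s) \<subseteq> sets (F t)"
  unfolding sets_F by (rule sigma_sets_mono') force

lemma eps0_F: "s \<le> t \<Longrightarrow> eps0 s \<in> borel_measurable (F t)"
  by (rule measurableI) (auto simp: sets_F intro!: sigma_sets.Basic)

lemma subalg_F: "sigma_finite_subalgebra M (F t)"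
  by (rule finite_measure_subalgebra_is_sigma_finite)
    (simp add: finite_measure_subalgebra_def finite_measure_subalgebra_axioms_def
      finite_measure_axioms subalgebra_def F_subset)

text \<open>Presents events of the filtration as preimages under a block of common noises, the form
  in which independence of disjoint blocks applies.\<close>

lemma F_vimage:
  "sets (F t) \<subseteq> {(\<lambda>\<omega>. restrict (\<lambda>i. case_sum eps eps0 i \<omega>) (Inr ` {..t})) -` S \<inter> space M | S.
    S \<in> sets (PiM (Inr ` {..t}) (\<lambda>_. borel))}"
proof -
  let ?I = "Inr ` {..t} :: (nat + nat) set"
  let ?X = "\<lambda>\<omega>. restrict (\<lambda>i. case_sum eps eps0 i \<omega>) ?I"
  let ?P = "PiM ?I (\<lambda>_. borel :: (real^'d) measure)"
  have X: "?X \<in> space M \<rightarrow> space ?P" by (auto simp: space_PiM)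
  have "sets (vimage_algebra (space M) ?X ?P) = {?X -` S \<inter> space M | S. S \<in> sets ?P}"
    by (rule sets_vimage_algebra2[OF X])
  moreover have "sets (F t) \<subseteq> sets (vimage_algebra (space M) ?X ?P)"
  proof -
    have "(\<Union>s\<in>{..t}. {eps0 s -` S \<inter> space M | S. S \<in> sets borel}) \<subseteq> sets (vimage_algebra (space M) ?X ?P)"
    proof safe
      fix s S assume s: "s \<le> t" and S: "S \<in> sets (borel :: (real^'d) measure)"
      have "(\<lambda>x. x (Inr s)) \<in> measurable ?P borel" using s by (intro measurable_component_singleton) auto
      then have "(\<lambda>\<omega>. ?X \<omega> (Inr s)) \<in> measurable (vimage_algebra (space M) ?X ?P) borel"
        by (rule measurable_compose[OF measurable_vimage_algebra1[OF X]])
      from measurable_sets[OF this S] show "eps0 s -` S \<inter> space M \<in> sets (vimage_algebra (space M) ?X ?P)"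
        using s by (simp add: vimage_def)
    qed
    from sets.sigma_sets_subset[OF this] show ?thesis by (simp add: sets_F)
  qed
  ultimately show ?thesis by blast
qed

lemma eps_indep_F:
  assumes A: "A \<in> sets (F t)" and [measurable]: "h \<in> borel_measurable borel"
    and i: "integrable M (\<lambda>\<omega>. h (eps s \<omega>) :: real)"
  shows "(\<integral>\<omega>. indicator A \<omega> * h (eps s \<omega>) \<partial>M) = prob A * (\<integral>\<omega>. h (eps s \<omega>) \<partial>M)"
proof -
  let ?I = "Inr ` {..t} :: (nat + nat) set"
  let ?X = "\<lambda>\<omega>. restrict (\<lambda>i. case_sum eps eps0 i \<omega>) ?I"
  obtain S where S: "S \<in> sets (PiM ?I (\<lambda>_. borel))" "A = ?X -` S \<inter> space M"
    using F_vimage A by blast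
  have "indep_var borel ((indicator S :: _ \<Rightarrow> real) \<circ> ?X)
     borel ((\<lambda>x. h (x (Inl s))) \<circ> (\<lambda>\<omega>. restrict (\<lambda>i. case_sum eps eps0 i \<omega>) {Inl s}))"
    by (rule indep_var_compose[OF indep_var_restrict[OF eps_indep]])
      (use S(1) in \<open>auto intro!: measurable_compose[OF _ assms(2)]\<close>)
  then have ind: "indep_var borel (\<lambda>\<omega>. indicator S (?X \<omega>) :: real) borel (\<lambda>\<omega>. h (eps s \<omega>))"
    by (simp add: o_def)
  have AM: "A \<in> sets M" using A F_subset by blast
  have eq: "indicator S (?X \<omega>) = (indicator A \<omega> :: real)" if "\<omega> \<in> space M" for \<omega>
    using that by (simp add: S(2) indicator_def)
  have iA: "integrable M (\<lambda>\<omega>. indicator S (?X \<omega>) :: real)"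
    by (subst Bochner_Integration.integrable_cong[OF refl eq]) (use AM in \<open>auto simp: emeasure_eq_measure\<close>)
  have "(\<integral>\<omega>. indicator A \<omega> * h (eps s \<omega>) \<partial>M) = (\<integral>\<omega>. indicator S (?X \<omega>) * h (eps s \<omega>) \<partial>M)"
    by (rule Bochner_Integration.integral_cong) (simp_all add: eq)
  also have "\<dots> = (\<integral>\<omega>. indicator S (?X \<omega>) \<partial>M) * (\<integral>\<omega>. h (eps s \<omega>) \<partial>M)"
    by (rule indep_var_lebesgue_integral[OF ind iA i])
  also have "(\<integral>\<omega>. indicator S (?X \<omega>) \<partial>M) = prob A"
    using AM by (simp add: Bochner_Integration.integral_cong[OF refl eq])
  finally show ?thesis .
qed

text \<open>Says that the idiosyncratic noise has conditional mean zero given the common noise up to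
  any time; at time zero the subtracted mean provides this.\<close>

lemma indicator_noise_y:
  assumes A: "A \<in> sets (F t)"
  shows "(\<integral>\<omega>. indicator A \<omega> *\<^sub>R noise_y M eps s \<omega> \<partial>M) = 0"
proof -
  interpret lq_noise M "noise_y M eps" by (rule noise_y_lq)
  have AM: "A \<in> sets M" using A F_subset by blast
  have i: "integrable M (noise_y M eps s)" by (rule sq_integrable_integrable[OF w_sq])
  have iA: "integrable M (\<lambda>\<omega>. indicator A \<omega> *\<^sub>R noise_y M eps s \<omega>)"
    by (rule integrable_mult_indicator[OF AM i])
  define c where "c = (if s = 0 then \<integral>\<omega>. eps 0 \<omega> \<partial>M else 0)"
  have ne: "noise_y M eps s \<omega> = eps s \<omega> - c" for \<omega> by (simp add: noise_y_def c_def)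
  have "(\<integral>\<omega>. noise_y M eps s \<omega> \<partial>M) = 0"
    using sq_integrable_integrable[OF eps_sq(1)] by (cases s) (simp_all add: noise_y_def eps_mean prob_space)
  then have m: "(\<integral>\<omega>. eps s \<omega> $ j - c $ j \<partial>M) = 0" for j
    using integrable_nth(2)[OF i, of j] by (simp add: ne)
  have "(\<integral>\<omega>. indicator A \<omega> *\<^sub>R noise_y M eps s \<omega> \<partial>M) $ j = 0" for j
    using eps_indep_F[OF A, of "\<lambda>x. x $ j - c $ j" s] integrable_nth[OF iA, of j]
      integrable_nth(1)[OF i, of j] by (simp add: ne m)
  then show ?thesis by (simp add: vec_eq_iff)
qed

text \<open>The decomposition is assumed only almost everywhere, since the state recursion itself
  contains versions of conditional expectations.\<close>

lemma cond_mean_eq: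
  fixes X a b :: "'w \<Rightarrow> real^'n"
  assumes X: "X \<in> borel_measurable M" and ab: "AE \<omega> in M. X \<omega> = a \<omega> + b \<omega>"
    and a: "integrable M a" and a0: "\<And>A. A \<in> sets (F t) \<Longrightarrow> (\<integral>\<omega>. indicator A \<omega> *\<^sub>R a \<omega> \<partial>M) = 0"
    and b: "integrable M b" "b \<in> borel_measurable (F t)"
  shows "AE \<omega> in M. cond_mean M eps0 t X \<omega> = b \<omega>"
proof -
  interpret sigma_finite_subalgebra M "F t" by (rule subalg_F)
  have "AE \<omega> in M. real_cond_exp M (F t) (\<lambda>\<omega>. X \<omega> $ i) \<omega> = b \<omega> $ i" for i
  proof (rule real_cond_exp_charact)
    have ia: "integrable M (\<lambda>\<omega>. a \<omega> $ i)" by (rule integrable_nth[OF a])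
    show ib: "integrable M (\<lambda>\<omega>. b \<omega> $ i)" by (rule integrable_nth[OF b(1)])
    have ae: "AE \<omega> in M. X \<omega> $ i = a \<omega> $ i + b \<omega> $ i" using ab by eventually_elim simp
    have mX: "(\<lambda>\<omega>. X \<omega> $ i) \<in> borel_measurable M" using X by measurable
    show "integrable M (\<lambda>\<omega>. X \<omega> $ i)"
      by (rule integrable_cong_AE_imp[OF Bochner_Integration.integrable_add[OF ia ib] mX]) (use ae in eventually_elim, simp)
    show "(\<lambda>\<omega>. b \<omega> $ i) \<in> borel_measurable (F t)" using b(2) by measurable
    fix A assume A: "A \<in> sets (F t)"
    then have AM: "A \<in> sets M" using F_subset by blast
    have "(\<integral>\<omega>\<in>A. X \<omega> $ i \<partial>M) = (\<integral>\<omega>. indicator A \<omega> *\<^sub>R a \<omega> $ i + indicator A \<omega> *\<^sub>R b \<omega> $ i \<partial>M)"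
      unfolding set_lebesgue_integral_def
    proof (rule integral_cong_AE)
      show "AE \<omega> in M. indicator A \<omega> *\<^sub>R X \<omega> $ i = indicator A \<omega> *\<^sub>R a \<omega> $ i + indicator A \<omega> *\<^sub>R b \<omega> $ i"
        using ae by eventually_elim (simp add: algebra_simps)
    qed (use mX AM ia ib in measurable)
    also have "\<dots> = (\<integral>\<omega>. indicator A \<omega> *\<^sub>R a \<omega> $ i \<partial>M) + (\<integral>\<omega>. indicator A \<omega> *\<^sub>R b \<omega> $ i \<partial>M)"
      by (intro Bochner_Integration.integral_add integrable_mult_indicator AM ia ib)
    also have "(\<integral>\<omega>. indicator A \<omega> *\<^sub>R a \<omega> $ i \<partial>M) = 0"
      using integrable_nth(2)[OF integrable_mult_indicator[OF AM a], of i] a0[OF A] by simp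
    finally show "(\<integral>\<omega>\<in>A. X \<omega> $ i \<partial>M) = (\<integral>\<omega>\<in>A. b \<omega> $ i \<partial>M)"
      by (simp add: set_lebesgue_integral_def)
  qed
  then have "AE \<omega> in M. \<forall>i. real_cond_exp M (F t) (\<lambda>\<omega>. X \<omega> $ i) \<omega> = b \<omega> $ i"
    by (subst AE_all_countable) auto
  then show ?thesis by eventually_elim (simp add: cond_mean_def vec_eq_iff)
qed

lemma cond_mean_measurable [measurable]: "cond_mean M eps0 t (X :: 'w \<Rightarrow> real^'n) \<in> borel_measurable M"
proof -
  interpret sigma_finite_subalgebra M "F t" by (rule subalg_F)
  show ?thesis by (rule borel_measurable_vec) (simp add: cond_mean_def)
qed

end

section \<open>Splitting of the closed loop into idiosyncratic and common parts\<close>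

lemma indicator_mult_vec:
  fixes G :: "real^'n^'m"
  assumes f: "integrable M f" and A: "A \<in> sets M"
  shows "(\<integral>\<omega>. indicator A \<omega> *\<^sub>R (G *v f \<omega>) \<partial>M) = G *v (\<integral>\<omega>. indicator A \<omega> *\<^sub>R f \<omega> \<partial>M)"
  using integral_bounded_linear[OF matrix_vector_mul_bounded_linear integrable_mult_indicator[OF A f], of G]
  by (simp add: matrix_vector_mult_scaleR)

lemma matrix_vector_mult_uminus: "(G::real^'n^'m) *v (- x) = - (G *v x)"
  by (rule linear_neg[OF matrix_vector_mul_linear])

locale mf_closed_loop = mf_problem M eps eps0
  for M :: "'w measure" and eps eps0 :: "nat \<Rightarrow> 'w \<Rightarrow> real^'d" +
  fixes A Ab :: "real^'d^'d" and B Bb :: "real^'l^'d" and K L :: "real^'d^'l"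
begin

definition "y = lq_state A B (noise_y M eps) K"
definition "z = lq_state (A + Ab) (B + Bb) (noise_z M eps eps0) L"
definition "X = mf_state M A Ab B Bb eps eps0 (K, L)"

lemma y_int: "sq_integrable M (y t)" "integrable M (y t)" "y t \<in> borel_measurable M"
proof -
  interpret lq_noise M "noise_y M eps" by (rule noise_y_lq)
  show "sq_integrable M (y t)" unfolding y_def by (rule state_sq)
  then show "integrable M (y t)" "y t \<in> borel_measurable M"
    by (auto intro: sq_integrable_integrable sq_integrable_measurable)
qed

lemma z_int: "sq_integrable M (z t)" "integrable M (z t)" "z t \<in> borel_measurable M"
proof -
  interpret lq_noise M "noise_z M eps eps0" by (rule noise_z_lq)
  show "sq_integrable M (z t)" unfolding z_def by (rule state_sq)
  then show "integrable M (z t)" "z t \<in> borel_measurable M"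
    by (auto intro: sq_integrable_integrable sq_integrable_measurable)
qed

lemma z_F: "z t \<in> borel_measurable (F t)"
proof (induction t)
  case 0
  show ?case unfolding z_def using eps0_F[of 0 0] by (simp add: noise_z_def)
next
  case (Suc t)
  have "z t \<in> borel_measurable (F (Suc t))"
    using Suc F_mono[of t "Suc t"] measurable_mono[of borel borel "F t" "F (Suc t)"] by auto
  moreover have "eps0 (Suc t) \<in> borel_measurable (F (Suc t))" by (rule eps0_F) simp
  ultimately show ?case unfolding z_def by (simp add: noise_z_def)
qed

lemma indicator_y:
  assumes S: "S \<in> sets (F r)"
  shows "(\<integral>\<omega>. indicator S \<omega> *\<^sub>R y t \<omega> \<partial>M) = 0"
proof (induction t)
  case 0
  show ?case unfolding y_def using indicator_noise_y[OF S] by simp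
next
  case (Suc t)
  interpret lq_noise M "noise_y M eps" by (rule noise_y_lq)
  have SM: "S \<in> sets M" using S F_subset by blast
  have "integrable M (\<lambda>\<omega>. indicator S \<omega> *\<^sub>R ((A - B ** K) *v y t \<omega>))"
    by (intro integrable_mult_indicator SM sq_integrable_integrable sq_integrable_mult_vec y_int)
  moreover have "integrable M (\<lambda>\<omega>. indicator S \<omega> *\<^sub>R noise_y M eps (Suc t) \<omega>)"
    by (intro integrable_mult_indicator SM sq_integrable_integrable w_sq)
  ultimately have "(\<integral>\<omega>. indicator S \<omega> *\<^sub>R y (Suc t) \<omega> \<partial>M) =
     (\<integral>\<omega>. indicator S \<omega> *\<^sub>R ((A - B ** K) *v y t \<omega>) \<partial>M) + (\<integral>\<omega>. indicator S \<omega> *\<^sub>R noise_y M eps (Suc t) \<omega> \<partial>M)"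
    by (simp add: y_def scaleR_add_right)
  also have "\<dots> = 0"
    using Suc indicator_noise_y[OF S] by (simp add: indicator_mult_vec[OF y_int(2) SM])
  finally show ?case .
qed

text \<open>Proved along the recursion: almost sure equality with the measurable
  \<open>y t + z t\<close> would not give measurability, as the space need not be complete.\<close>

lemma X_measurable: "X t \<in> borel_measurable M"
proof (induction t)
  case 0
  show ?case unfolding X_def using eps_sq[of 0] by (simp add: sq_integrable_measurable)
next
  case (Suc t)
  note [measurable] = Suc[unfolded X_def]
  have [measurable]: "eps (Suc t) \<in> borel_measurable M" "eps0 (Suc t) \<in> borel_measurable M"
    using eps_sq by (auto intro: sq_integrable_measurable)
  have [measurable]: "mf_control M eps0 (K, L) t (mf_state M A Ab B Bb eps eps0 (K, L) t) \<in> borel_measurable M"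
    unfolding mf_control_def by measurable
  show ?case unfolding X_def by (simp add: Let_def)
qed

text \<open>Stated relative to the splitting at time \<open>t\<close>, so that it can drive the
  induction for the splitting and then be reused in the cost.\<close>

lemma cond_mean_split:
  assumes ae: "AE \<omega> in M. X t \<omega> = y t \<omega> + z t \<omega>"
  shows "AE \<omega> in M. cond_mean M eps0 t (X t) \<omega> = z t \<omega>"
    and "AE \<omega> in M. mf_control M eps0 (K, L) t (X t) \<omega> = - (K *v y t \<omega>) + - (L *v z t \<omega>)"
    and "AE \<omega> in M. cond_mean M eps0 t (mf_control M eps0 (K, L) t (X t)) \<omega> = - (L *v z t \<omega>)"
proof -
  show 1: "AE \<omega> in M. cond_mean M eps0 t (X t) \<omega> = z t \<omega>"
    by (rule cond_mean_eq[OF X_measurable ae y_int(2) indicator_y z_int(2) z_F])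
  show 2: "AE \<omega> in M. mf_control M eps0 (K, L) t (X t) \<omega> = - (K *v y t \<omega>) + - (L *v z t \<omega>)"
    using ae 1 by eventually_elim (simp add: mf_control_def)
  have m: "mf_control M eps0 (K, L) t (X t) \<in> borel_measurable M"
    unfolding mf_control_def using X_measurable by measurable
  show "AE \<omega> in M. cond_mean M eps0 t (mf_control M eps0 (K, L) t (X t)) \<omega> = - (L *v z t \<omega>)"
  proof (rule cond_mean_eq[OF m 2])
    show "integrable M (\<lambda>\<omega>. - (K *v y t \<omega>))" "integrable M (\<lambda>\<omega>. - (L *v z t \<omega>))"
      by (intro integrable_minus sq_integrable_integrable sq_integrable_mult_vec y_int z_int)+
    show "(\<integral>\<omega>. indicator S \<omega> *\<^sub>R - (K *v y t \<omega>) \<partial>M) = 0" if "S \<in> sets (F t)" for S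
      using indicator_mult_vec[OF y_int(2)[of t], of S K] indicator_y[OF that, of t] that F_subset[of t] by auto
    show "(\<lambda>\<omega>. - (L *v z t \<omega>)) \<in> borel_measurable (F t)" using z_F[of t] by measurable
  qed
qed

lemma X_split: "AE \<omega> in M. X t \<omega> = y t \<omega> + z t \<omega>"
proof (induction t)
  case 0
  show ?case by (simp add: X_def y_def z_def noise_y_def noise_z_def)
next
  case (Suc t)
  note c = cond_mean_split[OF Suc]
  from Suc c show ?case
  proof eventually_elim
    case (elim \<omega>)
    have "X (Suc t) \<omega> = A *v X t \<omega> + Ab *v cond_mean M eps0 t (X t) \<omega>
               + B *v mf_control M eps0 (K, L) t (X t) \<omega> + Bb *v cond_mean M eps0 t (mf_control M eps0 (K, L) t (X t)) \<omega>
               + eps0 (Suc t) \<omega> + eps (Suc t) \<omega>"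
      by (simp add: X_def Let_def)
    also have "\<dots> = A *v (y t \<omega> + z t \<omega>) + Ab *v z t \<omega> + B *v (- (K *v y t \<omega>) + - (L *v z t \<omega>)) + Bb *v (- (L *v z t \<omega>))
               + eps0 (Suc t) \<omega> + eps (Suc t) \<omega>"
      unfolding elim ..
    also have "\<dots> = y (Suc t) \<omega> + z (Suc t) \<omega>"
      unfolding y_def z_def
      by (simp add: noise_y_def noise_z_def matrix_vector_mult_add_rdistrib matrix_vector_mult_diff_rdistrib
        matrix_vector_right_distrib matrix_vector_mult_uminus matrix_vector_mul_assoc
        matrix_add_rdistrib algebra_simps)
    finally show ?case .
  qed
qed

lemma mf_cost_eq:
  assumes \<gamma>: "0 \<le> \<gamma>" and psd: "pos_semidef Q" "pos_semidef (Q + Qb)" "pos_semidef R" "pos_semidef (R + Rb)"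
  shows "mf_cost M \<gamma> A Ab B Bb Q Qb R Rb eps eps0 (K, L) =
    lq_cost M \<gamma> A B Q R (noise_y M eps) K +
    lq_cost M \<gamma> (A + Ab) (B + Bb) (Q + Qb) (R + Rb) (noise_z M eps eps0) L"
proof -
  let ?u = "\<lambda>t. mf_control M eps0 (K, L) t (X t)"
  define a where "a t \<omega> = ennreal (\<gamma> ^ t * qform (Q + transpose K ** R ** K) (y t \<omega>))" for t \<omega>
  define b where "b t \<omega> = ennreal (\<gamma> ^ t * qform ((Q + Qb) + transpose L ** (R + Rb) ** L) (z t \<omega>))" for t \<omega>
  have [measurable]: "a t \<in> borel_measurable M" "b t \<in> borel_measurable M" for t
    unfolding a_def[abs_def] b_def[abs_def] using y_int(3) z_int(3) by measurable
  have qn: "qform S (- x) = qform S x" for S :: "real^'n^'n" and x by (simp add: qform_def matrix_vector_mult_uminus)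
  \<comment> \<open>There are countably many times, so one null set suffices to replace the whole
    series under the integral.\<close>
  have "AE \<omega> in M. \<forall>t. ennreal (\<gamma> ^ t *
        (qform Q (X t \<omega> - cond_mean M eps0 t (X t) \<omega>) + qform (Q + Qb) (cond_mean M eps0 t (X t) \<omega>)
          + qform R (?u t \<omega> - cond_mean M eps0 t (?u t) \<omega>) + qform (R + Rb) (cond_mean M eps0 t (?u t) \<omega>))) = a t \<omega> + b t \<omega>"
  proof (subst AE_all_countable, intro allI)
    fix t
    from X_split[of t] cond_mean_split[OF X_split[of t]]
    show "AE \<omega> in M. ennreal (\<gamma> ^ t *
        (qform Q (X t \<omega> - cond_mean M eps0 t (X t) \<omega>) + qform (Q + Qb) (cond_mean M eps0 t (X t) \<omega>)
          + qform R (?u t \<omega> - cond_mean M eps0 t (?u t) \<omega>) + qform (R + Rb) (cond_mean M eps0 t (?u t) \<omega>))) = a t \<omega> + b t \<omega>"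
    proof eventually_elim
      case (elim \<omega>)
      have q: "0 \<le> qform (Q + transpose K ** R ** K) x" "0 \<le> qform ((Q + Qb) + transpose L ** (R + Rb) ** L) x" for x
        by (intro pos_semidefD(2) pos_semidef_add psd pos_semidef_conj')+
      have "a t \<omega> + b t \<omega> = ennreal (\<gamma> ^ t * qform (Q + transpose K ** R ** K) (y t \<omega>)
          + \<gamma> ^ t * qform ((Q + Qb) + transpose L ** (R + Rb) ** L) (z t \<omega>))"
        unfolding a_def b_def using \<gamma> q by (intro ennreal_plus[symmetric] mult_nonneg_nonneg) auto
      also have "\<gamma> ^ t * qform (Q + transpose K ** R ** K) (y t \<omega>)
          + \<gamma> ^ t * qform ((Q + Qb) + transpose L ** (R + Rb) ** L) (z t \<omega>) =
          \<gamma> ^ t * (qform Q (y t \<omega>) + qform (Q + Qb) (z t \<omega>) + qform R (K *v y t \<omega>) + qform (R + Rb) (L *v z t \<omega>))"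
        unfolding qform_add[of Q "transpose K ** R ** K"] qform_add[of "Q + Qb" "transpose L ** (R + Rb) ** L"] qform_conj'
        by (simp add: algebra_simps)
      finally show ?case unfolding elim by (simp add: qn)
    qed
  qed
  then have "mf_cost M \<gamma> A Ab B Bb Q Qb R Rb eps eps0 (K, L) = (\<integral>\<^sup>+ \<omega>. (\<Sum>t. a t \<omega> + b t \<omega>) \<partial>M)"
    unfolding mf_cost_def Let_def X_def[symmetric] by (intro nn_integral_cong_AE) (erule eventually_mono, simp)
  also have "\<dots> = (\<integral>\<^sup>+ \<omega>. (\<Sum>t. a t \<omega>) + (\<Sum>t. b t \<omega>) \<partial>M)"
    by (intro nn_integral_cong suminf_add[symmetric] summableI)
  also have "\<dots> = (\<integral>\<^sup>+ \<omega>. (\<Sum>t. a t \<omega>) \<partial>M) + (\<integral>\<^sup>+ \<omega>. (\<Sum>t. b t \<omega>) \<partial>M)"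
    by (rule nn_integral_add) measurable
  finally show ?thesis by (simp add: lq_cost_def a_def b_def y_def z_def)
qed

end

subsection \<open>The step size condition\<close>

text \<open>For \<open>h = 0\<close> the hypothesis is void because the reciprocal is infinite, but
  the conclusion is then trivial.\<close>

lemma ereal_step_bound:
  assumes "ereal \<eta> \<le> ereal (1 / 4) * (1 / ereal h)" and "0 \<le> h"
  shows "\<eta> * h \<le> 1 / 4"
proof (cases "h = 0")
  case False
  then have "ereal (1 / 4) * (1 / ereal h) = ereal (1 / (4 * h))" using assms(2) by (simp add: one_ereal_def)
  then have "\<eta> \<le> 1 / (4 * h)" using assms(1) by simp
  then show ?thesis using False assms(2) by (simp add: field_simps)
qed simp

lemma step_size_bounds:
  assumes step: "ereal \<eta> \<le> ereal (1 / 4) * (1 / h_var \<gamma> B Q R lam C)"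
      "ereal \<eta> \<le> ereal (1 / 4) * (1 / h_hess \<gamma> B Q R lam C)"
    and \<eta>: "0 < \<eta>" and C: "0 < C" and lam: "0 < lam" and \<gamma>: "0 < \<gamma>"
    and R: "pos_def (R::real^'l^'l)" and Q: "pos_semidef (Q::real^'d^'d)"
  defines "\<rho> \<equiv> spec_norm R + \<gamma> * (spec_norm B)\<^sup>2 * (C / lam)" and "q \<equiv> lambda_min Q"
  shows "0 < q"
    and "\<eta> * (8 * ((1 + 1 / sqrt \<gamma>) * spec_norm B * C ^ 3) / (lam\<^sup>2 * q ^ 3) * sqrt (\<rho> * (C / lam))) \<le> 1 / 4"
    and "\<eta> * (2 * C / q * \<rho>) \<le> 1 / 4"
proof -
  have \<rho>: "0 < \<rho>" unfolding \<rho>_def using hess_factor_pos[OF R \<gamma> _ lam, of C B] C by simp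
  have "0 \<le> q" unfolding q_def
    by (rule lambda_min_ge) (use pos_semidefD[OF Q] in auto)
  \<comment> \<open>With positive cost a vanishing eigenvalue makes \<open>h_hess\<close> infinite,
    its reciprocal zero, and hence the step nonpositive.\<close>
  moreover have "q \<noteq> 0"
  proof
    assume "q = 0"
    then have "h_hess \<gamma> B Q R lam C = \<infinity>"
      unfolding h_hess_def q_def[symmetric] \<rho>_def[symmetric] using C \<rho> by (simp add: divide_ereal_def)
    then show False using step(2) \<eta> by simp
  qed
  ultimately show q: "0 < q" by simp
  have "h_var \<gamma> B Q R lam C =
      ereal (8 * ((1 + 1 / sqrt \<gamma>) * spec_norm B * C ^ 3) / (lam\<^sup>2 * q ^ 3) * sqrt (\<rho> * (C / lam)))"
    unfolding h_var_def q_def[symmetric] \<rho>_def[symmetric] using q lam by simp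
  from ereal_step_bound[OF step(1)[unfolded this]]
  show "\<eta> * (8 * ((1 + 1 / sqrt \<gamma>) * spec_norm B * C ^ 3) / (lam\<^sup>2 * q ^ 3) * sqrt (\<rho> * (C / lam))) \<le> 1 / 4"
    using q lam \<gamma> C \<rho> spec_norm_nonneg[of B] by simp
  have "h_hess \<gamma> B Q R lam C = ereal (2 * C / q * \<rho>)"
    unfolding h_hess_def q_def[symmetric] \<rho>_def[symmetric] using q by simp
  from ereal_step_bound[OF step(2)[unfolded this]]
  show "\<eta> * (2 * C / q * \<rho>) \<le> 1 / 4" using q C \<rho> by simp
qed

text \<open>Replacing \<open>1 - c\<close> by \<open>exp (- c)\<close> gives the logarithmic count
  and avoids powers of a factor that might be negative.\<close>

lemma geometric_tail:
  fixes e :: "nat \<Rightarrow> real"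
  assumes e: "\<And>k. 0 \<le> e k" "\<And>k. e (Suc k) \<le> (1 - c) * e k" and c: "0 < c" and tol: "0 < tol"
    and k: "1 / c * ln (1 / tol) \<le> real k"
  shows "e k \<le> tol * e 0"
proof -
  have "e n \<le> exp (- c * real n) * e 0" for n
  proof (induction n)
    case (Suc n)
    have "e (Suc n) \<le> (1 - c) * e n" by (rule e)
    also have "\<dots> \<le> exp (- c) * e n"
      using exp_ge_add_one_self[of "- c"] e(1) by (intro mult_right_mono) auto
    also have "\<dots> \<le> exp (- c) * (exp (- c * real n) * e 0)" using Suc by (intro mult_left_mono) auto
    also have "\<dots> = exp (- c * real (Suc n)) * e 0" by (simp add: exp_add[symmetric] algebra_simps)
    finally show ?case .
  qed simp
  also have "exp (- c * real k) * e 0 \<le> tol * e 0"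
  proof (rule mult_right_mono[OF _ e(1)])
    have "ln (1 / tol) \<le> c * real k" using k c by (simp add: field_simps)
    then have "- c * real k \<le> ln tol" using tol by (simp add: ln_div)
    then show "exp (- c * real k) \<le> tol" using tol by (metis exp_le_cancel_iff exp_ln)
  qed
  finally show ?thesis .
qed

text \<open>The identity is a Lyapunov witness. This is how the norm condition on the initial gains
  enters.\<close>

lemma (in lq_problem) stable_spec_norm:
  assumes K: "\<gamma> * (spec_norm (A - B ** K))\<^sup>2 < 1"
  shows "stable K"
  unfolding lyap_stable_def
proof (intro exI[of _ "mat 1"] exI[of _ "1 - \<gamma> * (spec_norm (A - B ** K))\<^sup>2"] conjI allI pos_semidef_mat1)
  fix x
  have "qform (cl K ** mat 1 ** transpose (cl K)) x = \<gamma> * (norm (transpose (A - B ** K) *v x))\<^sup>2"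
    unfolding qform_conj qform_mat1 power2_norm_eq_inner[symmetric] using \<gamma>
    by (simp add: cl_def transpose_scalar scaleR_matrix_vector_assoc[symmetric] power_mult_distrib)
  also have "\<dots> \<le> \<gamma> * (spec_norm (A - B ** K) * norm x)\<^sup>2"
    using \<gamma> by (intro mult_left_mono power_mono norm_transpose_vector_le) auto
  finally show "(1 - \<gamma> * (spec_norm (A - B ** K))\<^sup>2) * (x \<bullet> x) \<le> qform (mat 1 - cl K ** mat 1 ** transpose (cl K)) x"
    by (simp only: qform_diff qform_mat1) (simp add: power_mult_distrib power2_norm_eq_inner algebra_simps)
qed (use K in simp)

lemma (in lq_control) pl_const_pos:
  assumes "lam = lq_lambda M \<gamma> w" and Ks: "stable Ks"
  shows "pl_const M \<gamma> A B R w Ks = 4 * lam\<^sup>2 * lambda_min R / spec_norm (Sig Ks)"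
    and "0 < pl_const M \<gamma> A B R w Ks" and "0 < spec_norm (Sig Ks)"
proof -
  show eq: "pl_const M \<gamma> A B R w Ks = 4 * lam\<^sup>2 * lambda_min R / spec_norm (Sig Ks)"
    unfolding pl_const_def lq_Sigma_eq[OF Ks] assms(1)[symmetric] ..
  have "Sig Ks \<noteq> 0" using Sig_trace_pos[OF Ks] lam by auto
  then show s: "0 < spec_norm (Sig Ks)" by (rule spec_norm_pos)
  show "0 < pl_const M \<gamma> A B R w Ks" unfolding eq using s lam lambda_min_pos_def[OF R] by simp
qed

lemma (in lq_control) enn2real_lq_cost: "stable K \<Longrightarrow> enn2real (lq_cost M \<gamma> A B Q R w K) = J K"
  by (simp only: lq_cost_eq enn2real_ennreal J_nonneg)

text \<open>The rate may be any number up to the problem's own one, so that both problems can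
  contract with the smaller rate; the weakening needs a nonnegative cost gap.\<close>

lemma (in lq_control) gradient_step:
  assumes lam_def: "lam = lq_lambda M \<gamma> w" and K: "stable K" and J: "J K \<le> C"
    and C: "0 < C" and \<eta>: "0 < \<eta>" and Ks: "stable Ks" "J Ks \<le> J K"
    and step: "ereal \<eta> \<le> ereal (1 / 4) * (1 / h_var \<gamma> B Q R lam C)"
      "ereal \<eta> \<le> ereal (1 / 4) * (1 / h_hess \<gamma> B Q R lam C)"
    and \<nu>: "\<nu> \<le> pl_const M \<gamma> A B R w Ks / 2"
  defines "K' \<equiv> K - \<eta> *\<^sub>R grad (\<lambda>K'. enn2real (lq_cost M \<gamma> A B Q R w K')) K"
  shows "stable K'" and "J K' \<le> J K" and "J K' - J Ks \<le> (1 - \<eta> * \<nu>) * (J K - J Ks)"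
proof -
  note sb = step_size_bounds[OF step \<eta> C lam \<gamma> R Q]
  have K': "K' = K - \<eta> *\<^sub>R (2 *\<^sub>R (Eg (Pk K) K ** Sig K))"
    unfolding K'_def using grad_cost[OF K enn2real_lq_cost] by simp
  note d = descent[OF K J \<gamma>1 sb(1) lambda_min_attained(2)[OF pos_semidefD(1)[OF Q]] \<eta> refl sb(2,3), folded K']
  show "stable K'" by (rule d(1))
  have "0 \<le> 2 * \<eta> * (norm (Eg (Pk K) K ** Sig K))\<^sup>2" using \<eta> by simp
  then show "J K' \<le> J K" using d(2) by linarith
  have Rs: "symmetric R" using R by (simp add: pos_def_def)
  have "J K' - J Ks \<le> (1 - \<eta> * (pl_const M \<gamma> A B R w Ks / 2)) * (J K - J Ks)"
    unfolding pl_const_pos(1)[OF lam_def Ks(1)]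
    by (rule contraction[OF K Ks(1) lambda_min_pos_def[OF R] lambda_min_attained(2)[OF Rs]
        pl_const_pos(3)[OF lam_def Ks(1)] qform_le_spec_norm \<eta> d(2)])
  also have "\<dots> \<le> (1 - \<eta> * \<nu>) * (J K - J Ks)"
    using \<nu> \<eta> Ks(2) by (intro mult_right_mono) auto
  finally show "J K' - J Ks \<le> (1 - \<eta> * \<nu>) * (J K - J Ks)" .
qed

lemma (in lq_control) gradient_step_zero:
  assumes K: "stable K" and J: "J K = 0"
  shows "grad (\<lambda>K'. enn2real (lq_cost M \<gamma> A B Q R w K')) K = 0"
  using grad_cost[OF K enn2real_lq_cost] zero_cost(3)[OF K J] by simp

theorem theorem23:
  fixes M :: "'w measure"
    and \<gamma> \<eta> :: real
    and A Ab Q Qb Py Pz :: "real^'d^'d"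
    and B Bb :: "real^'l^'d"
    and R Rb :: "real^'l^'l"
    and eps eps0 :: "nat \<Rightarrow> 'w \<Rightarrow> real^'d"
    and K L :: "nat \<Rightarrow> real^'d^'l"
  defines "C \<equiv> mf_cost M \<gamma> A Ab B Bb Q Qb R Rb eps eps0"
    and "wy \<equiv> noise_y M eps"
    and "wz \<equiv> noise_z M eps eps0"
  defines "Cy \<equiv> lq_cost M \<gamma> A B Q R wy"
    and "Cz \<equiv> lq_cost M \<gamma> (A + Ab) (B + Bb) (Q + Qb) (R + Rb) wz"
    and "Kopt \<equiv> optimal_gain \<gamma> A B R Py"
    and "Lopt \<equiv> optimal_gain \<gamma> (A + Ab) (B + Bb) (R + Rb) Pz"
    and "lam_y \<equiv> lq_lambda M \<gamma> wy"
    and "lam_z \<equiv> lq_lambda M \<gamma> wz"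
    and "C0 \<equiv> enn2real (C (K 0, L 0))"
  defines "\<nu> \<equiv> min (pl_const M \<gamma> A B R wy Kopt)
                   (pl_const M \<gamma> (A + Ab) (B + Bb) (R + Rb) wz Lopt) / 2"
  assumes gamma: "0 < \<gamma>" "\<gamma> < 1"
    and noise: "mf_noise M eps eps0"
    and stable: "\<gamma> * (spec_norm A)\<^sup>2 < 1" "\<gamma> * (spec_norm (A + Ab))\<^sup>2 < 1"
    and sym: "symmetric Q" "symmetric Qb" "symmetric R" "symmetric Rb"
    and psd: "pos_semidef Q" "pos_semidef (Q + Qb)"
    and pd: "pos_def R" "pos_def (R + Rb)"
    and nondeg:
      "max (lambda_min (second_moment M (wy 0))) (lambda_min (second_moment M (wy 1))) > 0"
      "max (lambda_min (second_moment M (wz 0))) (lambda_min (second_moment M (wz 1))) > 0"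
    and riccati: "riccati_solution \<gamma> A B Q R Py"
      "riccati_solution \<gamma> (A + Ab) (B + Bb) (Q + Qb) (R + Rb) Pz"
    and init: "(K 0, L 0) \<in> admissible \<gamma> A Ab B Bb"
    and step_pos: "0 < \<eta>"
    and descent:
      "\<And>k. K (Suc k) = K k - \<eta> *\<^sub>R grad (\<lambda>K'. enn2real (Cy K')) (K k)"
      "\<And>k. L (Suc k) = L k - \<eta> *\<^sub>R grad (\<lambda>L'. enn2real (Cz L')) (L k)"
    and step_size:
      "ereal \<eta> \<le> ereal (1 / 4) *
         Min {1 / h_var \<gamma> B Q R lam_y C0,
              1 / h_hess \<gamma> B Q R lam_y C0,
              1 / h_var \<gamma> (B + Bb) (Q + Qb) (R + Rb) lam_z C0,
              1 / h_hess \<gamma> (B + Bb) (Q + Qb) (R + Rb) lam_z C0}"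
  shows "C (K 0, L 0) < \<infinity> \<and> C (Kopt, Lopt) < \<infinity> \<and>
    (\<forall>k. C (K (Suc k), L (Suc k)) \<le> C (K k, L k) \<and> C (K k, L k) \<le> C (K 0, L 0) \<and>
         enn2real (C (K (Suc k), L (Suc k))) - enn2real (C (Kopt, Lopt))
           \<le> (1 - \<eta> * \<nu>) * (enn2real (C (K k, L k)) - enn2real (C (Kopt, Lopt)))) \<and>
    (\<forall>tol>0. \<forall>k. real k \<ge> 1 / (\<eta> * \<nu>) * ln (1 / tol) \<longrightarrow>
         enn2real (C (K k, L k)) - enn2real (C (Kopt, Lopt))
           \<le> tol * (enn2real (C (K 0, L 0)) - enn2real (C (Kopt, Lopt))))"
proof -
  interpret mf_problem M eps eps0 by unfold_locales (rule noise)
  interpret wy: lq_noise M wy unfolding wy_def by (rule noise_y_lq)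
  interpret wz: lq_noise M wz unfolding wz_def by (rule noise_z_lq)
  note ly = wy.lq_lambda_pos[OF gamma nondeg(1), folded lam_y_def]
  note lz = wz.lq_lambda_pos[OF gamma nondeg(2), folded lam_z_def]
  interpret y: lq_control M wy \<gamma> A B Q R lam_y
    by unfold_locales (use gamma psd pd ly in auto)
  interpret z: lq_control M wz \<gamma> "A + Ab" "B + Bb" "Q + Qb" "R + Rb" lam_z
    by unfold_locales (use gamma psd pd lz in auto)
  have C_eq: "C (k, l) = ennreal (y.J k + z.J l)" if "y.stable k" "z.stable l" for k l
  proof -
    interpret mf_closed_loop M eps eps0 A Ab B Bb k l ..
    have "C (k, l) = Cy k + Cz l"
      unfolding C_def Cy_def Cz_def wy_def wz_def
      using gamma psd y.R_psd z.R_psd by (intro mf_cost_eq) auto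
    then show ?thesis
      using y.lq_cost_eq[OF that(1)] z.lq_cost_eq[OF that(2)] y.J_nonneg[OF that(1)] z.J_nonneg[OF that(2)]
      by (simp add: Cy_def Cz_def ennreal_plus)
  qed
  have K0: "y.stable (K 0)" and L0: "z.stable (L 0)"
    using init by (auto simp: admissible_def intro: y.stable_spec_norm z.stable_spec_norm)
  have C0: "C0 = y.J (K 0) + z.J (L 0)"
    unfolding C0_def C_eq[OF K0 L0] using y.J_nonneg[OF K0] z.J_nonneg[OF L0] by (intro enn2real_ennreal add_nonneg_nonneg)
  have C0_nonneg: "0 \<le> C0" unfolding C0 using y.J_nonneg[OF K0] z.J_nonneg[OF L0] by simp
  have steps: "ereal \<eta> \<le> ereal (1 / 4) * h"
    if "h \<in> {1 / h_var \<gamma> B Q R lam_y C0, 1 / h_hess \<gamma> B Q R lam_y C0,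
              1 / h_var \<gamma> (B + Bb) (Q + Qb) (R + Rb) lam_z C0,
              1 / h_hess \<gamma> (B + Bb) (Q + Qb) (R + Rb) lam_z C0}" for h
    by (rule order_trans[OF step_size ereal_mult_left_mono[OF Min_le[OF _ that]]]) simp_all
  have opt: "y.stable Kopt \<and> z.stable Lopt \<and>
    (\<forall>k. y.stable (K k) \<and> z.stable (L k) \<and>
      y.J (K (Suc k)) \<le> y.J (K k) \<and> z.J (L (Suc k)) \<le> z.J (L k) \<and>
      y.J (K (Suc k)) - y.J Kopt \<le> (1 - \<eta> * \<nu>) * (y.J (K k) - y.J Kopt) \<and>
      z.J (L (Suc k)) - z.J Lopt \<le> (1 - \<eta> * \<nu>) * (z.J (L k) - z.J Lopt))"
  \<comment> \<open>For zero initial cost the step size condition is void, so the iteration has to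
    be shown not to move at all.\<close>
  proof (cases "C0 = 0")
    case True
    then have J0: "y.J (K 0) = 0" "z.J (L 0) = 0"
      using C0 y.J_nonneg[OF K0] z.J_nonneg[OF L0] by auto
    note zy = y.zero_cost[OF K0 J0(1)] and zz = z.zero_cost[OF L0 J0(2)]
    have "Kopt = 0" unfolding Kopt_def
      by (rule y.riccati_zero[OF riccati(1) zy(1)]) (use K0 zy(2) in simp)
    moreover have "Lopt = 0" unfolding Lopt_def
      by (rule z.riccati_zero[OF riccati(2) zz(1)]) (use L0 zz(2) in simp)
    moreover have "K k = 0 \<and> L k = 0" for k
    proof (induction k)
      case 0
      then show ?case using zy(2) zz(2) by simp
    next
      case (Suc k)
      then show ?case
        using descent[of k] y.gradient_step_zero[OF K0 J0(1)] z.gradient_step_zero[OF L0 J0(2)] zy(2) zz(2)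
        by (simp add: Cy_def Cz_def)
    qed
    ultimately show ?thesis using K0 L0 J0 zy(2) zz(2) by simp
  next
    case False
    then have C0_pos: "0 < C0" using C0_nonneg by simp
    note sy = steps[of "1 / h_var \<gamma> B Q R lam_y C0"] steps[of "1 / h_hess \<gamma> B Q R lam_y C0"]
    note sz = steps[of "1 / h_var \<gamma> (B + Bb) (Q + Qb) (R + Rb) lam_z C0"]
      steps[of "1 / h_hess \<gamma> (B + Bb) (Q + Qb) (R + Rb) lam_z C0"]
    have Kopt: "y.stable Kopt" unfolding Kopt_def
      by (rule y.riccati_stable[OF riccati(1) step_size_bounds(1)[OF sy step_pos C0_pos ly(2) gamma(1) pd(1) psd(1)]
        lambda_min_attained(2)[OF pos_semidefD(1)[OF psd(1)]]]) simp_all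
    have Lopt: "z.stable Lopt" unfolding Lopt_def
      by (rule z.riccati_stable[OF riccati(2) step_size_bounds(1)[OF sz step_pos C0_pos lz(2) gamma(1) pd(2) psd(2)]
        lambda_min_attained(2)[OF pos_semidefD(1)[OF psd(2)]]]) simp_all
    have \<nu>: "\<nu> \<le> pl_const M \<gamma> A B R wy Kopt / 2"
        "\<nu> \<le> pl_const M \<gamma> (A + Ab) (B + Bb) (R + Rb) wz Lopt / 2"
      by (auto simp: \<nu>_def)
    have yopt: "y.J Kopt \<le> y.J k" if "y.stable k" for k
      unfolding Kopt_def by (rule y.riccati_optimal[OF riccati(1) Kopt[unfolded Kopt_def] that])
    have zopt: "z.J Lopt \<le> z.J l" if "z.stable l" for l
      unfolding Lopt_def by (rule z.riccati_optimal[OF riccati(2) Lopt[unfolded Lopt_def] that])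
    have gy: "y.stable (K (Suc k)) \<and> y.J (K (Suc k)) \<le> y.J (K k) \<and>
        y.J (K (Suc k)) - y.J Kopt \<le> (1 - \<eta> * \<nu>) * (y.J (K k) - y.J Kopt)"
      if "y.stable (K k)" "y.J (K k) \<le> C0" for k
      using y.gradient_step[OF meta_eq_to_obj_eq[OF lam_y_def] that C0_pos step_pos Kopt yopt[OF that(1)] sy \<nu>(1)]
      by (simp add: descent(1) Cy_def)
    have gz: "z.stable (L (Suc k)) \<and> z.J (L (Suc k)) \<le> z.J (L k) \<and>
        z.J (L (Suc k)) - z.J Lopt \<le> (1 - \<eta> * \<nu>) * (z.J (L k) - z.J Lopt)"
      if "z.stable (L k)" "z.J (L k) \<le> C0" for k
      using z.gradient_step[OF meta_eq_to_obj_eq[OF lam_z_def] that C0_pos step_pos Lopt zopt[OF that(1)] sz \<nu>(2)]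
      by (simp add: descent(2) Cz_def)
    \<comment> \<open>Each cost alone stays below the total \<open>C0\<close>, because the other one
      is nonnegative at the start; this is why one \<open>C0\<close> can appear in both step size
      conditions.\<close>
    have "y.stable (K k) \<and> y.J (K k) \<le> C0 \<and> z.stable (L k) \<and> z.J (L k) \<le> C0" for k
    proof (induction k)
      case 0
      then show ?case using K0 L0 C0 y.J_nonneg[OF K0] z.J_nonneg[OF L0] by simp
    next
      case (Suc k)
      then show ?case using gy[of k] gz[of k] by auto
    qed
    then show ?thesis using Kopt Lopt gy gz by blast
  qed
  then have Ks: "y.stable Kopt" "z.stable Lopt" and st: "\<And>k. y.stable (K k)" "\<And>k. z.stable (L k)"
    by auto
  define e where "e k = (y.J (K k) - y.J Kopt) + (z.J (L k) - z.J Lopt)" for k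
  have C_real: "enn2real (C (k, l)) = y.J k + z.J l" if "y.stable k" "z.stable l" for k l
    unfolding C_eq[OF that] using y.J_nonneg[OF that(1)] z.J_nonneg[OF that(2)] by (intro enn2real_ennreal add_nonneg_nonneg)
  have e: "enn2real (C (K k, L k)) - enn2real (C (Kopt, Lopt)) = e k" for k
    unfolding C_real[OF st] C_real[OF Ks] e_def by simp
  have e_step: "e (Suc k) \<le> (1 - \<eta> * \<nu>) * e k" for k
    using opt unfolding e_def distrib_left by (meson add_mono)
  have e_nonneg: "0 \<le> e k" for k
    unfolding e_def
    using y.riccati_optimal[OF riccati(1) Ks(1)[unfolded Kopt_def] st(1)[of k], folded Kopt_def]
      z.riccati_optimal[OF riccati(2) Ks(2)[unfolded Lopt_def] st(2)[of k], folded Lopt_def] by simp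
  have \<nu>_pos: "0 < \<nu>"
    unfolding \<nu>_def using y.pl_const_pos(2)[OF meta_eq_to_obj_eq[OF lam_y_def] Ks(1)]
      z.pl_const_pos(2)[OF meta_eq_to_obj_eq[OF lam_z_def] Ks(2)] by simp
  have dec: "C (K (Suc k), L (Suc k)) \<le> C (K k, L k)" for k
    unfolding C_eq[OF st] using opt by (intro ennreal_leI add_mono) auto
  have dec0: "C (K k, L k) \<le> C (K 0, L 0)" for k
    by (induction k) (auto intro: order_trans[OF dec])
  show ?thesis
    unfolding e
  proof (intro conjI allI impI)
    show "C (K 0, L 0) < \<infinity>" "C (Kopt, Lopt) < \<infinity>"
      unfolding C_eq[OF st] C_eq[OF Ks] by simp_all
    show "e k \<le> tol * e 0" if "0 < tol" "1 / (\<eta> * \<nu>) * ln (1 / tol) \<le> real k" for tol k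
      using geometric_tail[of e "\<eta> * \<nu>" tol k] that e_nonneg e_step step_pos \<nu>_pos by simp
  qed (rule dec dec0 e_step)+
qed

end
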